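(* Let $G$ be a locally convex Lie group and $\mathcal U$ a $G$-admissible Grothendieck universe. Then the (smooth) simplicial set $BG^{\mathcal U}$, whose $k$-simplices are the $\mathcal U$-small simplicial $G$-bundles over $\Delta^k_\bullet$, is a Kan complex.
   Context: $\Delta^n=\{x\in\mathbb{R}^n:x_i\ge0,\sum x_i\le1\}$; maps from it are smooth if they extend smoothly to a neighborhood. $\Delta^d_\bullet$ is the simplicial set with $\Delta^d_\bullet(k)=$ smooth maps $\Delta^k\to\Delta^d$; a smooth $\sigma:\Delta^k\to\Delta^d$ induces $\sigma_\bullet:\Delta^k_\bullet\to\Delta^d_\bullet$, $\rho\mapsto\sigma\circ\rho$. Call a simplicial map $\Delta^d_\bullet\to\Delta^n_\bullet$ smooth if it is of the form $\sigma_\bullet$. $\Delta^{sm}(\Delta^n_\bullet)$ is the category whose objects are smooth maps $\Sigma:\Delta^d_\bullet\to\Delta^n_\bullet$ ($d\ge0$), and whose morphisms $f:\Sigma_1\to\Sigma_2$ are smooth maps $\widetilde f:\Delta^{d_1}\to\Delta^{d_2}$ with $\Sigma_2\circ\widetilde f_\bullet=\Sigma_1$. A smooth $f:\Delta^m_\bullet\to\Delta^n_\bullet$ induces $\Delta^{sm}f:\Sigma\mapsto f\circ\Sigma$. A smooth $G$-bundle over $\Delta^n$ is a topological principal $G$-bundle with a maximal atlas of local trivializations over open subsets $U_i\subset\Delta^n$ whose transition maps extend to smooth maps $N\times G\to N\times G$, $N\supset U_i\cap U_j$ open in $\mathbb{R}^n$. $\mathcal G$ is the category of smooth principal $G$-bundles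 over the simplices $\Delta^n$, $n\ge0$, with morphisms smooth $G$-bundle maps over smooth maps of simplices. A simplicial $G$-bundle $P$ over $\Delta^n_\bullet$ is a functor $P:\Delta^{sm}(\Delta^n_\bullet)\to\mathcal G$ such that $P_\Sigma=P(\Sigma)$ is a bundle over $\Delta^d$ for $\Sigma:\Delta^d_\bullet\to\Delta^n_\bullet$, and $P(f)$ covers $\widetilde f$. Pull-back: $f^*P=P\circ\Delta^{sm}f$. A Grothendieck universe $\mathcal U$ is $G$-admissible if $G\in\mathcal U$ and $\Delta^n\in\mathcal U$ for all $n$. A simplicial $G$-bundle $P$ over $\Delta^n_\bullet$ is $\mathcal U$-small if each $P_\Sigma\in\mathcal U$ (and each $\Delta^n_\bullet(k)\in\mathcal U$, automatic here). The simplicial structure of $BG^{\mathcal U}$ is: for $i\in\hom_\Delta(m,n)$, with corresponding affine map $i:\Delta^m\to\Delta^n$, $BG^{\mathcal U}(i)(P)=i_\bullet^*P$. *)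

theory Defs
  imports
    "HOL-Analysis.Analysis"
    "HOL-Analysis.Abstract_Euclidean_Space"
    "HOL-Algebra.Group"
    "HOL-Library.Function_Algebras"
begin

section \<open>Sets and Grothendieck universes\<close>

text \<open>A type that is a model of ZF set theory: \<^term>\<open>elts x\<close> is the collection of the elements
  of the set \<open>x\<close>, and a collection is a set iff it is in \<^term>\<open>range elts\<close>. Separation and
  replacement are required for arbitrary HOL predicates and functions; the axiom of choice comes
  from HOL.\<close>

class zf_sets =
  fixes elts :: "'a \<Rightarrow> 'a set"
  assumes zf_extensionality: "elts x = elts y \<Longrightarrow> x = y"
    and zf_separation: "Y \<subseteq> elts x \<Longrightarrow> Y \<in> range elts"
    and zf_union: "(\<Union>y\<in>elts x. elts y) \<in> range elts"
    and zf_power: "{y. elts y \<subseteq> elts x} \<in> range elts"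
    and zf_replacement: "f ` elts x \<in> range elts"
    and zf_infinity: "range (g :: nat \<Rightarrow> 'a) \<in> range elts"
    and zf_foundation: "wf {(x, y). x \<in> elts y}"

definition vset :: "'a set \<Rightarrow> 'a::zf_sets" where
  "vset A = (THE x. elts x = A)"

definition belongs_to :: "'a set \<Rightarrow> 'a::zf_sets \<Rightarrow> bool" where
  "belongs_to A U \<longleftrightarrow> (\<exists>a\<in>elts U. elts a = A)"

definition grothendieck_universe :: "'a::zf_sets \<Rightarrow> bool" where
  "grothendieck_universe U \<longleftrightarrow>
     (\<forall>x\<in>elts U. elts x \<subseteq> elts U) \<and>
     (\<forall>x\<in>elts U. \<forall>y\<in>elts U. belongs_to {x, y} U) \<and>
     (\<forall>x\<in>elts U. belongs_to {y. elts y \<subseteq> elts x} U) \<and>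
     (\<forall>I\<in>elts U. \<forall>f. f ` elts I \<subseteq> elts U \<longrightarrow> belongs_to (\<Union>i\<in>elts I. elts (f i)) U)"

text \<open>Set-theoretic codes of points of \<open>\<real>\<^sup>n\<close>: von Neumann numerals, Kuratowski pairs, and
  Dedekind cuts, where a triple \<open>(a, b, c)\<close> of naturals with \<open>c > 0\<close> stands for the
  rational number \<open>(a - b) / c\<close>; a point of \<open>\<real>\<^sup>n\<close> is coded by the graph of the
  function \<open>{0..<n} \<rightarrow> \<real>\<close>.\<close>

primrec vnat :: "nat \<Rightarrow> 'a::zf_sets" where
  "vnat 0 = vset {}"
| "vnat (Suc n) = vset (insert (vnat n) (elts (vnat n)))"

definition vpair :: "'a::zf_sets \<Rightarrow> 'a \<Rightarrow> 'a" where
  "vpair x y = vset {vset {x}, vset {x, y}}"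

definition vreal :: "real \<Rightarrow> 'a::zf_sets" where
  "vreal r = vset {vpair (vnat a) (vpair (vnat b) (vnat c)) | a b c.
      c > 0 \<and> (real a - real b) / real c < r}"

definition vpoint :: "nat \<Rightarrow> (nat \<Rightarrow> real) \<Rightarrow> 'a::zf_sets" where
  "vpoint n x = vset ((\<lambda>i. vpair (vnat i) (vreal (x i))) ` {..<n})"

section \<open>Smooth maps in locally convex spaces\<close>

class locally_convex_space = real_vector + t2_space + topological_ab_group_add +
  assumes tendsto_scaleR_Pair:
      "LIM p (nhds (a :: real) \<times>\<^sub>F nhds x). fst p *\<^sub>R snd p :> nhds (a *\<^sub>R x)"
    and locally_convex_raw: "open S \<Longrightarrow> 0 \<in> S \<Longrightarrow> \<exists>C. open C \<and> 0 \<in> C \<and> C \<subseteq> S \<and>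
      (\<forall>x\<in>C. \<forall>y\<in>C. \<forall>u\<ge>0. \<forall>v\<ge>0. u + v = 1 \<longrightarrow> u *\<^sub>R x + v *\<^sub>R y \<in> C)"

lemma locally_convex:
  fixes S :: "'a::locally_convex_space set"
  assumes "open S" "0 \<in> S"
  shows "\<exists>C. open C \<and> 0 \<in> C \<and> convex C \<and> C \<subseteq> S"
  using locally_convex_raw[OF assms] unfolding convex_def by blast

instantiation "fun" :: (type, real_vector) real_vector
begin

definition scaleR_fun :: "real \<Rightarrow> ('a \<Rightarrow> 'b) \<Rightarrow> 'a \<Rightarrow> 'b" where
  "scaleR_fun c f = (\<lambda>x. c *\<^sub>R f x)"

instance
  by standard (simp_all add: scaleR_fun_def plus_fun_def fun_eq_iff algebra_simps)

end

text \<open>Smoothness in the sense of Michal--Bastiani for a map on an open subset \<open>N\<close> of a linear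
  subspace \<open>W\<close>: all iterated directional derivatives \<open>D\<^sub>k x v = d\<^sup>k f (x; v\<^sub>0, \<dots>, v\<^sub>k\<^sub>-\<^sub>1)\<close> in
  directions from \<open>W\<close> exist and are jointly continuous. The directions are given as an infinite
  sequence, of which \<open>D\<^sub>k\<close> necessarily uses only the first \<open>k\<close> entries, so that continuity
  for the product topology on sequences is continuity on \<open>N \<times> W\<^sup>k\<close>.\<close>

definition bastiani_smooth_on ::
  "'a set \<Rightarrow> 'a set \<Rightarrow> ('a::{real_vector,topological_space} \<Rightarrow> 'b::{real_vector,topological_space}) \<Rightarrow> bool"
where
  "bastiani_smooth_on W N f \<longleftrightarrow>
     openin (top_of_set W) N \<and>
     (\<exists>D :: nat \<Rightarrow> 'a \<Rightarrow> (nat \<Rightarrow> 'a) \<Rightarrow> 'b.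
        (\<forall>x\<in>N. \<forall>v\<in>UNIV \<rightarrow> W. D 0 x v = f x) \<and>
        (\<forall>k. \<forall>x\<in>N. \<forall>v\<in>UNIV \<rightarrow> W.
           ((\<lambda>t::real. (D k (x + t *\<^sub>R v k) v - D k x v) /\<^sub>R t) \<longlongrightarrow> D (Suc k) x v) (at 0)) \<and>
        (\<forall>k. continuous_on (N \<times> (UNIV \<rightarrow> W)) (\<lambda>(x, v). D k x v)))"

record ('m, 'e) manifold =
  mtop :: "'m topology"
  model :: "'e set"
  charts :: "('m set \<times> ('m \<Rightarrow> 'e)) set"

definition locally_convex_manifold :: "('m, 'e::locally_convex_space) manifold \<Rightarrow> bool" where
  "locally_convex_manifold M \<longleftrightarrow>
     Hausdorff_space (mtop M) \<and> subspace (model M) \<and>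
     (\<Union>(U, \<phi>)\<in>charts M. U) = topspace (mtop M) \<and>
     (\<forall>(U, \<phi>)\<in>charts M.
        openin (mtop M) U \<and> openin (top_of_set (model M)) (\<phi> ` U) \<and>
        homeomorphic_map (subtopology (mtop M) U) (top_of_set (\<phi> ` U)) \<phi>) \<and>
     (\<forall>(U, \<phi>)\<in>charts M. \<forall>(V, \<psi>)\<in>charts M.
        bastiani_smooth_on (model M) (\<phi> ` (U \<inter> V)) (\<psi> \<circ> inv_into U \<phi>))"

definition smooth_map ::
  "('m, 'a::{real_vector,topological_space}) manifold \<Rightarrow>
   ('k, 'b::{real_vector,topological_space}) manifold \<Rightarrow> ('m \<Rightarrow> 'k) \<Rightarrow> bool"
where
  "smooth_map M K f \<longleftrightarrow>
     continuous_map (mtop M) (mtop K) f \<and>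
     (\<forall>(U, \<phi>)\<in>charts M. \<forall>(V, \<psi>)\<in>charts K.
        bastiani_smooth_on (model M) (\<phi> ` (U \<inter> f -` V)) (\<psi> \<circ> f \<circ> inv_into U \<phi>))"

definition prod_manifold ::
  "('m, 'a) manifold \<Rightarrow> ('k, 'b) manifold \<Rightarrow> ('m \<times> 'k, 'a \<times> 'b) manifold"
where
  "prod_manifold M K =
     \<lparr>mtop = prod_topology (mtop M) (mtop K),
      model = model M \<times> model K,
      charts = {(U \<times> V, map_prod \<phi> \<psi>) | U \<phi> V \<psi>. (U, \<phi>) \<in> charts M \<and> (V, \<psi>) \<in> charts K}\<rparr>"

text \<open>Throughout, \<open>\<real>\<^sup>n\<close> is the subspace \<open>{x. \<forall>i\<ge>n. x i = 0}\<close> of \<open>nat \<Rightarrow> real\<close> underlying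
  \<^const>\<open>Euclidean_space\<close>.\<close>

type_synonym point = "nat \<Rightarrow> real"

definition open_submanifold :: "nat \<Rightarrow> point set \<Rightarrow> (point, point) manifold" where
  "open_submanifold n N =
     \<lparr>mtop = subtopology (Euclidean_space n) N,
      model = topspace (Euclidean_space n),
      charts = {(N, id)}\<rparr>"

abbreviation euclidean_manifold :: "nat \<Rightarrow> (point, point) manifold" where
  "euclidean_manifold n \<equiv> open_submanifold n (topspace (Euclidean_space n))"

record ('g, 'e) lie_group = "'g monoid" +
  mfd :: "('g, 'e) manifold"

definition locally_convex_lie_group :: "('g, 'e::locally_convex_space) lie_group \<Rightarrow> bool" where
  "locally_convex_lie_group G \<longleftrightarrow>
     group G \<and> locally_convex_manifold (mfd G) \<and> model (mfd G) = UNIV \<and>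
     topspace (mtop (mfd G)) = carrier G \<and>
     smooth_map (prod_manifold (mfd G) (mfd G)) (mfd G) (\<lambda>(x, y). x \<otimes>\<^bsub>G\<^esub> y) \<and>
     smooth_map (mfd G) (mfd G) (\<lambda>x. inv\<^bsub>G\<^esub> x)"

section \<open>Simplicial sets\<close>

text \<open>All maps with a restricted domain are represented by extensional functions, so that
  equality of maps, functors and simplices is equality in HOL.\<close>

definition delta_hom :: "nat \<Rightarrow> nat \<Rightarrow> (nat \<Rightarrow> nat) set" where
  "delta_hom m n = {i \<in> {..m} \<rightarrow>\<^sub>E {..n}. mono_on {..m} i}"

text \<open>For \<open>i \<in> delta_hom m n\<close>, the structure map \<open>struct_map X m n i\<close> goes from the
  \<open>n\<close>-simplices to the \<open>m\<close>-simplices.\<close>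

record 'x sset =
  simplices :: "nat \<Rightarrow> 'x set"
  struct_map :: "nat \<Rightarrow> nat \<Rightarrow> (nat \<Rightarrow> nat) \<Rightarrow> 'x \<Rightarrow> 'x"

definition simplicial_set :: "'x sset \<Rightarrow> bool" where
  "simplicial_set X \<longleftrightarrow>
     (\<forall>m n. \<forall>i\<in>delta_hom m n. struct_map X m n i \<in> simplices X n \<rightarrow> simplices X m) \<and>
     (\<forall>n. \<forall>x\<in>simplices X n. struct_map X n n (\<lambda>a\<in>{..n}. a) x = x) \<and>
     (\<forall>l m n. \<forall>i\<in>delta_hom l m. \<forall>j\<in>delta_hom m n. \<forall>x\<in>simplices X n.
        struct_map X l n (compose {..l} j i) x = struct_map X l m i (struct_map X m n j x))"

definition simplicial_map :: "'x sset \<Rightarrow> 'y sset \<Rightarrow> (nat \<Rightarrow> 'x \<Rightarrow> 'y) \<Rightarrow> bool" where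
  "simplicial_map X Y f \<longleftrightarrow>
     (\<forall>n. f n \<in> simplices X n \<rightarrow> simplices Y n) \<and>
     (\<forall>m n. \<forall>i\<in>delta_hom m n. \<forall>x\<in>simplices X n.
        f m (struct_map X m n i x) = struct_map Y m n i (f n x))"

definition simplex_sset :: "nat \<Rightarrow> (nat \<Rightarrow> nat) sset" where
  "simplex_sset n =
     \<lparr>simplices = (\<lambda>m. delta_hom m n),
      struct_map = (\<lambda>l m i f. compose {..l} f i)\<rparr>"

definition horn_sset :: "nat \<Rightarrow> nat \<Rightarrow> (nat \<Rightarrow> nat) sset" where
  "horn_sset n k =
     \<lparr>simplices = (\<lambda>m. {f \<in> delta_hom m n. \<exists>j\<le>n. j \<noteq> k \<and> j \<notin> f ` {..m}}),
      struct_map = (\<lambda>l m i f. compose {..l} f i)\<rparr>"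

definition kan_complex :: "'x sset \<Rightarrow> bool" where
  "kan_complex X \<longleftrightarrow>
     simplicial_set X \<and>
     (\<forall>n k h. 1 \<le> n \<longrightarrow> k \<le> n \<longrightarrow> simplicial_map (horn_sset n k) X h \<longrightarrow>
        (\<exists>s. simplicial_map (simplex_sset n) X s \<and>
             (\<forall>m. \<forall>f\<in>simplices (horn_sset n k) m. s m f = h m f)))"

section \<open>Smooth simplices\<close>

definition geom_simplex :: "nat \<Rightarrow> point set" where
  "geom_simplex n = {x \<in> topspace (Euclidean_space n). (\<forall>i<n. 0 \<le> x i) \<and> (\<Sum>i<n. x i) \<le> 1}"

definition smooth_maps :: "nat \<Rightarrow> nat \<Rightarrow> (point \<Rightarrow> point) set" where
  "smooth_maps m n =
     {\<sigma> \<in> geom_simplex m \<rightarrow>\<^sub>E geom_simplex n.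
        \<exists>N h. openin (Euclidean_space m) N \<and> geom_simplex m \<subseteq> N \<and>
          smooth_map (open_submanifold m N) (euclidean_manifold n) h \<and>
          (\<forall>x\<in>geom_simplex m. h x = \<sigma> x)}"

text \<open>The vertices of the simplex are ordered as \<open>0, e\<^sub>1, \<dots>, e\<^sub>n\<close>; coordinates are indexed
  from \<open>0\<close>.\<close>

definition vertex :: "nat \<Rightarrow> point" where
  "vertex a = (\<lambda>l. if a = Suc l then 1 else 0)"

definition barycentric :: "nat \<Rightarrow> point \<Rightarrow> nat \<Rightarrow> real" where
  "barycentric m x a = (if a = 0 then 1 - (\<Sum>l<m. x l) else x (a - 1))"

definition affine_simplex_map :: "nat \<Rightarrow> (nat \<Rightarrow> nat) \<Rightarrow> point \<Rightarrow> point" where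
  "affine_simplex_map m i = (\<lambda>x\<in>geom_simplex m. \<Sum>a\<le>m. barycentric m x a *\<^sub>R vertex (i a))"

definition smooth_simplices :: "nat \<Rightarrow> (point \<Rightarrow> point) sset" where
  "smooth_simplices d =
     \<lparr>simplices = (\<lambda>k. smooth_maps k d),
      struct_map = (\<lambda>l k i \<rho>. compose (geom_simplex l) \<rho> (affine_simplex_map l i))\<rparr>"

type_synonym smap = "nat \<Rightarrow> (point \<Rightarrow> point) \<Rightarrow> (point \<Rightarrow> point)"

text \<open>The map \<open>\<sigma>\<^sub>\<bullet>\<close> induced by a smooth \<open>\<sigma>\<close> on the \<open>d\<close>-simplex, and composition of
  simplicial maps defined on \<open>smooth_simplices d\<close>.\<close>

definition induced_smap :: "nat \<Rightarrow> (point \<Rightarrow> point) \<Rightarrow> smap" where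
  "induced_smap d \<sigma> =
     (\<lambda>k. \<lambda>\<rho>\<in>simplices (smooth_simplices d) k. compose (geom_simplex k) \<sigma> \<rho>)"

definition smap_comp :: "nat \<Rightarrow> smap \<Rightarrow> smap \<Rightarrow> smap" where
  "smap_comp d F E = (\<lambda>k. compose (simplices (smooth_simplices d) k) (F k) (E k))"

definition smooth_smaps :: "nat \<Rightarrow> nat \<Rightarrow> smap set" where
  "smooth_smaps d n = induced_smap d ` smooth_maps d n"

section \<open>Categories and functors\<close>

record ('o, 'a) cat =
  ob :: "'o set"
  hom_set :: "'o \<Rightarrow> 'o \<Rightarrow> 'a set"
  ident :: "'o \<Rightarrow> 'a"
  cat_comp :: "'o \<Rightarrow> 'o \<Rightarrow> 'o \<Rightarrow> 'a \<Rightarrow> 'a \<Rightarrow> 'a"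

definition arrows :: "('o, 'a) cat \<Rightarrow> ('o \<times> 'o \<times> 'a) set" where
  "arrows C = {(a, b, f). a \<in> ob C \<and> b \<in> ob C \<and> f \<in> hom_set C a b}"

record ('o, 'a, 'p, 'b) cat_functor =
  fobj :: "'o \<Rightarrow> 'p"
  fmor :: "'o \<times> 'o \<times> 'a \<Rightarrow> 'b"

definition is_functor :: "('o, 'a) cat \<Rightarrow> ('p, 'b) cat \<Rightarrow> ('o, 'a, 'p, 'b) cat_functor \<Rightarrow> bool" where
  "is_functor C D F \<longleftrightarrow>
     fobj F \<in> ob C \<rightarrow>\<^sub>E ob D \<and> fmor F \<in> extensional (arrows C) \<and>
     (\<forall>(a, b, f)\<in>arrows C. fmor F (a, b, f) \<in> hom_set D (fobj F a) (fobj F b)) \<and>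
     (\<forall>a\<in>ob C. fmor F (a, a, ident C a) = ident D (fobj F a)) \<and>
     (\<forall>a b c f g. (a, b, f) \<in> arrows C \<longrightarrow> (b, c, g) \<in> arrows C \<longrightarrow>
        fmor F (a, c, cat_comp C a b c g f) =
        cat_comp D (fobj F a) (fobj F b) (fobj F c) (fmor F (b, c, g)) (fmor F (a, b, f)))"

definition functor_comp ::
  "('o, 'a) cat \<Rightarrow> ('p, 'b, 'q, 'c) cat_functor \<Rightarrow> ('o, 'a, 'p, 'b) cat_functor \<Rightarrow> ('o, 'a, 'q, 'c) cat_functor"
where
  "functor_comp C H F =
     \<lparr>fobj = (\<lambda>a\<in>ob C. fobj H (fobj F a)),
      fmor = (\<lambda>(a, b, f)\<in>arrows C. fmor H (fobj F a, fobj F b, fmor F (a, b, f)))\<rparr>"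

definition dsm_cat :: "nat \<Rightarrow> (nat \<times> smap, point \<Rightarrow> point) cat" where
  "dsm_cat n =
     \<lparr>ob = {(d, \<Sigma>). \<Sigma> \<in> smooth_smaps d n},
      hom_set = (\<lambda>(d1, \<Sigma>1) (d2, \<Sigma>2).
        {f \<in> smooth_maps d1 d2. smap_comp d1 \<Sigma>2 (induced_smap d1 f) = \<Sigma>1}),
      ident = (\<lambda>(d, \<Sigma>). \<lambda>x\<in>geom_simplex d. x),
      cat_comp = (\<lambda>(d1, \<Sigma>1) _ _ g f. compose (geom_simplex d1) g f)\<rparr>"

definition dsm_functor ::
  "nat \<Rightarrow> smap \<Rightarrow> (nat \<times> smap, point \<Rightarrow> point, nat \<times> smap, point \<Rightarrow> point) cat_functor"
where
  "dsm_functor m f =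
     \<lparr>fobj = (\<lambda>(d, \<Sigma>)\<in>ob (dsm_cat m). (d, smap_comp d f \<Sigma>)),
      fmor = (\<lambda>(a, b, h)\<in>arrows (dsm_cat m). h)\<rparr>"

section \<open>Smooth bundles over simplices\<close>

record ('p, 'g) gbundle =
  base_dim :: nat
  total :: "'p topology"
  proj :: "'p \<Rightarrow> point"
  act :: "'p \<times> 'g \<Rightarrow> 'p"
  atlas :: "(point set \<times> (point \<times> 'g \<Rightarrow> 'p)) set"

definition simplex_topology :: "nat \<Rightarrow> point topology" where
  "simplex_topology n = subtopology (Euclidean_space n) (geom_simplex n)"

definition local_trivialization ::
  "('g, 'e) lie_group \<Rightarrow> ('p, 'g) gbundle \<Rightarrow> point set \<times> (point \<times> 'g \<Rightarrow> 'p) \<Rightarrow> bool"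
where
  "local_trivialization G P = (\<lambda>(U, \<phi>).
     openin (simplex_topology (base_dim P)) U \<and> \<phi> \<in> extensional (U \<times> carrier G) \<and>
     homeomorphic_map
       (prod_topology (subtopology (simplex_topology (base_dim P)) U) (mtop (mfd G)))
       (subtopology (total P) {p \<in> topspace (total P). proj P p \<in> U}) \<phi> \<and>
     (\<forall>x\<in>U. \<forall>g\<in>carrier G. proj P (\<phi> (x, g)) = x \<and>
        (\<forall>h\<in>carrier G. \<phi> (x, g \<otimes>\<^bsub>G\<^esub> h) = act P (\<phi> (x, g), h))))"

definition topological_principal_bundle :: "('g, 'e) lie_group \<Rightarrow> ('p, 'g) gbundle \<Rightarrow> bool" where
  "topological_principal_bundle G P \<longleftrightarrow>
     proj P \<in> extensional (topspace (total P)) \<and>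
     continuous_map (total P) (simplex_topology (base_dim P)) (proj P) \<and>
     act P \<in> extensional (topspace (total P) \<times> carrier G) \<and>
     continuous_map (prod_topology (total P) (mtop (mfd G))) (total P) (act P) \<and>
     (\<forall>p\<in>topspace (total P). act P (p, \<one>\<^bsub>G\<^esub>) = p \<and>
        (\<forall>g\<in>carrier G. proj P (act P (p, g)) = proj P p \<and>
           (\<forall>h\<in>carrier G. act P (act P (p, g), h) = act P (p, g \<otimes>\<^bsub>G\<^esub> h)))) \<and>
     (\<forall>x\<in>geom_simplex (base_dim P). \<exists>U \<phi>. x \<in> U \<and> local_trivialization G P (U, \<phi>))"

definition smooth_transition ::
  "('g, 'e::locally_convex_space) lie_group \<Rightarrow> nat \<Rightarrow> point set \<times> (point \<times> 'g \<Rightarrow> 'p) \<Rightarrow>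
   point set \<times> (point \<times> 'g \<Rightarrow> 'p) \<Rightarrow> bool"
where
  "smooth_transition G n = (\<lambda>(U, \<phi>) (V, \<psi>).
     \<exists>N H. openin (Euclidean_space n) N \<and> U \<inter> V \<subseteq> N \<and>
       smooth_map (prod_manifold (open_submanifold n N) (mfd G))
         (prod_manifold (open_submanifold n N) (mfd G)) H \<and>
       (\<forall>x\<in>U \<inter> V. \<forall>g\<in>carrier G. H (x, g) = inv_into (V \<times> carrier G) \<psi> (\<phi> (x, g))))"

definition smooth_atlas ::
  "('g, 'e::locally_convex_space) lie_group \<Rightarrow> ('p, 'g) gbundle \<Rightarrow>
   (point set \<times> (point \<times> 'g \<Rightarrow> 'p)) set \<Rightarrow> bool"
where
  "smooth_atlas G P A \<longleftrightarrow>
     (\<forall>\<tau>\<in>A. local_trivialization G P \<tau>) \<and>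
     (\<Union>(U, \<phi>)\<in>A. U) = geom_simplex (base_dim P) \<and>
     (\<forall>\<tau>\<in>A. \<forall>\<tau>'\<in>A. smooth_transition G (base_dim P) \<tau> \<tau>')"

definition smooth_bundle ::
  "('g, 'e::locally_convex_space) lie_group \<Rightarrow> ('p, 'g) gbundle \<Rightarrow> bool"
where
  "smooth_bundle G P \<longleftrightarrow>
     topological_principal_bundle G P \<and> smooth_atlas G P (atlas P) \<and>
     (\<forall>B. smooth_atlas G P B \<and> atlas P \<subseteq> B \<longrightarrow> B = atlas P)"

definition covers :: "('p, 'g) gbundle \<Rightarrow> ('p, 'g) gbundle \<Rightarrow> ('p \<Rightarrow> 'p) \<Rightarrow> (point \<Rightarrow> point) \<Rightarrow> bool" where
  "covers P Q F f \<longleftrightarrow> (\<forall>p\<in>topspace (total P). proj Q (F p) = f (proj P p))"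

text \<open>In local trivializations \<open>\<phi>\<close> and \<open>\<psi>\<close>, the map \<open>\<psi>\<^sup>-\<^sup>1 \<circ> F \<circ> \<phi>\<close> has to be smooth, i.e.
  to extend smoothly to a neighbourhood of each point of the base.\<close>

definition smooth_bundle_map ::
  "('g, 'e::locally_convex_space) lie_group \<Rightarrow> ('p, 'g) gbundle \<Rightarrow> ('p, 'g) gbundle \<Rightarrow>
   ('p \<Rightarrow> 'p) \<Rightarrow> bool"
where
  "smooth_bundle_map G P Q F \<longleftrightarrow>
     F \<in> extensional (topspace (total P)) \<and>
     continuous_map (total P) (total Q) F \<and>
     (\<forall>p\<in>topspace (total P). \<forall>g\<in>carrier G. F (act P (p, g)) = act Q (F p, g)) \<and>
     (\<exists>f\<in>smooth_maps (base_dim P) (base_dim Q). covers P Q F f \<and>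
        (\<forall>(U, \<phi>)\<in>atlas P. \<forall>(V, \<psi>)\<in>atlas Q. \<forall>x\<in>U. f x \<in> V \<longrightarrow>
           (\<exists>N H. openin (Euclidean_space (base_dim P)) N \<and> x \<in> N \<and>
              smooth_map (prod_manifold (open_submanifold (base_dim P) N) (mfd G))
                (prod_manifold (euclidean_manifold (base_dim Q)) (mfd G)) H \<and>
              (\<forall>y\<in>N \<inter> U. f y \<in> V \<longrightarrow>
                 (\<forall>g\<in>carrier G. H (y, g) = inv_into (V \<times> carrier G) \<psi> (F (\<phi> (y, g))))))))"

definition bundle_cat ::
  "('g, 'e::locally_convex_space) lie_group \<Rightarrow> (('p, 'g) gbundle, 'p \<Rightarrow> 'p) cat"
where
  "bundle_cat G =
     \<lparr>ob = {P. smooth_bundle G P},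
      hom_set = (\<lambda>P Q. {F. smooth_bundle_map G P Q F}),
      ident = (\<lambda>P. \<lambda>p\<in>topspace (total P). p),
      cat_comp = (\<lambda>P _ _ g f. compose (topspace (total P)) g f)\<rparr>"

section \<open>Simplicial bundles and the simplicial set \<open>BG\<close>\<close>

type_synonym ('p, 'g) simplicial_bundle =
  "(nat \<times> smap, point \<Rightarrow> point, ('p, 'g) gbundle, 'p \<Rightarrow> 'p) cat_functor"

definition is_simplicial_bundle ::
  "('g, 'e::locally_convex_space) lie_group \<Rightarrow> nat \<Rightarrow> ('p, 'g) simplicial_bundle \<Rightarrow> bool"
where
  "is_simplicial_bundle G n P \<longleftrightarrow>
     is_functor (dsm_cat n) (bundle_cat G) P \<and>
     (\<forall>(d, \<Sigma>)\<in>ob (dsm_cat n). base_dim (fobj P (d, \<Sigma>)) = d) \<and>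
     (\<forall>(a, b, f)\<in>arrows (dsm_cat n). covers (fobj P a) (fobj P b) (fmor P (a, b, f)) f)"

definition bundle_pullback ::
  "nat \<Rightarrow> smap \<Rightarrow> ('p, 'g) simplicial_bundle \<Rightarrow> ('p, 'g) simplicial_bundle"
where
  "bundle_pullback m f P = functor_comp (dsm_cat m) P (dsm_functor m f)"

text \<open>A structured set (the group, or a bundle) belongs to a universe iff its underlying set does;
  the remaining structure consists of subsets of, and maps between, sets of the universe.\<close>

definition admissible_universe :: "('v, 'e) lie_group \<Rightarrow> 'v::zf_sets \<Rightarrow> bool" where
  "admissible_universe G U \<longleftrightarrow>
     grothendieck_universe U \<and> belongs_to (carrier G) U \<and>
     (\<forall>n. belongs_to (vpoint n ` geom_simplex n) U)"

definition vgraph :: "nat \<Rightarrow> nat \<Rightarrow> (point \<Rightarrow> point) \<Rightarrow> 'v::zf_sets" where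
  "vgraph k n \<sigma> = vset ((\<lambda>x. vpair (vpoint k x) (vpoint n (\<sigma> x))) ` geom_simplex k)"

definition small_simplicial_bundle :: "'v::zf_sets \<Rightarrow> nat \<Rightarrow> ('v, 'g) simplicial_bundle \<Rightarrow> bool" where
  "small_simplicial_bundle U n P \<longleftrightarrow>
     (\<forall>a\<in>ob (dsm_cat n). belongs_to (topspace (total (fobj P a))) U) \<and>
     (\<forall>k. belongs_to (vgraph k n ` simplices (smooth_simplices n) k) U)"

definition BG :: "('v::zf_sets, 'e::locally_convex_space) lie_group \<Rightarrow> 'v \<Rightarrow> ('v, 'v) simplicial_bundle sset"
where
  "BG G U =
     \<lparr>simplices = (\<lambda>k. {P. is_simplicial_bundle G k P \<and> small_simplicial_bundle U k P}),
      struct_map = (\<lambda>m n i P. bundle_pullback m (induced_smap m (affine_simplex_map m i)) P)\<rparr>"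

end

theory Submission
  imports Defs "HOL-Computational_Algebra.Polynomial"
begin

text \<open>A bundle over a simplex is trivial: local sections are glued coordinate by coordinate, where the
  transition function on an overlap is extended by precomposing it with a smooth retraction of the
  base, so that neither connections nor bump functions with values in \<open>G\<close> are needed. All facets of a horn
  contain the vertex \<open>k\<close>, and for each of them the linear projection that moves the weight of the
  opposite vertex onto \<open>k\<close> preserves the others; with these projections a section over some facets
  is extended over the next one. Thus the bundle over the horn has a global section. The filler
  sends a simplex \<open>\<sigma>\<close> outside the horn to the bundle over the constant simplex at the vertex \<open>k\<close>,
  which is already present (hence small), and the sections determine the bundle maps between all of
  these, in a functorial way.

  Composites of smooth maps are treated with the derivatives of \<open>f\<close> along all iterated tangent
  directions at once, for which the chain rule of any order follows from the one of order one.\<close>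

section \<open>Locally convex function and product spaces\<close>

text \<open>Two features of the statement shape the proof. The filler has to restrict to the given
  horn by equality, not only up to isomorphism, so every bundle and bundle map over a simplex inside
  a facet of the horn must be kept as it is; freedom remains only at simplices that lie in no such
  facet. A morphism may lead from a simplex in a facet to one outside, and then the two bundles come
  with no map between them; a section of each supplies it. For morphisms inside a facet the same
  recipe must return the given map, so the sections have to be natural for all maps of the horn, and
  one family has to serve all facets at once. The model space of \<open>G\<close> is only locally
  convex, without norm or completeness. Estimates therefore use convex neighbourhoods and bisection,
  and functions with values in \<open>G\<close> are only multiplied, inverted and precomposed with
  maps of the base. Euclidean space sits inside a function type as a subspace, so derivatives are
  taken on subspaces \<open>W\<close>; that these are closed is what keeps derivatives inside
  them.\<close>

lemma tendsto_fun_iff: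
  fixes f :: "'z \<Rightarrow> 'i \<Rightarrow> 'b::topological_space"
  shows "(f \<longlongrightarrow> l) F \<longleftrightarrow> (\<forall>i. ((\<lambda>z. f z i) \<longlongrightarrow> l i) F)"
proof -
  have "(f \<longlongrightarrow> l) F \<longleftrightarrow> limitin (product_topology (\<lambda>_. euclidean) UNIV) f l F"
    by (simp add: euclidean_product_topology)
  then show ?thesis
    by (simp add: limitin_componentwise)
qed

instance "fun" :: (type, t0_space) t0_space
proof
  fix x y :: "'a \<Rightarrow> 'b"
  assume "x \<noteq> y"
  then obtain i where "x i \<noteq> y i" by auto
  from t0_space_class.t0_space[OF this] obtain A where A: "open A" "\<not> (x i \<in> A \<longleftrightarrow> y i \<in> A)"
    by blast
  have c: "continuous_on UNIV (\<lambda>z::'a\<Rightarrow>'b. z i)" by simp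
  show "\<exists>U. open U \<and> \<not> (x \<in> U \<longleftrightarrow> y \<in> U)"
    by (rule exI[of _ "(\<lambda>z. z i) -` A"]) (use A c in \<open>auto intro!: open_vimage\<close>)
qed

instance "fun" :: (type, t1_space) t1_space
proof
  fix x y :: "'a \<Rightarrow> 'b"
  assume "x \<noteq> y"
  then obtain i where "x i \<noteq> y i" by auto
  then obtain A where A: "open A" "x i \<in> A" "y i \<notin> A"
    by (meson t1_space)
  have c: "continuous_on UNIV (\<lambda>z::'a\<Rightarrow>'b. z i)" by simp
  show "\<exists>U. open U \<and> x \<in> U \<and> y \<notin> U"
    by (rule exI[of _ "(\<lambda>z. z i) -` A"]) (use A c in \<open>auto intro!: open_vimage\<close>)
qed

instance "fun" :: (type, t2_space) t2_space
proof
  fix x y :: "'a \<Rightarrow> 'b"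
  assume "x \<noteq> y"
  then obtain i where "x i \<noteq> y i" by auto
  then obtain A B where AB: "open A" "open B" "x i \<in> A" "y i \<in> B" "A \<inter> B = {}"
    by (meson hausdorff)
  have c: "continuous_on UNIV (\<lambda>z::'a\<Rightarrow>'b. z i)" by simp
  show "\<exists>U V. open U \<and> open V \<and> x \<in> U \<and> y \<in> V \<and> U \<inter> V = {}"
    by (rule exI[of _ "(\<lambda>z. z i) -` A"], rule exI[of _ "(\<lambda>z. z i) -` B"])
       (use AB c open_vimage in \<open>auto intro!: open_vimage\<close>)
qed

instance "fun" :: (type, topological_ab_group_add) topological_ab_group_add
proof
  fix a b :: "'a \<Rightarrow> 'b"
  have 1: "((\<lambda>p. fst p i) \<longlongrightarrow> a i) (nhds a \<times>\<^sub>F nhds b)" "((\<lambda>p. snd p i) \<longlongrightarrow> b i) (nhds a \<times>\<^sub>F nhds b)" for i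
    by (rule tendsto_fun_iff[THEN iffD1, rule_format], rule filterlim_fst filterlim_snd)+
  show "((\<lambda>x. fst x + snd x) \<longlongrightarrow> a + b) (nhds a \<times>\<^sub>F nhds b)"
    unfolding tendsto_fun_iff plus_fun_def by (intro allI tendsto_add 1)
  show "(uminus \<longlongrightarrow> - a) (nhds a)"
    unfolding tendsto_fun_iff fun_Compl_def
    by (intro allI tendsto_minus, rule tendsto_fun_iff[THEN iffD1, rule_format], rule filterlim_ident)
qed

lemma tendsto_scaleR_lc:
  fixes g :: "'z \<Rightarrow> 'e::locally_convex_space"
  assumes "(f \<longlongrightarrow> a) F" "(g \<longlongrightarrow> x) F"
  shows "((\<lambda>z. f z *\<^sub>R g z) \<longlongrightarrow> a *\<^sub>R x) F"
  using filterlim_compose[OF tendsto_scaleR_Pair filterlim_Pair[OF assms]] by simp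

lemma continuous_on_scaleR_lc:
  fixes g :: "'z::topological_space \<Rightarrow> 'e::locally_convex_space"
  assumes "continuous_on A f" "continuous_on A g"
  shows "continuous_on A (\<lambda>z. f z *\<^sub>R g z)"
  using assms by (auto simp: continuous_on_def intro!: tendsto_scaleR_lc)

text \<open>Jets and sequences of directions are functions, so the calculus below is applied to
  function types with the product topology. A basic open box restricts finitely many coordinates,
  and these are shrunk to convex sets.\<close>

instance "fun" :: (type, locally_convex_space) locally_convex_space
proof
  fix a :: real and x :: "'a \<Rightarrow> 'b"
  have 1: "((\<lambda>p. snd p i) \<longlongrightarrow> x i) (nhds a \<times>\<^sub>F nhds x)" for i
    by (rule tendsto_fun_iff[THEN iffD1, rule_format], rule filterlim_snd)
  show "((\<lambda>p. fst p *\<^sub>R snd p) \<longlongrightarrow> a *\<^sub>R x) (nhds a \<times>\<^sub>F nhds x)"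
    unfolding tendsto_fun_iff scaleR_fun_def by (intro allI tendsto_scaleR_lc 1 filterlim_fst)
next
  fix S :: "('a \<Rightarrow> 'b) set"
  assume S: "open S" "0 \<in> S"
  then obtain X where X: "0 \<in> Pi\<^sub>E UNIV X" "\<And>i. open (X i)" "finite {i. X i \<noteq> UNIV}" "Pi\<^sub>E UNIV X \<subseteq> S"
    using product_topology_open_contains_basis[of "\<lambda>_. euclidean" UNIV S "0::'a\<Rightarrow>'b"]
    by (auto simp: euclidean_product_topology)
  \<comment> \<open>Unrestricted coordinates must stay \<open>UNIV\<close>, otherwise the box of the
    sets \<open>Cf i\<close> may fail to be open.\<close>
  then have "\<exists>C. open C \<and> 0 \<in> C \<and> convex C \<and> C \<subseteq> X i \<and> (X i = UNIV \<longrightarrow> C = UNIV)" for i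
    using locally_convex[of "X i"] by (cases "X i = UNIV") (auto simp: PiE_iff)
  then obtain Cf where C: "\<And>i. open (Cf i)" "\<And>i. 0 \<in> Cf i" "\<And>i. convex (Cf i)" "\<And>i. Cf i \<subseteq> X i"
      "\<And>i. X i = UNIV \<Longrightarrow> Cf i = UNIV"
    by metis
  have "finite {i. Cf i \<noteq> UNIV}"
    by (rule finite_subset[OF _ X(3)]) (use C(5) in auto)
  then have o: "open (Pi\<^sub>E UNIV Cf)"
    using C(1) by (intro open_PiE) auto
  show "\<exists>C. open C \<and> 0 \<in> C \<and> C \<subseteq> S \<and>
      (\<forall>x\<in>C. \<forall>y\<in>C. \<forall>u\<ge>0. \<forall>v\<ge>0. u + v = 1 \<longrightarrow> u *\<^sub>R x + v *\<^sub>R y \<in> C)"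
  proof (intro exI[of _ "Pi\<^sub>E UNIV Cf"] conjI ballI allI impI)
    show "Pi\<^sub>E UNIV Cf \<subseteq> S" using C(4) X(4) by (fastforce simp: PiE_iff)
    show "u *\<^sub>R x + v *\<^sub>R y \<in> Pi\<^sub>E UNIV Cf"
      if "x \<in> Pi\<^sub>E UNIV Cf" "y \<in> Pi\<^sub>E UNIV Cf" "0 \<le> u" "0 \<le> v" "u + v = 1" for x y and u v :: real
      using that C(3) by (simp add: PiE_iff scaleR_fun_def plus_fun_def convexD)
  qed (use o C(2) in \<open>auto simp: PiE_iff\<close>)
qed

instance prod :: (topological_monoid_add, topological_monoid_add) topological_monoid_add
proof
  fix a b :: "'a \<times> 'b"
  have "((\<lambda>p. (fst (fst p) + fst (snd p), snd (fst p) + snd (snd p))) \<longlongrightarrow> (fst a + fst b, snd a + snd b)) (nhds a \<times>\<^sub>F nhds b)"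
    by (intro tendsto_Pair tendsto_add tendsto_fst tendsto_snd filterlim_fst filterlim_snd)
  then show "((\<lambda>x. fst x + snd x) \<longlongrightarrow> a + b) (nhds a \<times>\<^sub>F nhds b)"
    by (simp add: plus_prod_def)
qed

instance prod :: (topological_comm_monoid_add, topological_comm_monoid_add) topological_comm_monoid_add ..

instance prod :: (topological_group_add, topological_group_add) topological_group_add
proof
  fix a :: "'a \<times> 'b"
  have "((\<lambda>p. (- fst p, - snd p)) \<longlongrightarrow> (- fst a, - snd a)) (nhds a)"
    by (intro tendsto_Pair tendsto_minus tendsto_fst tendsto_snd filterlim_ident)
  moreover have "(\<lambda>p. (- fst p, - snd p)) = (uminus :: 'a \<times> 'b \<Rightarrow> _)"
    by (simp add: fun_eq_iff uminus_prod_def)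
  ultimately show "(uminus \<longlongrightarrow> - a) (nhds a)"
    by (simp add: uminus_prod_def)
qed

instance prod :: (topological_ab_group_add, topological_ab_group_add) topological_ab_group_add ..

instance prod :: (locally_convex_space, locally_convex_space) locally_convex_space
proof
  fix a :: real and x :: "'a \<times> 'b"
  have "((\<lambda>p. (fst p *\<^sub>R fst (snd p), fst p *\<^sub>R snd (snd p))) \<longlongrightarrow> (a *\<^sub>R fst x, a *\<^sub>R snd x)) (nhds a \<times>\<^sub>F nhds x)"
    by (intro tendsto_Pair tendsto_scaleR_lc tendsto_fst tendsto_snd filterlim_fst filterlim_snd)
  then show "((\<lambda>p. fst p *\<^sub>R snd p) \<longlongrightarrow> a *\<^sub>R x) (nhds a \<times>\<^sub>F nhds x)"
    by (simp add: scaleR_prod_def)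
next
  fix S :: "('a \<times> 'b) set"
  assume "open S" "0 \<in> S"
  from open_prod_elim[OF this] obtain A B where AB: "open A" "open B" "0 \<in> A \<times> B" "A \<times> B \<subseteq> S"
    by blast
  obtain C D where "open C" "0 \<in> C" "convex C" "C \<subseteq> A" "open D" "0 \<in> D" "convex D" "D \<subseteq> B"
    using locally_convex[of A] locally_convex[of B] AB by (auto simp: zero_prod_def)
  then show "\<exists>C. open C \<and> 0 \<in> C \<and> C \<subseteq> S \<and>
      (\<forall>x\<in>C. \<forall>y\<in>C. \<forall>u\<ge>0. \<forall>v\<ge>0. u + v = 1 \<longrightarrow> u *\<^sub>R x + v *\<^sub>R y \<in> C)"
    using AB by (intro exI[of _ "C \<times> D"]) (auto simp: open_Times zero_prod_def convex_def)
qed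

instance real :: locally_convex_space
proof
  fix a x :: real
  show "((\<lambda>p. fst p *\<^sub>R snd p) \<longlongrightarrow> a *\<^sub>R x) (nhds a \<times>\<^sub>F nhds x)"
    by (intro tendsto_scaleR filterlim_fst filterlim_snd)
next
  fix S :: "real set"
  assume "open S" "0 \<in> S"
  then obtain e where "e > 0" "ball 0 e \<subseteq> S" by (meson open_contains_ball)
  then show "\<exists>C. open C \<and> 0 \<in> C \<and> C \<subseteq> S \<and>
      (\<forall>x\<in>C. \<forall>y\<in>C. \<forall>u\<ge>0. \<forall>v\<ge>0. u + v = 1 \<longrightarrow> u *\<^sub>R x + v *\<^sub>R y \<in> C)"
    using convex_ball[of "0::real" e] by (intro exI[of _ "ball 0 e"]) (auto simp: convex_def)
qed

section \<open>Mean value estimates in locally convex spaces\<close>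

lemma open_convex_nbhd:
  fixes x :: "'e::locally_convex_space"
  assumes "open S" "x \<in> S"
  obtains C where "open C" "x \<in> C" "convex C" "C \<subseteq> S"
proof -
  have c: "continuous_on UNIV (\<lambda>z. x + z)" "continuous_on UNIV (\<lambda>z. z - x)"
    by (auto simp: continuous_on_def intro!: tendsto_add tendsto_diff tendsto_ident_at)
  have "open ((\<lambda>z. x + z) -` S)"
    using c(1) assms(1) open_vimage by blast
  then obtain C where C: "open C" "0 \<in> C" "convex C" "C \<subseteq> (\<lambda>z. x + z) -` S"
    using locally_convex[of "(\<lambda>z. x + z) -` S"] assms by auto
  have eq: "(\<lambda>z. z - x) -` C = (\<lambda>z. x + z) ` C" by force
  show ?thesis
  proof
    show "open ((\<lambda>z. z - x) -` C)" using c(2) C(1) open_vimage by blast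
    show "convex ((\<lambda>z. z - x) -` C)" unfolding eq using C(3) by (simp add: convex_translation)
  qed (use C eq in auto)
qed

text \<open>The slope over two adjacent intervals is a convex combination of the slopes over each of
  them. By bisection it therefore suffices that slopes over short intervals around any point lie in
  \<open>C\<close>, and they do because the derivative at that point lies in the open set
  \<open>C\<close>. This replaces the mean value inequality in the absence of a norm.\<close>

lemma mean_value_convex:
  fixes \<gamma> :: "real \<Rightarrow> 'e::locally_convex_space"
  assumes C: "convex C" "open C"
    and der: "\<And>s. 0 \<le> s \<Longrightarrow> s \<le> 1 \<Longrightarrow> ((\<lambda>t. (\<gamma> (s + t) - \<gamma> s) /\<^sub>R t) \<longlongrightarrow> d s) (at 0)"
    and dC: "\<And>s. 0 \<le> s \<Longrightarrow> s \<le> 1 \<Longrightarrow> d s \<in> C"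
  shows "\<gamma> 1 - \<gamma> 0 \<in> C"
proof -
  define sl where "sl a b = (\<gamma> b - \<gamma> a) /\<^sub>R (b - a)" for a b
  have comb: "sl a c \<in> C" if "sl a b \<in> C" "sl b c \<in> C" "a < b" "b < c" for a b c
  proof -
    have "((b - a) / (c - a)) *\<^sub>R sl a b + ((c - b) / (c - a)) *\<^sub>R sl b c \<in> C"
      using that by (intro convexD[OF C(1)]) (auto simp: add_divide_distrib[symmetric])
    moreover have "((b - a) / (c - a)) *\<^sub>R sl a b = (\<gamma> b - \<gamma> a) /\<^sub>R (c - a)"
      "((c - b) / (c - a)) *\<^sub>R sl b c = (\<gamma> c - \<gamma> b) /\<^sub>R (c - a)"
      using that by (auto simp: sl_def divide_inverse)
    moreover have "(\<gamma> b - \<gamma> a) /\<^sub>R (c - a) + (\<gamma> c - \<gamma> b) /\<^sub>R (c - a) = sl a c"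
      by (simp add: sl_def scaleR_add_right[symmetric])
    ultimately show ?thesis by simp
  qed
  \<comment> \<open>\<open>sl a a\<close> is 0, which may lie outside \<open>C\<close>; the premise
    keeps degenerate intervals out of the bisection.\<close>
  have "0 < (1::real) \<longrightarrow> sl 0 1 \<in> C"
  proof (rule Bolzano[of 0 1 "\<lambda>a b. a < b \<longrightarrow> sl a b \<in> C"])
    fix a b c :: real
    assume "a < b \<longrightarrow> sl a b \<in> C" "b < c \<longrightarrow> sl b c \<in> C" "a \<le> b" "b \<le> c"
    then show "a < c \<longrightarrow> sl a c \<in> C"
      using comb[of a b c] by (cases "a = b"; cases "b = c") auto
  next
    fix x :: real assume x: "0 \<le> x" "x \<le> 1"
    have "eventually (\<lambda>t. (\<gamma> (x + t) - \<gamma> x) /\<^sub>R t \<in> C) (at 0)"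
      using topological_tendstoD[OF der[OF x] C(2) dC[OF x]] .
    then obtain e where e: "e > 0" "\<And>t. t \<noteq> 0 \<Longrightarrow> \<bar>t\<bar> < e \<Longrightarrow> (\<gamma> (x + t) - \<gamma> x) /\<^sub>R t \<in> C"
      by (auto simp: eventually_at dist_real_def)
    have r: "sl x b \<in> C" if "x < b" "b < x + e" for b
      using e(2)[of "b - x"] that by (simp add: sl_def)
    have l: "sl a x \<in> C" if "a < x" "x < a + e" for a
    proof -
      have "(\<gamma> a - \<gamma> x) /\<^sub>R (a - x) = (\<gamma> x - \<gamma> a) /\<^sub>R (x - a)"
        using that by (metis (no_types, opaque_lifting) inverse_minus_eq minus_diff_eq scaleR_minus_left scaleR_minus_right)
      then show ?thesis using e(2)[of "a - x"] that by (simp add: sl_def)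
    qed
    have "sl a b \<in> C" if "a \<le> x" "x \<le> b" "b - a < e" "a < b" for a b
      using r[of b] l[of a] comb[of a x b] that by (cases "a = x"; cases "b = x") auto
    then show "\<exists>d>0. \<forall>a b. a \<le> x \<and> x \<le> b \<and> b - a < d \<longrightarrow> a < b \<longrightarrow> sl a b \<in> C"
      using e(1) by blast
  qed auto
  then show ?thesis by (simp add: sl_def)
qed

text \<open>The mean value theorem is applied to the segment from \<open>y z\<close> to
  \<open>y z + h z *\<^sub>R u z\<close>, with values divided by \<open>h z\<close>. The derivative
  along it is \<open>d\<close> at a point near \<open>x\<close> in a direction near
  \<open>w\<close>, so joint continuity puts it into any convex neighbourhood of
  \<open>d x w\<close>. Moving base points give additivity of the derivative, moving directions give
  the chain rule.\<close>

lemma strict_directional: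
  fixes \<Phi> :: "'a::locally_convex_space \<Rightarrow> 'b::locally_convex_space"
  assumes W: "subspace W" and op: "openin (top_of_set W) \<Omega>"
    and der: "\<And>x v. x \<in> \<Omega> \<Longrightarrow> v \<in> W \<Longrightarrow> ((\<lambda>t::real. (\<Phi> (x + t *\<^sub>R v) - \<Phi> x) /\<^sub>R t) \<longlongrightarrow> d x v) (at 0)"
    and cont: "continuous_on (\<Omega> \<times> W) (\<lambda>(x, v). d x v)"
    and x: "x \<in> \<Omega>" and w: "w \<in> W"
    and y: "(y \<longlongrightarrow> x) F" "eventually (\<lambda>z. y z \<in> W) F"
    and u: "(u \<longlongrightarrow> w) F" "eventually (\<lambda>z. u z \<in> W) F"
    and h: "(h \<longlongrightarrow> (0::real)) F" "eventually (\<lambda>z. h z \<noteq> 0) F"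
  shows "((\<lambda>z. (\<Phi> (y z + h z *\<^sub>R u z) - \<Phi> (y z)) /\<^sub>R h z) \<longlongrightarrow> d x w) F"
proof (rule topological_tendstoI)
  fix S assume S: "open S" "d x w \<in> S"
  then obtain C where C: "open C" "d x w \<in> C" "convex C" "C \<subseteq> S"
    using open_convex_nbhd by blast
  obtain O1 where O1: "open O1" "\<Omega> = W \<inter> O1"
    using op by (metis openin_open)
  obtain A where A: "open A" "(x, w) \<in> A" "\<And>p. p \<in> \<Omega> \<times> W \<Longrightarrow> p \<in> A \<Longrightarrow> (case p of (x, v) \<Rightarrow> d x v) \<in> C"
    using cont[unfolded continuous_on_topological, rule_format, of "(x, w)" C] C x w by auto
  obtain A1 A2 where A12: "open A1" "open A2" "(x, w) \<in> A1 \<times> A2" "A1 \<times> A2 \<subseteq> A"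
    using open_prod_elim[OF A(1,2)] by blast
  have "((\<lambda>p. y (snd p) + fst p *\<^sub>R u (snd p)) \<longlongrightarrow> x + 0 *\<^sub>R w) (nhds (0::real) \<times>\<^sub>F F)"
    by (intro tendsto_add tendsto_scaleR_lc filterlim_fst filterlim_compose[OF y(1) filterlim_snd]
        filterlim_compose[OF u(1) filterlim_snd])
  then have "eventually (\<lambda>p. y (snd p) + fst p *\<^sub>R u (snd p) \<in> O1 \<inter> A1) (nhds (0::real) \<times>\<^sub>F F)"
    by (rule topological_tendstoD) (use O1 A12 x in auto)
  then obtain P Q where PQ: "eventually P (nhds (0::real))" "eventually Q F"
    "\<And>\<tau> z. P \<tau> \<Longrightarrow> Q z \<Longrightarrow> y z + \<tau> *\<^sub>R u z \<in> O1 \<inter> A1"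
    by (auto simp: eventually_prod_filter)
  obtain e where e: "e > 0" "\<And>\<tau>. \<bar>\<tau>\<bar> < e \<Longrightarrow> P \<tau>"
    using PQ(1) by (auto simp: eventually_nhds_metric dist_real_def)
  have 1: "eventually (\<lambda>z. u z \<in> A2) F"
    using topological_tendstoD[OF u(1) A12(2)] A12 by auto
  have 2: "eventually (\<lambda>z. \<bar>h z\<bar> < e) F"
    using h(1) e(1) by (auto simp: tendsto_iff dist_real_def)
  show "eventually (\<lambda>z. (\<Phi> (y z + h z *\<^sub>R u z) - \<Phi> (y z)) /\<^sub>R h z \<in> S) F"
    using 1 2 PQ(2) y(2) u(2) h(2)
  proof eventually_elim
    case (elim z)
    define \<gamma> where "\<gamma> s = \<Phi> (y z + (s * h z) *\<^sub>R u z) /\<^sub>R h z" for s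
    have "\<gamma> 1 - \<gamma> 0 \<in> C"
    proof (rule mean_value_convex[of C \<gamma> "\<lambda>s. d (y z + (s * h z) *\<^sub>R u z) (u z)"])
      fix s :: real assume s: "0 \<le> s" "s \<le> 1"
      have "\<bar>s * h z\<bar> \<le> 1 * \<bar>h z\<bar>" unfolding abs_mult using s by (intro mult_right_mono) auto
      then have "P (s * h z)" using elim(2) e(2) by simp
      then have p: "y z + (s * h z) *\<^sub>R u z \<in> O1 \<inter> A1" using PQ(3) elim by blast
      moreover have pW: "y z + (s * h z) *\<^sub>R u z \<in> W"
        using W elim by (simp add: subspace_add subspace_scale)
      ultimately have pO: "y z + (s * h z) *\<^sub>R u z \<in> \<Omega>" using O1 by auto
      have "filterlim (\<lambda>t. t * h z) (at 0) (at 0)"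
        using elim(6) by (auto simp: filterlim_at eventually_at_filter intro!: tendsto_eq_intros)
      from filterlim_compose[OF der[OF pO elim(5)] this]
      have "((\<lambda>t. (\<Phi> (y z + (s * h z) *\<^sub>R u z + (t * h z) *\<^sub>R u z) - \<Phi> (y z + (s * h z) *\<^sub>R u z)) /\<^sub>R (t * h z))
          \<longlongrightarrow> d (y z + (s * h z) *\<^sub>R u z) (u z)) (at 0)" .
      then show "((\<lambda>t. (\<gamma> (s + t) - \<gamma> s) /\<^sub>R t) \<longlongrightarrow> d (y z + (s * h z) *\<^sub>R u z) (u z)) (at 0)"
        by (simp add: \<gamma>_def algebra_simps)
      show "d (y z + (s * h z) *\<^sub>R u z) (u z) \<in> C"
        using A(3)[of "(y z + (s * h z) *\<^sub>R u z, u z)"] A12(4) p pO elim by auto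
    qed (use C in auto)
    then show ?case using C(4) by (auto simp: \<gamma>_def algebra_simps)
  qed
qed

section \<open>Multilinearity of iterated directional derivatives\<close>

lemma open_line_in:
  fixes x :: "'a::locally_convex_space"
  assumes "subspace W" "openin (top_of_set W) N" "x \<in> N" "v \<in> W"
  shows "eventually (\<lambda>t::real. x + t *\<^sub>R v \<in> N) (at 0)"
proof -
  obtain O1 where O1: "open O1" "N = W \<inter> O1"
    using assms(2) by (metis openin_open)
  have "((\<lambda>t::real. x + t *\<^sub>R v) \<longlongrightarrow> x + 0 *\<^sub>R v) (at 0)"
    by (intro tendsto_add tendsto_scaleR_lc tendsto_const tendsto_ident_at)
  then have "eventually (\<lambda>t::real. x + t *\<^sub>R v \<in> O1) (at 0)"
    by (rule topological_tendstoD) (use O1 assms in auto)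
  then show ?thesis
    by eventually_elim (use O1 assms in \<open>auto intro!: subspace_add subspace_scale\<close>)
qed

locale directional_derivative =
  fixes W :: "'a::locally_convex_space set" and \<Omega> :: "'a set"
    and \<Phi> :: "'a \<Rightarrow> 'b::locally_convex_space" and d :: "'a \<Rightarrow> 'a \<Rightarrow> 'b"
  assumes W: "subspace W" and op: "openin (top_of_set W) \<Omega>"
    and der: "\<And>x v. x \<in> \<Omega> \<Longrightarrow> v \<in> W \<Longrightarrow> ((\<lambda>t::real. (\<Phi> (x + t *\<^sub>R v) - \<Phi> x) /\<^sub>R t) \<longlongrightarrow> d x v) (at 0)"
    and cont: "continuous_on (\<Omega> \<times> W) (\<lambda>(x, v). d x v)"
begin

lemma \<Omega>_W: "\<Omega> \<subseteq> W"
  using op openin_imp_subset by blast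

lemma d_scale:
  assumes "x \<in> \<Omega>" "v \<in> W"
  shows "d x (c *\<^sub>R v) = c *\<^sub>R d x v"
proof (cases "c = 0")
  case True
  have "((\<lambda>t::real. (\<Phi> (x + t *\<^sub>R 0) - \<Phi> x) /\<^sub>R t) \<longlongrightarrow> 0) (at 0)"
    by simp
  from tendsto_unique[OF _ der[OF assms(1) subspace_0[OF W]] this] show ?thesis
    by (simp add: True)
next
  case False
  have "filterlim (\<lambda>t. t * c) (at 0) (at (0::real))"
    using False by (auto simp: filterlim_at eventually_at_filter intro!: tendsto_eq_intros)
  from filterlim_compose[OF der[OF assms] this]
  have "((\<lambda>t. c *\<^sub>R ((\<Phi> (x + (t * c) *\<^sub>R v) - \<Phi> x) /\<^sub>R (t * c))) \<longlongrightarrow> c *\<^sub>R d x v) (at 0)"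
    by (rule tendsto_scaleR_lc[OF tendsto_const])
  then have "((\<lambda>t. (\<Phi> (x + t *\<^sub>R (c *\<^sub>R v)) - \<Phi> x) /\<^sub>R t) \<longlongrightarrow> c *\<^sub>R d x v) (at 0)"
    using False by (simp add: field_simps)
  from tendsto_unique[OF _ der[OF assms(1) subspace_scale[OF W assms(2)]] this] show ?thesis
    by simp
qed

text \<open>A step along \<open>v + w\<close> is a step along \<open>v\<close> followed by a step
  along \<open>w\<close> from the moving point \<open>x + t *\<^sub>R v\<close>; for the second one
  the strict form of differentiability is required.\<close>

lemma d_add:
  assumes x: "x \<in> \<Omega>" and v: "v \<in> W" and w: "w \<in> W"
  shows "d x (v + w) = d x v + d x w"
proof -
  have y: "((\<lambda>t::real. x + t *\<^sub>R v) \<longlongrightarrow> x + 0 *\<^sub>R v) (at 0)"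
    by (intro tendsto_add tendsto_scaleR_lc tendsto_const tendsto_ident_at)
  have "((\<lambda>t. (\<Phi> (x + t *\<^sub>R v + t *\<^sub>R w) - \<Phi> (x + t *\<^sub>R v)) /\<^sub>R t) \<longlongrightarrow> d x w) (at 0)"
    by (rule strict_directional[OF W op der cont x w])
       (use y v w x \<Omega>_W W in \<open>auto intro!: subspace_add subspace_scale tendsto_ident_at always_eventually simp: eventually_at_filter\<close>)
  from tendsto_add[OF this der[OF x v]]
  have "((\<lambda>t. (\<Phi> (x + t *\<^sub>R (v + w)) - \<Phi> x) /\<^sub>R t) \<longlongrightarrow> d x w + d x v) (at 0)"
    by (simp add: algebra_simps)
  from tendsto_unique[OF _ der[OF x subspace_add[OF W v w]] this] show ?thesis
    by (simp add: add.commute)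
qed

end

locale bastiani =
  fixes W :: "'a::locally_convex_space set" and N :: "'a set"
    and f :: "'a \<Rightarrow> 'b::locally_convex_space" and D :: "nat \<Rightarrow> 'a \<Rightarrow> (nat \<Rightarrow> 'a) \<Rightarrow> 'b"
  assumes W: "subspace W" and op: "openin (top_of_set W) N"
    and D_0: "\<And>x v. x \<in> N \<Longrightarrow> v \<in> UNIV \<rightarrow> W \<Longrightarrow> D 0 x v = f x"
    and D_Suc: "\<And>k x v. x \<in> N \<Longrightarrow> v \<in> UNIV \<rightarrow> W \<Longrightarrow>
           ((\<lambda>t::real. (D k (x + t *\<^sub>R v k) v - D k x v) /\<^sub>R t) \<longlongrightarrow> D (Suc k) x v) (at 0)"
    and D_cont: "\<And>k. continuous_on (N \<times> (UNIV \<rightarrow> W)) (\<lambda>(x, v). D k x v)"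

lemma bastiani_smooth_on_iff:
  assumes "subspace W"
  shows "bastiani_smooth_on W N f \<longleftrightarrow> (\<exists>D. bastiani W N f D)"
proof
  assume "bastiani_smooth_on W N f"
  then obtain D where "openin (top_of_set W) N"
    "\<forall>x\<in>N. \<forall>v\<in>UNIV \<rightarrow> W. D 0 x v = f x"
    "\<forall>k. \<forall>x\<in>N. \<forall>v\<in>UNIV \<rightarrow> W. ((\<lambda>t::real. (D k (x + t *\<^sub>R v k) v - D k x v) /\<^sub>R t) \<longlongrightarrow> D (Suc k) x v) (at 0)"
    "\<forall>k. continuous_on (N \<times> (UNIV \<rightarrow> W)) (\<lambda>(x, v). D k x v)"
    unfolding bastiani_smooth_on_def by blast
  with assms have "bastiani W N f D" by unfold_locales blast+
  then show "\<exists>D. bastiani W N f D" by (rule exI[of "\<lambda>D. bastiani W N f D"])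
next
  assume "\<exists>D. bastiani W N f D"
  then obtain D where "bastiani W N f D" by blast
  then interpret bastiani W N f D .
  show "bastiani_smooth_on W N f"
    unfolding bastiani_smooth_on_def using op D_0 D_Suc D_cont by blast
qed

context bastiani
begin

lemma line_in: "x \<in> N \<Longrightarrow> v \<in> W \<Longrightarrow> eventually (\<lambda>t::real. x + t *\<^sub>R v \<in> N) (at 0)"
  by (rule open_line_in[OF W op])

text \<open>Induction works because \<open>D (Suc k)\<close> is a limit of difference quotients of
  \<open>D k\<close> along \<open>v k\<close>, so each order reads one further direction.\<close>

lemma D_cong:
  assumes "x \<in> N" "v \<in> UNIV \<rightarrow> W" "v' \<in> UNIV \<rightarrow> W" "\<And>i. i < k \<Longrightarrow> v i = v' i"
  shows "D k x v = D k x v'"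
  using assms
proof (induction k arbitrary: x)
  case 0
  then show ?case by (simp add: D_0)
next
  case (Suc k)
  have "((\<lambda>t::real. (D k (x + t *\<^sub>R v k) v - D k x v) /\<^sub>R t) \<longlongrightarrow> D (Suc k) x v') (at 0)"
  proof (rule Lim_transform_eventually[OF D_Suc[OF Suc.prems(1,3)]])
    have "eventually (\<lambda>t::real. x + t *\<^sub>R v k \<in> N) (at 0)"
      using Suc.prems by (intro line_in) auto
    then show "eventually (\<lambda>t::real. (D k (x + t *\<^sub>R v' k) v' - D k x v') /\<^sub>R t =
        (D k (x + t *\<^sub>R v k) v - D k x v) /\<^sub>R t) (at 0)"
      by eventually_elim (use Suc in \<open>auto simp: Suc.IH[of _]\<close>)
  qed
  then show ?case
    using D_Suc[OF Suc.prems(1,2)] tendsto_unique trivial_limit_at by blast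
qed

lemma upd_W: "v \<in> UNIV \<rightarrow> W \<Longrightarrow> a \<in> W \<Longrightarrow> v(i := a) \<in> UNIV \<rightarrow> W"
  by auto

text \<open>Isolates the newest direction: with the others frozen, \<open>D (Suc k)\<close> is a
  first derivative, to which \<open>d_add\<close> and \<open>d_scale\<close> apply. By
  \<open>D_cong\<close> the entry \<open>v k\<close> may be overwritten inside
  \<open>D k\<close>.\<close>

lemma directional_last:
  assumes v: "v \<in> UNIV \<rightarrow> W"
  shows "directional_derivative W N (\<lambda>x. D k x v) (\<lambda>x a. D (Suc k) x (v(k := a)))"
proof
  fix x a assume xa: "x \<in> N" "a \<in> W"
  have vk: "v(k := a) \<in> UNIV \<rightarrow> W" using v xa by auto
  show "((\<lambda>t::real. (D k (x + t *\<^sub>R a) v - D k x v) /\<^sub>R t) \<longlongrightarrow> D (Suc k) x (v(k := a))) (at 0)"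
  proof (rule Lim_transform_eventually[OF D_Suc[OF xa(1) vk]])
    have "eventually (\<lambda>t::real. x + t *\<^sub>R a \<in> N) (at 0)"
      using xa by (rule line_in)
    then show "eventually (\<lambda>t::real. (D k (x + t *\<^sub>R (v(k := a)) k) (v(k := a)) - D k x (v(k := a))) /\<^sub>R t =
        (D k (x + t *\<^sub>R a) v - D k x v) /\<^sub>R t) (at 0)"
      by eventually_elim (use D_cong[OF _ vk v] xa in auto)
  qed
next
  have "continuous_on (N \<times> W) (\<lambda>p. (fst p, v(k := snd p)))"
  proof (intro continuous_intros continuous_on_coordinatewise_then_product)
    show "continuous_on (N \<times> W) (\<lambda>p. (v(k := snd p)) i)" for i
      by (cases "i = k") (auto intro: continuous_intros)
  qed
  then have "continuous_on (N \<times> W) (\<lambda>p. case (fst p, v(k := snd p)) of (x, v) \<Rightarrow> D (Suc k) x v)"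
    by (rule continuous_on_compose2[OF D_cont]) (use v in auto)
  then show "continuous_on (N \<times> W) (\<lambda>(x, a). D (Suc k) x (v(k := a)))"
    by (simp add: case_prod_beta)
qed (use W op in auto)

text \<open>The newest slot is linear because it is the direction of a directional derivative. For
  an older slot the identity holds for the difference quotients by induction and passes to the
  limit.\<close>

lemma D_multilinear:
  assumes x: "x \<in> N" and v: "v \<in> UNIV \<rightarrow> W" and i: "i < k" and a: "a \<in> W" and b: "b \<in> W"
  shows "D k x (v(i := a + c *\<^sub>R b)) = D k x (v(i := a)) + c *\<^sub>R D k x (v(i := b))"
  using x i
proof (induction k arbitrary: x)
  case (Suc k)
  have ab: "a + c *\<^sub>R b \<in> W" "c *\<^sub>R b \<in> W" using a b W by (auto intro!: subspace_add subspace_scale)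
  show ?case
  proof (cases "i = k")
    case True
    interpret directional_derivative W N "\<lambda>x. D k x v" "\<lambda>x a. D (Suc k) x (v(k := a))"
      by (rule directional_last[OF v])
    show ?thesis
      unfolding True d_add[OF Suc.prems(1) a ab(2)] d_scale[OF Suc.prems(1) b] ..
  next
    case False
    then have ik: "i < k" using Suc by simp
    note lim = D_Suc[OF Suc.prems(1) upd_W[OF v]]
    have "((\<lambda>t::real. (D k (x + t *\<^sub>R (v(i:=a)) k) (v(i:=a)) - D k x (v(i:=a))) /\<^sub>R t
          + c *\<^sub>R ((D k (x + t *\<^sub>R (v(i:=b)) k) (v(i:=b)) - D k x (v(i:=b))) /\<^sub>R t))
          \<longlongrightarrow> D (Suc k) x (v(i:=a)) + c *\<^sub>R D (Suc k) x (v(i:=b))) (at 0)"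
      by (intro tendsto_add tendsto_scaleR_lc tendsto_const lim a b)
    moreover have "eventually (\<lambda>t::real. x + t *\<^sub>R v k \<in> N) (at 0)"
      using Suc.prems v by (intro line_in) auto
    then have "eventually (\<lambda>t::real. (D k (x + t *\<^sub>R (v(i:=a)) k) (v(i:=a)) - D k x (v(i:=a))) /\<^sub>R t
          + c *\<^sub>R ((D k (x + t *\<^sub>R (v(i:=b)) k) (v(i:=b)) - D k x (v(i:=b))) /\<^sub>R t) =
          (D k (x + t *\<^sub>R (v(i:=a + c *\<^sub>R b)) k) (v(i:=a + c *\<^sub>R b)) - D k x (v(i:=a + c *\<^sub>R b))) /\<^sub>R t) (at 0)"
    proof eventually_elim
      case (elim t)
      have vk: "(v(i := z)) k = v k" for z using ik by simp
      show ?case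
        unfolding vk Suc.IH[OF elim ik] Suc.IH[OF Suc.prems(1) ik] by (simp add: algebra_simps)
    qed
    ultimately have "((\<lambda>t::real. (D k (x + t *\<^sub>R (v(i:=a + c *\<^sub>R b)) k) (v(i:=a + c *\<^sub>R b)) - D k x (v(i:=a + c *\<^sub>R b))) /\<^sub>R t)
          \<longlongrightarrow> D (Suc k) x (v(i:=a)) + c *\<^sub>R D (Suc k) x (v(i:=b))) (at 0)"
      by (rule Lim_transform_eventually)
    then show ?thesis
      using lim[OF ab(1)] tendsto_unique trivial_limit_at by blast
  qed
qed simp

lemma tendsto_D:
  assumes "x \<in> N" "v \<in> UNIV \<rightarrow> W"
    and "(y \<longlongrightarrow> x) F" "(u \<longlongrightarrow> v) F" "eventually (\<lambda>z. y z \<in> N) F" "eventually (\<lambda>z. u z \<in> UNIV \<rightarrow> W) F"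
  shows "((\<lambda>z. D k (y z) (u z)) \<longlongrightarrow> D k x v) F"
proof -
  have "((\<lambda>z. case (y z, u z) of (x, v) \<Rightarrow> D k x v) \<longlongrightarrow> (case (x, v) of (x, v) \<Rightarrow> D k x v)) F"
    by (rule continuous_on_tendsto_compose[OF D_cont[of k]])
       (use assms in \<open>auto intro!: tendsto_Pair elim: eventually_elim2\<close>)
  then show ?thesis by simp
qed

text \<open>The total derivative is obtained by changing the arguments one at a time, using that
  \<open>D k x\<close> is multilinear.\<close>

lemma D_total:
  assumes x: "x \<in> N" and v: "v \<in> UNIV \<rightarrow> W" and x': "x' \<in> W" and v': "v' \<in> UNIV \<rightarrow> W"
  shows "((\<lambda>t::real. (D k (x + t *\<^sub>R x') (v + t *\<^sub>R v') - D k x v) /\<^sub>R t) \<longlongrightarrow>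
    D (Suc k) x (v(k := x')) + (\<Sum>i<k. D k x (v(i := v' i)))) (at 0)"
proof -
  \<comment> \<open>In \<open>w j t\<close> the first \<open>j\<close> directions have been moved
    already; consecutive sequences differ in one slot, where multilinearity gives the exact
    increment.\<close>
  define w where "w j t = (\<lambda>i. if i < j then v i + t *\<^sub>R v' i else v i)" for j and t :: real
  have wW: "w j t \<in> UNIV \<rightarrow> W" for j t
    using v v' W by (auto simp: w_def Pi_iff intro!: subspace_add subspace_scale)
  have vt: "v + t *\<^sub>R v' \<in> UNIV \<rightarrow> W" for t
    using v v' W by (auto simp: plus_fun_def scaleR_fun_def Pi_iff intro!: subspace_add subspace_scale)
  have step: "D k y (w (Suc j) t) = D k y (w j t) + t *\<^sub>R D k y ((w j t)(j := v' j))"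
    if "y \<in> N" "j < k" for y j t
  proof -
    have "w (Suc j) t = (w j t)(j := v j + t *\<^sub>R v' j)" "(w j t)(j := v j) = w j t"
      by (auto simp: w_def fun_eq_iff)
    moreover have "v j \<in> W" "v' j \<in> W" using v v' by auto
    ultimately show ?thesis
      using D_multilinear[OF that(1) wW that(2), of "v j" "v' j" j t t] by metis
  qed
  have tele: "D k y (w m t) = D k y v + t *\<^sub>R (\<Sum>i<m. D k y ((w i t)(i := v' i)))" if "y \<in> N" "m \<le> k" for y m t
    using that(2)
  proof (induction m)
    case 0
    have "w 0 t = v" by (simp add: w_def)
    then show ?case by simp
  next
    case (Suc m)
    then show ?case using step[OF that(1), of m t] by (simp add: algebra_simps del: fun_upd_apply)
  qed
  have wt: "((\<lambda>t. (w i t)(i := v' i)) \<longlongrightarrow> v(i := v' i)) (at 0)" for i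
    unfolding tendsto_fun_iff
  proof
    fix l
    have "((\<lambda>t. v l + t *\<^sub>R v' l) \<longlongrightarrow> v l + 0 *\<^sub>R v' l) (at 0)"
      by (intro tendsto_add tendsto_scaleR_lc tendsto_const tendsto_ident_at)
    then show "((\<lambda>t. ((w i t)(i := v' i)) l) \<longlongrightarrow> (v(i := v' i)) l) (at 0)"
      by (cases "l < i") (auto simp: w_def)
  qed
  have "((\<lambda>t::real. x + t *\<^sub>R x') \<longlongrightarrow> x + 0 *\<^sub>R x') (at 0)"
    by (intro tendsto_add tendsto_scaleR_lc tendsto_const tendsto_ident_at)
  then have xt: "((\<lambda>t::real. x + t *\<^sub>R x') \<longlongrightarrow> x) (at 0)" by simp
  have ev: "eventually (\<lambda>t::real. x + t *\<^sub>R x' \<in> N) (at 0)" by (rule line_in[OF x x'])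
  interpret dl: directional_derivative W N "\<lambda>x. D k x v" "\<lambda>x a. D (Suc k) x (v(k := a))"
    by (rule directional_last[OF v])
  have "((\<lambda>t::real. (D k (x + t *\<^sub>R x') v - D k x v) /\<^sub>R t + (\<Sum>i<k. D k (x + t *\<^sub>R x') ((w i t)(i := v' i))))
     \<longlongrightarrow> D (Suc k) x (v(k := x')) + (\<Sum>i<k. D k x (v(i := v' i)))) (at 0)"
    using v v' wW by (intro tendsto_add dl.der x x' tendsto_sum tendsto_D xt wt ev always_eventually allI upd_W) auto
  moreover have "eventually (\<lambda>t::real. (D k (x + t *\<^sub>R x') v - D k x v) /\<^sub>R t + (\<Sum>i<k. D k (x + t *\<^sub>R x') ((w i t)(i := v' i)))
      = (D k (x + t *\<^sub>R x') (v + t *\<^sub>R v') - D k x v) /\<^sub>R t) (at 0)"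
    using ev eventually_at_ball'[of 1 "0::real" UNIV, simplified]
  proof eventually_elim
    case (elim t)
    have "D k (x + t *\<^sub>R x') (v + t *\<^sub>R v') = D k (x + t *\<^sub>R x') (w k t)"
      by (rule D_cong[OF elim(1) vt wW]) (simp add: w_def plus_fun_def scaleR_fun_def)
    then show ?case using tele[OF elim(1), of k t] elim(2) by (simp add: algebra_simps del: fun_upd_apply)
  qed
  ultimately show ?thesis by (rule Lim_transform_eventually)
qed

end

section \<open>Jets and the chain rule\<close>

text \<open>A jet \<open>\<xi>\<close> is thought of as the family of mixed partial derivatives at \<open>0\<close> of a map \<open>c\<close> into \<open>W\<close>
  of parameters \<open>t\<^sub>0, t\<^sub>1, \<dots>\<close>, with \<open>\<xi> L = \<partial>\<^sub>L c\<close> for a list \<open>L\<close> of distinct indices; the entries at other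
  lists are irrelevant. A lift \<open>Y\<close> of \<open>f\<close> computes the jet of \<open>f \<circ> c\<close>. In contrast to a single
  derivative \<open>D k\<close>, lifts can be composed.\<close>

definition jets :: "'a set \<Rightarrow> 'a set \<Rightarrow> (nat list \<Rightarrow> 'a) set" where
  "jets W N = {\<xi>. \<xi> [] \<in> N \<and> (\<forall>L. \<xi> L \<in> W)}"

definition shift :: "nat \<Rightarrow> (nat list \<Rightarrow> 'a) \<Rightarrow> nat list \<Rightarrow> 'a" where
  "shift k \<xi> = (\<lambda>L. \<xi> (k # L))"

text \<open>\<open>\<xi> + t *\<^sub>R shift k \<xi>\<close> is the first-order move in the
  parameter \<open>k\<close>, so \<open>Y_Cons\<close> expresses that prepending \<open>k\<close>
  differentiates in this parameter. Each parameter occurs once, hence the restriction to distinct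
  lists. By \<open>Y_cong\<close>, jets may be changed freely outside the sublists of
  \<open>S\<close>, which the proof for composites does repeatedly.\<close>

locale jet_lift =
  fixes W :: "'a::locally_convex_space set" and N :: "'a set"
    and f :: "'a \<Rightarrow> 'b::locally_convex_space" and Y :: "(nat list \<Rightarrow> 'a) \<Rightarrow> nat list \<Rightarrow> 'b"
  assumes W: "subspace W" and op: "openin (top_of_set W) N"
    and Y_Nil: "\<And>\<xi>. \<xi> \<in> jets W N \<Longrightarrow> Y \<xi> [] = f (\<xi> [])"
    and Y_Cons: "\<And>\<xi> k S. \<xi> \<in> jets W N \<Longrightarrow> distinct (k # S) \<Longrightarrow>
      ((\<lambda>t::real. (Y (\<xi> + t *\<^sub>R shift k \<xi>) S - Y \<xi> S) /\<^sub>R t) \<longlongrightarrow> Y \<xi> (k # S)) (at 0)"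
    and Y_cong: "\<And>\<xi> \<xi>' S. \<xi> \<in> jets W N \<Longrightarrow> \<xi>' \<in> jets W N \<Longrightarrow>
      (\<And>L. L \<in> set (subseqs S) \<Longrightarrow> \<xi> L = \<xi>' L) \<Longrightarrow> Y \<xi> S = Y \<xi>' S"
    and Y_cont: "\<And>S. continuous_on (jets W N) (\<lambda>\<xi>. Y \<xi> S)"

lemma shift_jets: "\<xi> \<in> jets W N \<Longrightarrow> shift k \<xi> \<in> UNIV \<rightarrow> W"
  by (auto simp: jets_def shift_def)

lemma Nil_in_subseqs: "[] \<in> set (subseqs S)"
  by (induction S) (auto simp: Let_def)

lemma set_subseqs_Cons: "set (subseqs (k # S)) = (#) k ` set (subseqs S) \<union> set (subseqs S)"
  by (simp add: Let_def)

lemma subseqs_set: "L \<in> set (subseqs S) \<Longrightarrow> set L \<subseteq> set S"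
  using subseqs_powset[of S] by blast

lemma subspace_Pi: "subspace W \<Longrightarrow> subspace (UNIV \<rightarrow> W)"
  by (auto simp: subspace_def Pi_iff plus_fun_def scaleR_fun_def zero_fun_def)

lemma openin_jets:
  fixes W :: "'a::locally_convex_space set"
  assumes "openin (top_of_set W) N"
  shows "openin (top_of_set (UNIV \<rightarrow> W)) (jets W N)"
proof -
  obtain T where T: "open T" "N = W \<inter> T"
    using assms by (metis openin_open)
  have "jets W N = (UNIV \<rightarrow> W) \<inter> (\<lambda>\<xi>. \<xi> []) -` T"
    using T by (auto simp: jets_def)
  moreover have "open ((\<lambda>\<xi>::nat list \<Rightarrow> 'a. \<xi> []) -` T)"
    by (intro open_vimage T continuous_on_product_coordinates)
  ultimately show ?thesis by (auto simp: openin_open)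
qed

lemma continuous_on_coordinate: "continuous_on A (\<lambda>\<xi>. \<xi> i)"
  by (rule continuous_on_subset[OF continuous_on_product_coordinates subset_UNIV])

text \<open>The combinatorics of the Faa di Bruno formula: a term \<open>[B\<^sub>0, \<dots>, B\<^sub>j\<^sub>-\<^sub>1]\<close> stands for
  \<open>D\<^sub>j (\<xi> []; \<xi> B\<^sub>0, \<dots>, \<xi> B\<^sub>j\<^sub>-\<^sub>1)\<close>.\<close>

definition term_derivs :: "nat \<Rightarrow> nat list list \<Rightarrow> nat list list list" where
  "term_derivs k \<pi> = (\<pi> @ [[k]]) # map (\<lambda>i. \<pi>[i := k # \<pi> ! i]) [0..<length \<pi>]"

primrec faa_terms :: "nat list \<Rightarrow> nat list list list" where
  "faa_terms [] = [[]]"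
| "faa_terms (k # S) = concat (map (term_derivs k) (faa_terms S))"

lemma faa_terms_subseqs: "\<pi> \<in> set (faa_terms S) \<Longrightarrow> B \<in> set \<pi> \<Longrightarrow> B \<in> set (subseqs S)"
proof (induction S arbitrary: \<pi> B)
  case (Cons k S)
  then obtain \<rho> where \<rho>: "\<rho> \<in> set (faa_terms S)" "\<pi> \<in> set (term_derivs k \<rho>)" by auto
  then consider "B \<in> set \<rho>" | "B = [k]" | i where "i < length \<rho>" "B = k # \<rho> ! i"
    using Cons.prems(2) set_update_subset_insert by (fastforce simp: term_derivs_def)
  then show ?case
    by cases (use Cons.IH[OF \<rho>(1)] Nil_in_subseqs[of S] in \<open>auto simp: set_subseqs_Cons simp del: subseqs.simps\<close>)
qed simp

context bastiani
begin

text \<open>The entries from the length of the term on are padding, chosen as 0 to stay in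
  \<open>W\<close>.\<close>

definition faa_args :: "(nat list \<Rightarrow> 'a) \<Rightarrow> nat list list \<Rightarrow> nat \<Rightarrow> 'a" where
  "faa_args \<xi> \<pi> = (\<lambda>i. if i < length \<pi> then \<xi> (\<pi> ! i) else 0)"

definition faa_eval :: "(nat list \<Rightarrow> 'a) \<Rightarrow> nat list list \<Rightarrow> 'b" where
  "faa_eval \<xi> \<pi> = D (length \<pi>) (\<xi> []) (faa_args \<xi> \<pi>)"

definition faa :: "(nat list \<Rightarrow> 'a) \<Rightarrow> nat list \<Rightarrow> 'b" where
  "faa \<xi> S = sum_list (map (faa_eval \<xi>) (faa_terms S))"

lemma faa_args_in: "\<xi> \<in> jets W N \<Longrightarrow> faa_args \<xi> \<pi> \<in> UNIV \<rightarrow> W"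
  using W by (auto simp: faa_args_def jets_def subspace_0)

text \<open>The total derivative has two kinds of summands: moving the base point adds the new block
  \<open>[k]\<close>, and moving an argument puts \<open>k\<close> in front of its block. These are
  exactly the entries of \<open>term_derivs\<close>.\<close>

lemma faa_eval_deriv:
  assumes \<xi>: "\<xi> \<in> jets W N"
  shows "((\<lambda>t::real. (faa_eval (\<xi> + t *\<^sub>R shift k \<xi>) \<pi> - faa_eval \<xi> \<pi>) /\<^sub>R t) \<longlongrightarrow>
    sum_list (map (faa_eval \<xi>) (term_derivs k \<pi>))) (at 0)"
proof -
  let ?n = "length \<pi>" and ?v = "faa_args \<xi> \<pi>" and ?v' = "faa_args (shift k \<xi>) \<pi>"
  have v': "?v' \<in> UNIV \<rightarrow> W"
    using \<xi> W by (auto simp: faa_args_def jets_def shift_def subspace_0)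
  have x: "\<xi> [] \<in> N" "\<xi> [k] \<in> W" using \<xi> by (auto simp: jets_def)
  have "faa_eval (\<xi> + t *\<^sub>R shift k \<xi>) \<pi> = D ?n (\<xi> [] + t *\<^sub>R \<xi> [k]) (?v + t *\<^sub>R ?v')" for t
  proof -
    have "faa_args (\<xi> + t *\<^sub>R shift k \<xi>) \<pi> = ?v + t *\<^sub>R ?v'"
      by (auto simp: faa_args_def plus_fun_def scaleR_fun_def fun_eq_iff)
    then show ?thesis
      by (simp add: faa_eval_def plus_fun_def scaleR_fun_def shift_def)
  qed
  moreover have "sum_list (map (faa_eval \<xi>) (term_derivs k \<pi>)) =
    D (Suc ?n) (\<xi> []) (?v(?n := \<xi> [k])) + (\<Sum>i<?n. D ?n (\<xi> []) (?v(i := ?v' i)))"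
  proof -
    have "faa_args \<xi> (\<pi> @ [[k]]) = ?v(?n := \<xi> [k])"
      by (auto simp: faa_args_def fun_eq_iff nth_append)
    moreover have "faa_args \<xi> (\<pi>[i := k # \<pi> ! i]) = ?v(i := ?v' i)" if "i < ?n" for i
      using that by (auto simp: faa_args_def fun_eq_iff shift_def nth_list_update)
    ultimately have "faa_eval \<xi> (\<pi> @ [[k]]) = D (Suc ?n) (\<xi> []) (?v(?n := \<xi> [k]))"
      "\<And>i. i < ?n \<Longrightarrow> faa_eval \<xi> (\<pi>[i := k # \<pi> ! i]) = D ?n (\<xi> []) (?v(i := ?v' i))"
      by (simp_all add: faa_eval_def del: fun_upd_apply)
    then show ?thesis
      by (simp add: term_derivs_def comp_def interv_sum_list_conv_sum_set_nat atLeast0LessThan del: fun_upd_apply)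
  qed
  ultimately show ?thesis
    using D_total[OF x(1) faa_args_in[OF \<xi>] x(2) v', of ?n \<pi>] by (simp add: faa_eval_def del: fun_upd_apply)
qed

lemma faa_deriv:
  assumes \<xi>: "\<xi> \<in> jets W N"
  shows "((\<lambda>t::real. (faa (\<xi> + t *\<^sub>R shift k \<xi>) S - faa \<xi> S) /\<^sub>R t) \<longlongrightarrow> faa \<xi> (k # S)) (at 0)"
proof -
  have "((\<lambda>t::real. (sum_list (map (faa_eval (\<xi> + t *\<^sub>R shift k \<xi>)) xs) - sum_list (map (faa_eval \<xi>) xs)) /\<^sub>R t)
    \<longlongrightarrow> sum_list (map (faa_eval \<xi>) (concat (map (term_derivs k) xs)))) (at 0)" for xs
  proof (induction xs)
    case (Cons \<pi> xs)
    have eq: "(sum_list (map F (\<pi> # xs)) - sum_list (map H (\<pi> # xs))) /\<^sub>R t =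
      (F \<pi> - H \<pi>) /\<^sub>R t + (sum_list (map F xs) - sum_list (map H xs)) /\<^sub>R t"
      for F H :: "nat list list \<Rightarrow> 'b" and t
      by (simp add: algebra_simps)
    have eq': "sum_list (map F (concat (map (term_derivs k) (\<pi> # xs)))) =
      sum_list (map F (term_derivs k \<pi>)) + sum_list (map F (concat (map (term_derivs k) xs)))"
      for F :: "nat list list \<Rightarrow> 'b"
      by simp
    show ?case
      unfolding eq eq' by (rule tendsto_add[OF faa_eval_deriv[OF \<xi>, of k \<pi>] Cons])
  qed simp
  then show ?thesis by (simp add: faa_def)
qed

lemma jet_lift_faa: "jet_lift W N f faa"
proof
  fix \<xi> assume "\<xi> \<in> jets W N"
  then show "faa \<xi> [] = f (\<xi> [])"
    using D_0[of "\<xi> []" "faa_args \<xi> []"] faa_args_in[of \<xi> "[]"] by (auto simp: faa_def faa_eval_def jets_def)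
next
  fix \<xi> \<xi>' S assume \<xi>: "\<xi> \<in> jets W N" "\<xi>' \<in> jets W N" "\<And>L. L \<in> set (subseqs S) \<Longrightarrow> \<xi> L = \<xi>' L"
  have "faa_eval \<xi> \<pi> = faa_eval \<xi>' \<pi>" if "\<pi> \<in> set (faa_terms S)" for \<pi>
  proof -
    have "faa_args \<xi> \<pi> = faa_args \<xi>' \<pi>"
      using faa_terms_subseqs[OF that] \<xi>(3) by (auto simp: faa_args_def fun_eq_iff)
    then show ?thesis using \<xi>(3)[OF Nil_in_subseqs] by (simp add: faa_eval_def)
  qed
  then show "faa \<xi> S = faa \<xi>' S"
    unfolding faa_def by (intro arg_cong[where f = sum_list] map_cong) auto
next
  fix S
  have ev: "continuous_on (jets W N) (\<lambda>\<xi>. faa_eval \<xi> \<pi>)" for \<pi>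
  proof -
    have "continuous_on (jets W N) (\<lambda>\<xi>. faa_args \<xi> \<pi> i)" for i
      by (cases "i < length \<pi>") (auto simp: faa_args_def continuous_on_coordinate)
    then have "continuous_on (jets W N) (\<lambda>\<xi>. (\<xi> [], faa_args \<xi> \<pi>))"
      by (intro continuous_intros continuous_on_coordinate continuous_on_coordinatewise_then_product)
    then have "continuous_on (jets W N) (\<lambda>\<xi>. case (\<xi> [], faa_args \<xi> \<pi>) of (x, v) \<Rightarrow> D (length \<pi>) x v)"
      by (rule continuous_on_compose2[OF D_cont]) (use faa_args_in in \<open>auto simp: jets_def\<close>)
    then show ?thesis by (simp add: faa_eval_def)
  qed
  have "continuous_on (jets W N) (\<lambda>\<xi>. sum_list (map (faa_eval \<xi>) xs))" for xs
    by (induction xs) (auto intro!: continuous_on_add ev continuous_on_const)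
  then show "continuous_on (jets W N) (\<lambda>\<xi>. faa \<xi> S)" by (simp add: faa_def)
qed (use W op faa_deriv in auto)

end

context jet_lift
begin

text \<open>Difference quotients of \<open>W'\<close>-valued maps lie in \<open>W'\<close>, and
  closedness keeps their limits there. Thus the lift of a map into \<open>N'\<close> produces jets
  on which a second lift can act.\<close>

lemma Y_range:
  assumes "closed W'" "subspace W'" "f ` N \<subseteq> W'" and \<xi>: "\<xi> \<in> jets W N" and "distinct S"
  shows "Y \<xi> S \<in> W'"
  using \<xi> \<open>distinct S\<close>
proof (induction S arbitrary: \<xi>)
  case Nil
  then show ?case using assms Y_Nil by (auto simp: jets_def)
next
  case (Cons k S)
  have "eventually (\<lambda>t::real. \<xi> + t *\<^sub>R shift k \<xi> \<in> jets W N) (at 0)"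
    by (rule open_line_in[OF subspace_Pi[OF W] openin_jets[OF op] Cons.prems(1) shift_jets[OF Cons.prems(1)]])
  then have "eventually (\<lambda>t::real. (Y (\<xi> + t *\<^sub>R shift k \<xi>) S - Y \<xi> S) /\<^sub>R t \<in> W') (at 0)"
    by eventually_elim (use Cons assms in \<open>auto intro!: subspace_scale subspace_diff\<close>)
  then show ?case
    by (rule Lim_in_closed_set[OF \<open>closed W'\<close> _ _ Y_Cons[OF Cons.prems]]) simp
qed

text \<open>Ordinary iterated derivatives are recovered from the jet of an affine map with value
  \<open>x\<close> and first partials \<open>v i\<close>, all of whose mixed partials
  vanish.\<close>

lemma bastiani: "\<exists>D. bastiani W N f D"
proof -
  define jet where "jet x v L = (case L of [] \<Rightarrow> x | [i] \<Rightarrow> v i | _ \<Rightarrow> 0)" for x :: 'a and v :: "nat \<Rightarrow> 'a" and L :: "nat list"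
  have jet: "jet x v \<in> jets W N" if "x \<in> N" "v \<in> UNIV \<rightarrow> W" for x v
    using that op openin_imp_subset[OF op] W by (auto simp: jets_def jet_def subspace_0 Pi_iff split: list.splits)
  have sh: "jet x v + t *\<^sub>R shift k (jet x v) = jet (x + t *\<^sub>R v k) v" for x v k and t :: real
    by (auto simp: jet_def shift_def plus_fun_def scaleR_fun_def fun_eq_iff split: list.splits)
  \<comment> \<open>The list is reversed because a lift differentiates last in the head of its list,
    and \<open>D (Suc k)\<close> differentiates \<open>D k\<close> in direction
    \<open>k\<close>.\<close>
  have "bastiani W N f (\<lambda>k x v. Y (jet x v) (rev [0..<k]))"
  proof
    fix x and v :: "nat \<Rightarrow> 'a" assume xv: "x \<in> N" "v \<in> UNIV \<rightarrow> W"
    show "Y (jet x v) (rev [0..<0]) = f x"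
      using Y_Nil[OF jet[OF xv]] by (simp add: jet_def)
    show "((\<lambda>t::real. (Y (jet (x + t *\<^sub>R v k) v) (rev [0..<k]) - Y (jet x v) (rev [0..<k])) /\<^sub>R t)
      \<longlongrightarrow> Y (jet x v) (rev [0..<Suc k])) (at 0)" for k
      using Y_Cons[OF jet[OF xv], of k "rev [0..<k]"] by (simp add: sh)
  next
    fix k
    have "continuous_on (N \<times> (UNIV \<rightarrow> W)) (\<lambda>p. jet (fst p) (snd p) L)" for L
    proof (cases L)
      case Nil
      then show ?thesis by (simp add: jet_def continuous_on_fst)
    next
      case (Cons i L')
      have "continuous_on (N \<times> (UNIV \<rightarrow> W)) (\<lambda>p. snd p i)"
        by (rule continuous_on_compose2[OF continuous_on_coordinate[of UNIV] continuous_on_snd[OF continuous_on_id]]) auto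
      with Cons show ?thesis by (cases L') (simp_all add: jet_def)
    qed
    then have "continuous_on (N \<times> (UNIV \<rightarrow> W)) (\<lambda>p. jet (fst p) (snd p))"
      by (rule continuous_on_coordinatewise_then_product)
    then have "continuous_on (N \<times> (UNIV \<rightarrow> W)) (\<lambda>p. Y (jet (fst p) (snd p)) (rev [0..<k]))"
      by (rule continuous_on_compose2[OF Y_cont]) (use jet in auto)
    then show "continuous_on (N \<times> (UNIV \<rightarrow> W)) (\<lambda>(x, v). Y (jet x v) (rev [0..<k]))"
      by (simp add: case_prod_beta)
  qed (use W op in auto)
  then show ?thesis by blast
qed

end

text \<open>The lift of a composite is the composite of the lifts. The substance is its derivative:
  when \<open>\<xi>\<close> moves, the jet of \<open>f\<close> moves with difference quotients
  \<open>u t\<close> tending to \<open>w\<close>, and strict differentiability of \<open>Yg\<close>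
  for moving directions gives the limit.\<close>

lemma jet_lift_comp:
  assumes f: "jet_lift W N f Yf" and g: "jet_lift W' N' g Yg"
    and W': "closed W'" and fN: "f ` N \<subseteq> N'"
  shows "\<exists>Y. jet_lift W N (g \<circ> f) Y"
proof -
  interpret f: jet_lift W N f Yf by fact
  interpret g: jet_lift W' N' g Yg by fact
  have N'W': "N' \<subseteq> W'" using g.op openin_imp_subset by blast
  \<comment> \<open>At lists with repetitions nothing is known about \<open>Yf\<close>, not even
    that its values lie in \<open>W'\<close>; they are replaced by 0.\<close>
  define Z where "Z \<xi> L = (if distinct L then Yf \<xi> L else 0)" for \<xi> L
  have Z: "Z \<xi> \<in> jets W' N'" if "\<xi> \<in> jets W N" for \<xi>
    using f.Y_range[OF W' g.W _ that] f.Y_Nil[OF that] fN N'W' that subspace_0[OF g.W]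
    by (auto simp: Z_def jets_def)
  have Zcont: "continuous_on (jets W N) Z"
  proof (rule continuous_on_coordinatewise_then_product)
    show "continuous_on (jets W N) (\<lambda>\<xi>. Z \<xi> L)" for L
      by (cases "distinct L") (auto simp: Z_def f.Y_cont)
  qed
  have "jet_lift W N (g \<circ> f) (\<lambda>\<xi>. Yg (Z \<xi>))"
  proof
    fix \<xi> assume \<xi>: "\<xi> \<in> jets W N"
    show "Yg (Z \<xi>) [] = (g \<circ> f) (\<xi> [])"
      using g.Y_Nil[OF Z[OF \<xi>]] f.Y_Nil[OF \<xi>] by (simp add: Z_def)
  next
    fix \<xi> k and S :: "nat list" assume \<xi>: "\<xi> \<in> jets W N" and dist: "distinct (k # S)"
    define \<Omega> where "\<Omega> = jets W' N'"
    \<comment> \<open>A jet with prescribed shift \<open>\<zeta>\<close> in the parameter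
      \<open>k\<close> and unchanged entries at lists not starting with \<open>k\<close>. As
      \<open>k\<close> does not occur in \<open>S\<close>, \<open>Y_Cons\<close> for
      \<open>Yg\<close> at this jet becomes a directional derivative in an arbitrary direction
      \<open>\<zeta>\<close>.\<close>
    define merge :: "(nat list \<Rightarrow> 'b) \<Rightarrow> (nat list \<Rightarrow> 'b) \<Rightarrow> nat list \<Rightarrow> 'b"
      where "merge \<eta> \<zeta> L = (case L of [] \<Rightarrow> \<eta> [] | l # L' \<Rightarrow> if l = k then \<zeta> L' else \<eta> L)" for \<eta> \<zeta> L
    have merge: "merge \<eta> \<zeta> \<in> jets W' N'" if "\<eta> \<in> jets W' N'" "\<zeta> \<in> UNIV \<rightarrow> W'" for \<eta> \<zeta>
      using that by (auto simp: jets_def merge_def Pi_iff split: list.splits)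
    have shm: "shift k (merge \<eta> \<zeta>) = \<zeta>" for \<eta> \<zeta>
      by (simp add: shift_def merge_def)
    have subk: "L \<noteq> [] \<and> hd L \<noteq> k" if "L \<in> set (subseqs S)" "L \<noteq> []" for L
      using that dist subsetD[OF subseqs_set[OF that(1)] hd_in_set[OF that(2)]] by auto
    have evJ: "eventually (\<lambda>t::real. \<eta> + t *\<^sub>R \<zeta> \<in> jets W' N') (at 0)"
      if "\<eta> \<in> jets W' N'" "\<zeta> \<in> UNIV \<rightarrow> W'" for \<eta> \<zeta>
      by (rule open_line_in[OF subspace_Pi[OF g.W] openin_jets[OF g.op] that])
    have mS: "merge \<eta> \<zeta> L = \<eta> L" if "L \<in> set (subseqs S)" for \<eta> \<zeta> L
      using subk[OF that] by (cases L) (auto simp: merge_def)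
    \<comment> \<open>The product topology asks for convergence at every list, also at those about
      which \<open>Y_Cons\<close> for \<open>Yf\<close> is silent; there \<open>u\<close> and its
      limit \<open>w\<close> are set to 0.\<close>
    define u where "u t L = (if distinct (k # L) then (Z (\<xi> + t *\<^sub>R shift k \<xi>) L - Z \<xi> L) /\<^sub>R t else 0)" for t L
    define w where "w L = (if distinct (k # L) then Yf \<xi> (k # L) else 0)" for L
    have dirder: "((\<lambda>t::real. (Yg (\<eta> + t *\<^sub>R \<zeta>) S - Yg \<eta> S) /\<^sub>R t) \<longlongrightarrow> Yg (merge \<eta> \<zeta>) (k # S)) (at 0)"
      if \<eta>: "\<eta> \<in> jets W' N'" and \<zeta>: "\<zeta> \<in> UNIV \<rightarrow> W'" for \<eta> \<zeta>
    proof (rule Lim_transform_eventually)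
      show "((\<lambda>t::real. (Yg (merge \<eta> \<zeta> + t *\<^sub>R \<zeta>) S - Yg (merge \<eta> \<zeta>) S) /\<^sub>R t) \<longlongrightarrow> Yg (merge \<eta> \<zeta>) (k # S)) (at 0)"
        using g.Y_Cons[OF merge[OF \<eta> \<zeta>] dist] by (simp add: shm)
      show "eventually (\<lambda>t::real. (Yg (merge \<eta> \<zeta> + t *\<^sub>R \<zeta>) S - Yg (merge \<eta> \<zeta>) S) /\<^sub>R t =
          (Yg (\<eta> + t *\<^sub>R \<zeta>) S - Yg \<eta> S) /\<^sub>R t) (at 0)"
        using evJ[OF \<eta> \<zeta>] evJ[OF merge[OF \<eta> \<zeta>] \<zeta>]
      proof eventually_elim
        case (elim t)
        have "Yg (merge \<eta> \<zeta> + t *\<^sub>R \<zeta>) S = Yg (\<eta> + t *\<^sub>R \<zeta>) S" "Yg (merge \<eta> \<zeta>) S = Yg \<eta> S"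
          by (intro g.Y_cong elim merge \<eta> \<zeta>; simp add: plus_fun_def mS)+
        then show ?case by simp
      qed
    qed
    have mcont: "continuous_on (\<Omega> \<times> (UNIV \<rightarrow> W')) (\<lambda>(\<eta>, \<zeta>). Yg (merge \<eta> \<zeta>) (k # S))"
    proof -
      have "continuous_on (\<Omega> \<times> (UNIV \<rightarrow> W')) (\<lambda>p. merge (fst p) (snd p) L)" for L
      proof -
        have "continuous_on (\<Omega> \<times> (UNIV \<rightarrow> W')) (\<lambda>p. snd p M)" "continuous_on (\<Omega> \<times> (UNIV \<rightarrow> W')) (\<lambda>p. fst p M)" for M
          by (rule continuous_on_compose2[OF continuous_on_coordinate[of UNIV] continuous_on_snd[OF continuous_on_id]]
            continuous_on_compose2[OF continuous_on_coordinate[of UNIV] continuous_on_fst[OF continuous_on_id]]; simp)+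
        then show ?thesis
          by (cases L; cases "hd L = k") (simp_all add: merge_def)
      qed
      then have "continuous_on (\<Omega> \<times> (UNIV \<rightarrow> W')) (\<lambda>p. merge (fst p) (snd p))"
        by (rule continuous_on_coordinatewise_then_product)
      then have "continuous_on (\<Omega> \<times> (UNIV \<rightarrow> W')) (\<lambda>p. Yg (merge (fst p) (snd p)) (k # S))"
        by (rule continuous_on_compose2[OF g.Y_cont]) (use merge in \<open>auto simp: \<Omega>_def\<close>)
      then show ?thesis by (simp add: case_prod_beta)
    qed
    have evX: "eventually (\<lambda>t::real. \<xi> + t *\<^sub>R shift k \<xi> \<in> jets W N) (at 0)"
      by (rule open_line_in[OF subspace_Pi[OF f.W] openin_jets[OF f.op] \<xi> shift_jets[OF \<xi>]])
    have uw: "((\<lambda>t. u t) \<longlongrightarrow> w) (at 0)"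
      unfolding tendsto_fun_iff
    proof
      fix L show "((\<lambda>t. u t L) \<longlongrightarrow> w L) (at 0)"
      proof (cases "distinct (k # L)")
        case True
        then show ?thesis using f.Y_Cons[OF \<xi> True] by (simp add: u_def w_def Z_def)
      next
        case False
        then have "u t L = 0" "w L = 0" for t by (simp_all only: u_def w_def if_False)
        then show ?thesis by simp
      qed
    qed
    have wW: "w \<in> UNIV \<rightarrow> W'"
      using f.Y_range[OF W' g.W _ \<xi>] fN N'W' subspace_0[OF g.W] by (auto simp: w_def)
    have uW: "eventually (\<lambda>t. u t \<in> UNIV \<rightarrow> W') (at 0)"
      using evX
    proof eventually_elim
      case (elim t)
      then show ?case using Z[OF elim] Z[OF \<xi>] g.W
        by (auto simp: u_def jets_def intro!: subspace_scale subspace_diff subspace_0)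
    qed
    have lim: "((\<lambda>t::real. (Yg (Z \<xi> + t *\<^sub>R u t) S - Yg (Z \<xi>) S) /\<^sub>R t) \<longlongrightarrow> Yg (merge (Z \<xi>) w) (k # S)) (at 0)"
      by (rule strict_directional[where W = "UNIV \<rightarrow> W'" and \<Omega> = \<Omega> and \<Phi> = "\<lambda>\<eta>. Yg \<eta> S"
            and d = "\<lambda>\<eta> \<zeta>. Yg (merge \<eta> \<zeta>) (k # S)" and x = "Z \<xi>" and y = "\<lambda>_. Z \<xi>" and h = "\<lambda>t. t" and u = u and w = w])
         (use subspace_Pi[OF g.W] openin_jets[OF g.op] Z[OF \<xi>] dirder mcont uw uW wW
          in \<open>auto simp: \<Omega>_def eventually_at_filter jets_def\<close>)
    \<comment> \<open>At sublists of \<open>S\<close> the direction \<open>w\<close> agrees with the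
      shift of \<open>Z \<xi>\<close>, and \<open>Y_cong\<close> looks no further.\<close>
    have eq: "Yg (merge (Z \<xi>) w) (k # S) = Yg (Z \<xi>) (k # S)"
    proof (rule g.Y_cong[OF merge[OF Z[OF \<xi>] wW] Z[OF \<xi>]])
      fix L assume L: "L \<in> set (subseqs (k # S))"
      then have "distinct L" using dist subseqs_distinctD by blast
      from L consider "L \<in> set (subseqs S)" | M where "L = k # M"
        unfolding set_subseqs_Cons by blast
      then show "merge (Z \<xi>) w L = Z \<xi> L"
        by cases (use mS \<open>distinct L\<close> in \<open>auto simp: merge_def Z_def w_def\<close>)
    qed
    \<comment> \<open>Replacing the true increment of the jet by \<open>t *\<^sub>R u t\<close>
      affects only lists \<open>L\<close> for which \<open>k # L\<close> has a repetition, and no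
      sublist of \<open>S\<close> is of this kind.\<close>
    have ev: "eventually (\<lambda>t::real. (Yg (Z \<xi> + t *\<^sub>R u t) S - Yg (Z \<xi>) S) /\<^sub>R t
        = (Yg (Z (\<xi> + t *\<^sub>R shift k \<xi>)) S - Yg (Z \<xi>) S) /\<^sub>R t) (at 0)"
    proof -
      have tu: "((\<lambda>t. Z \<xi> + t *\<^sub>R u t) \<longlongrightarrow> Z \<xi> + 0 *\<^sub>R w) (at 0)"
        by (intro tendsto_add tendsto_scaleR_lc tendsto_const tendsto_ident_at uw)
      obtain T where T: "open T" "jets W' N' = (UNIV \<rightarrow> W') \<inter> T"
        using openin_jets[OF g.op] by (metis openin_open)
      have "eventually (\<lambda>t. Z \<xi> + t *\<^sub>R u t \<in> T) (at 0)"
        by (rule topological_tendstoD[OF tu T(1)]) (use T Z[OF \<xi>] in auto)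
      with evX uW have "eventually (\<lambda>t. \<xi> + t *\<^sub>R shift k \<xi> \<in> jets W N \<and> Z \<xi> + t *\<^sub>R u t \<in> jets W' N' \<and> t \<noteq> 0) (at 0)"
        unfolding eventually_at_filter
      proof eventually_elim
        case (elim t)
        have "Z \<xi> + t *\<^sub>R u t \<in> UNIV \<rightarrow> W'" if "t \<noteq> 0"
          using elim that Z[OF \<xi>] g.W
          by (auto simp: jets_def plus_fun_def scaleR_fun_def Pi_iff intro!: subspace_add subspace_scale)
        with elim show ?case using T by auto
      qed
      then show ?thesis
      proof eventually_elim
        case (elim t)
        have "Yg (Z \<xi> + t *\<^sub>R u t) S = Yg (Z (\<xi> + t *\<^sub>R shift k \<xi>)) S"
        proof (rule g.Y_cong)
          fix L assume L: "L \<in> set (subseqs S)"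
          have "distinct L" using dist L subseqs_distinctD by fastforce
          moreover have "set L \<subseteq> set S" using subseqs_set[OF L] by blast
          ultimately have "distinct (k # L)" using dist by auto
          then show "(Z \<xi> + t *\<^sub>R u t) L = Z (\<xi> + t *\<^sub>R shift k \<xi>) L"
            using elim by (simp add: u_def plus_fun_def scaleR_fun_def)
        qed (use elim Z in auto)
        then show ?case by simp
      qed
    qed
    show "((\<lambda>t::real. (Yg (Z (\<xi> + t *\<^sub>R shift k \<xi>)) S - Yg (Z \<xi>) S) /\<^sub>R t) \<longlongrightarrow> Yg (Z \<xi>) (k # S)) (at 0)"
      by (rule Lim_transform_eventually[OF lim[unfolded eq] ev])
  next
    fix \<xi> \<xi>' S assume \<xi>: "\<xi> \<in> jets W N" "\<xi>' \<in> jets W N" "\<And>L. L \<in> set (subseqs S) \<Longrightarrow> \<xi> L = \<xi>' L"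
    have sub: "M \<in> set (subseqs S)" if "L \<in> set (subseqs S)" "M \<in> set (subseqs L)" for L M :: "nat list" and S
      using that
    proof (induction S arbitrary: L M)
      case (Cons a S)
      from Cons.prems(1) consider "L \<in> set (subseqs S)" | L' where "L = a # L'" "L' \<in> set (subseqs S)"
        unfolding set_subseqs_Cons by blast
      then show ?case
      proof cases
        case 1
        then show ?thesis using Cons unfolding set_subseqs_Cons by blast
      next
        case 2
        from Cons.prems(2)[unfolded 2(1) set_subseqs_Cons] Cons.IH[OF 2(2)] show ?thesis
          unfolding set_subseqs_Cons by blast
      qed
    qed simp
    show "Yg (Z \<xi>) S = Yg (Z \<xi>') S"
    proof (rule g.Y_cong[OF Z[OF \<xi>(1)] Z[OF \<xi>(2)]])
      fix L assume L: "L \<in> set (subseqs S)"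
      have "Yf \<xi> L = Yf \<xi>' L"
        by (rule f.Y_cong[OF \<xi>(1,2)]) (rule \<xi>(3), rule sub[OF L])
      then show "Z \<xi> L = Z \<xi>' L" by (simp add: Z_def)
    qed
  next
    show "continuous_on (jets W N) (\<lambda>\<xi>. Yg (Z \<xi>) S)" for S
      by (rule continuous_on_compose2[OF g.Y_cont Zcont]) (use Z in auto)
  qed (use f.W f.op in auto)
  then show ?thesis by blast
qed

theorem bastiani_smooth_on_compose:
  fixes f :: "'a::locally_convex_space \<Rightarrow> 'b::locally_convex_space" and g :: "'b \<Rightarrow> 'c::locally_convex_space"
  assumes "bastiani_smooth_on W N f" "bastiani_smooth_on W' N' g" "f ` N \<subseteq> N'"
    and W: "subspace W" and W': "subspace W'" "closed W'"
  shows "bastiani_smooth_on W N (g \<circ> f)"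
proof -
  obtain D D' where "bastiani W N f D" "bastiani W' N' g D'"
    using assms by (auto simp: bastiani_smooth_on_iff)
  then obtain Y where "jet_lift W N (g \<circ> f) Y"
    using jet_lift_comp[OF bastiani.jet_lift_faa bastiani.jet_lift_faa \<open>closed W'\<close> assms(3)] by blast
  then show ?thesis
    using jet_lift.bastiani by (auto simp: bastiani_smooth_on_iff[OF W])
qed

section \<open>Calculus of Michal--Bastiani smooth maps\<close>

lemma bastiani_smooth_on_imp_open: "bastiani_smooth_on W N f \<Longrightarrow> openin (top_of_set W) N"
  by (simp add: bastiani_smooth_on_def)

lemma bastiani_restrict:
  assumes "bastiani W N f D" "openin (top_of_set W) N'" "N' \<subseteq> N" "\<And>x. x \<in> N' \<Longrightarrow> g x = f x"
  shows "bastiani W N' g D"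
proof -
  interpret bastiani W N f D by fact
  show ?thesis
  proof
    show "continuous_on (N' \<times> (UNIV \<rightarrow> W)) (\<lambda>(x, v). D k x v)" for k
      by (rule continuous_on_subset[OF D_cont]) (use assms in auto)
    show "((\<lambda>t::real. (D k (x + t *\<^sub>R v k) v - D k x v) /\<^sub>R t) \<longlongrightarrow> D (Suc k) x v) (at 0)"
      if "x \<in> N'" "v \<in> UNIV \<rightarrow> W" for k x v
      using that assms(3) by (intro D_Suc) auto
  qed (use assms W D_0 in auto)
qed

lemma bastiani_smooth_on_subset:
  fixes f :: "'a::locally_convex_space \<Rightarrow> 'b::locally_convex_space"
  assumes "bastiani_smooth_on W N f" "subspace W" "openin (top_of_set W) N'" "N' \<subseteq> N" "\<And>x. x \<in> N' \<Longrightarrow> g x = f x"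
  shows "bastiani_smooth_on W N' g"
proof -
  obtain D where "bastiani W N f D" using assms by (auto simp: bastiani_smooth_on_iff)
  from bastiani_restrict[of W N f D N' g, OF this assms(3,4) assms(5)]
  show ?thesis using assms(2) by (auto simp: bastiani_smooth_on_iff)
qed

text \<open>Each derivative is a limit formed from the preceding one, so all are determined by
  \<open>f\<close>. Locally chosen derivatives therefore agree on overlaps and can be glued.\<close>

lemma bastiani_unique:
  assumes "bastiani W N f D" "bastiani W N' f D'" "x \<in> N" "x \<in> N'" "v \<in> UNIV \<rightarrow> W"
  shows "D k x v = D' k x v"
proof -
  interpret A: bastiani W N f D by fact
  interpret B: bastiani W N' f D' by fact
  show ?thesis
    using assms(3,4)
  proof (induction k arbitrary: x)
    case 0
    then show ?case using assms(5) by (simp add: A.D_0 B.D_0)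
  next
    case (Suc k)
    have vk: "v k \<in> W" using assms(5) by auto
    have "((\<lambda>t::real. (D k (x + t *\<^sub>R v k) v - D k x v) /\<^sub>R t) \<longlongrightarrow> D' (Suc k) x v) (at 0)"
    proof (rule Lim_transform_eventually[OF B.D_Suc[OF Suc.prems(2) assms(5)]])
      show "eventually (\<lambda>t::real. (D' k (x + t *\<^sub>R v k) v - D' k x v) /\<^sub>R t =
          (D k (x + t *\<^sub>R v k) v - D k x v) /\<^sub>R t) (at 0)"
        using A.line_in[OF Suc.prems(1) vk] B.line_in[OF Suc.prems(2) vk]
        by eventually_elim (simp add: Suc)
    qed
    from tendsto_unique[OF _ A.D_Suc[OF Suc.prems(1) assms(5)] this] show ?case by simp
  qed
qed

lemma bastiani_smooth_on_local:
  fixes f :: "'a::locally_convex_space \<Rightarrow> 'b::locally_convex_space"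
  assumes W: "subspace W"
    and loc: "\<And>x. x \<in> N \<Longrightarrow> \<exists>N'\<subseteq>N. x \<in> N' \<and> bastiani_smooth_on W N' f"
  shows "bastiani_smooth_on W N f"
proof -
  obtain M where M: "\<And>x. x \<in> N \<Longrightarrow> M x \<subseteq> N" "\<And>x. x \<in> N \<Longrightarrow> x \<in> M x" "\<And>x. x \<in> N \<Longrightarrow> bastiani_smooth_on W (M x) f"
    using loc by metis
  then have "\<forall>x\<in>N. \<exists>D. bastiani W (M x) f D"
    by (simp add: bastiani_smooth_on_iff[OF W])
  then obtain D where D: "\<And>x. x \<in> N \<Longrightarrow> bastiani W (M x) f (D x)" by metis
  have opM: "openin (top_of_set W) (M x)" if "x \<in> N" for x
    using M(3)[OF that] by (rule bastiani_smooth_on_imp_open)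
  have eq: "D y k y v = D x k y v" if "x \<in> N" "y \<in> M x" "v \<in> UNIV \<rightarrow> W" for x y k v
    using bastiani_unique[OF D D, of y x y v k] that M by blast
  have "bastiani W N f (\<lambda>k x v. D x k x v)"
  proof
    show "openin (top_of_set W) N"
      by (subst openin_subopen) (use opM M in blast)
  next
    fix x and v :: "nat \<Rightarrow> 'a" assume xv: "x \<in> N" "v \<in> UNIV \<rightarrow> W"
    interpret bastiani W "M x" f "D x" by (rule D) fact
    show "D x 0 x v = f x" using D_0 M xv by blast
    fix k
    have vk: "v k \<in> W" using xv by auto
    show "((\<lambda>t::real. (D (x + t *\<^sub>R v k) k (x + t *\<^sub>R v k) v - D x k x v) /\<^sub>R t) \<longlongrightarrow> D x (Suc k) x v) (at 0)"
    proof (rule Lim_transform_eventually[OF D_Suc[OF M(2)[OF xv(1)] xv(2)]])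
      show "eventually (\<lambda>t::real. (D x k (x + t *\<^sub>R v k) v - D x k x v) /\<^sub>R t =
          (D (x + t *\<^sub>R v k) k (x + t *\<^sub>R v k) v - D x k x v) /\<^sub>R t) (at 0)"
        using line_in[OF M(2)[OF xv(1)] vk] by eventually_elim (use eq xv in simp)
    qed
  next
    fix k
    show "continuous_on (N \<times> (UNIV \<rightarrow> W)) (\<lambda>(x, v). D x k x v)"
      unfolding continuous_on_def
    proof
      fix p :: "'a \<times> (nat \<Rightarrow> 'a)" assume p: "p \<in> N \<times> (UNIV \<rightarrow> W)"
      then obtain x v where xv: "p = (x, v)" "x \<in> N" "v \<in> UNIV \<rightarrow> W" by auto
      interpret bastiani W "M x" f "D x" by (rule D) fact
      obtain T where T: "open T" "M x = W \<inter> T"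
        using opM[OF xv(2)] by (metis openin_open)
      have NW: "N \<subseteq> W"
        using M(2) opM openin_imp_subset by blast
      have pM: "p \<in> M x \<times> (UNIV \<rightarrow> W)" using xv M by auto
      have "((\<lambda>(x', v). D x k x' v) \<longlongrightarrow> (case p of (x', v) \<Rightarrow> D x k x' v)) (at p within M x \<times> (UNIV \<rightarrow> W))"
        using D_cont[of k] pM unfolding continuous_on_def by (rule bspec)
      moreover have "at p within M x \<times> (UNIV \<rightarrow> W) = at p within N \<times> (UNIV \<rightarrow> W)"
        by (rule at_within_nhd[of p "T \<times> UNIV"])
           (use pM T M(1)[OF xv(2)] NW in \<open>auto simp: open_Times\<close>)
      moreover have "eventually (\<lambda>q. (case q of (x', v) \<Rightarrow> D x k x' v) = (case q of (x', v) \<Rightarrow> D x' k x' v))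
          (at p within M x \<times> (UNIV \<rightarrow> W))"
        unfolding eventually_at_filter using eq[OF xv(2)] by (intro always_eventually) auto
      ultimately show "((\<lambda>(x, v). D x k x v) \<longlongrightarrow> (case p of (x, v) \<Rightarrow> D x k x v)) (at p within N \<times> (UNIV \<rightarrow> W))"
        using xv(1) by (auto elim: Lim_transform_eventually)
    qed
  qed (rule W)
  then show ?thesis by (auto simp: bastiani_smooth_on_iff[OF W])
qed

lemma bastiani_smooth_on_imp_continuous:
  fixes f :: "'a::locally_convex_space \<Rightarrow> 'b::locally_convex_space"
  assumes "bastiani_smooth_on W N f" "subspace W"
  shows "continuous_on N f"
proof -
  obtain D where "bastiani W N f D" using assms by (auto simp: bastiani_smooth_on_iff)
  then interpret bastiani W N f D .
  have "continuous_on N (\<lambda>x. (x, \<lambda>_::nat. 0::'a))"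
    by (intro continuous_intros)
  then have "continuous_on N (\<lambda>x. case (x, \<lambda>_. 0) of (x, v) \<Rightarrow> D 0 x v)"
    by (rule continuous_on_compose2[OF D_cont[of 0]]) (use W in \<open>auto simp: subspace_0\<close>)
  then show ?thesis
    by (rule continuous_on_eq) (use W D_0 in \<open>auto simp: subspace_0\<close>)
qed

lemma bastiani_smooth_on_Pair:
  fixes f :: "'a::locally_convex_space \<Rightarrow> 'b::locally_convex_space" and g :: "'a \<Rightarrow> 'c::locally_convex_space"
  assumes "bastiani_smooth_on W N f" "bastiani_smooth_on W N g" "subspace W"
  shows "bastiani_smooth_on W N (\<lambda>x. (f x, g x))"
proof -
  obtain D D' where DD: "bastiani W N f D" "bastiani W N g D'" using assms by (auto simp: bastiani_smooth_on_iff)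
  interpret f: bastiani W N f D by fact
  interpret g: bastiani W N g D' by fact
  have "bastiani W N (\<lambda>x. (f x, g x)) (\<lambda>k x v. (D k x v, D' k x v))"
  proof
    show "((\<lambda>t::real. ((D k (x + t *\<^sub>R v k) v, D' k (x + t *\<^sub>R v k) v) - (D k x v, D' k x v)) /\<^sub>R t) \<longlongrightarrow>
      (D (Suc k) x v, D' (Suc k) x v)) (at 0)" if "x \<in> N" "v \<in> UNIV \<rightarrow> W" for k x v
      unfolding minus_prod_def scaleR_prod_def fst_conv snd_conv
      by (intro tendsto_Pair f.D_Suc g.D_Suc that)
    show "continuous_on (N \<times> (UNIV \<rightarrow> W)) (\<lambda>(x, v). (D k x v, D' k x v))" for k
      using continuous_on_Pair[OF f.D_cont[of k] g.D_cont[of k]] by (simp add: case_prod_beta)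
  qed (use f.W f.op f.D_0 g.D_0 in auto)
  then show ?thesis using assms(3) by (auto simp: bastiani_smooth_on_iff)
qed

lemma bastiani_smooth_on_affine:
  fixes f :: "'a::locally_convex_space \<Rightarrow> 'b::locally_convex_space"
  assumes W: "subspace W" and op: "openin (top_of_set W) N" and lin: "linear f" and cont: "continuous_on UNIV f"
  shows "bastiani_smooth_on W N (\<lambda>x. f x + c)"
proof -
  define D where "D k x v = (if k = 0 then f x + c else if k = 1 then f (v 0) else 0)" for k :: nat and x and v :: "nat \<Rightarrow> 'a"
  have "bastiani W N (\<lambda>x. f x + c) D"
  proof
    fix k x and v :: "nat \<Rightarrow> 'a"
    have "eventually (\<lambda>t::real. (D k (x + t *\<^sub>R v k) v - D k x v) /\<^sub>R t = D (Suc k) x v) (at 0)"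
      using eventually_at_filter[of "\<lambda>t. t \<noteq> (0::real)" 0 UNIV, simplified]
      by eventually_elim (auto simp: D_def linear_add[OF lin] linear_scale[OF lin])
    then show "((\<lambda>t::real. (D k (x + t *\<^sub>R v k) v - D k x v) /\<^sub>R t) \<longlongrightarrow> D (Suc k) x v) (at 0)"
      by (rule tendsto_eventually)
  next
    fix k
    have "continuous_on (N \<times> (UNIV \<rightarrow> W)) (\<lambda>p. f (fst p))"
      by (rule continuous_on_compose2[OF cont continuous_on_fst[OF continuous_on_id]]) simp
    moreover have "continuous_on (N \<times> (UNIV \<rightarrow> W)) (\<lambda>p. snd p 0)"
      by (rule continuous_on_compose2[OF continuous_on_coordinate[of UNIV] continuous_on_snd[OF continuous_on_id]]) simp
    then have "continuous_on (N \<times> (UNIV \<rightarrow> W)) (\<lambda>p. f (snd p 0))"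
      by (rule continuous_on_compose2[OF cont]) simp
    moreover have "continuous_on (N \<times> (UNIV \<rightarrow> W)) (\<lambda>p. f (fst p) + c)"
      by (rule continuous_on_add[OF calculation(1) continuous_on_const])
    ultimately show "continuous_on (N \<times> (UNIV \<rightarrow> W)) (\<lambda>(x, v). D k x v)"
      by (cases "k = 0"; cases "k = 1") (simp_all add: D_def case_prod_beta)
  qed (use W op in \<open>auto simp: D_def\<close>)
  then show ?thesis by (auto simp: bastiani_smooth_on_iff[OF W])
qed

lemma bastiani_smooth_on_linear:
  fixes f :: "'a::locally_convex_space \<Rightarrow> 'b::locally_convex_space"
  assumes "subspace W" "openin (top_of_set W) N" "linear f" "continuous_on UNIV f"
  shows "bastiani_smooth_on W N f"
  using bastiani_smooth_on_affine[OF assms, of 0] by simp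

lemma bastiani_smooth_on_const:
  fixes c :: "'b::locally_convex_space"
  assumes "subspace W" "openin (top_of_set W) N"
  shows "bastiani_smooth_on W N (\<lambda>x::'a::locally_convex_space. c)"
  using bastiani_smooth_on_affine[OF assms linear_zero continuous_on_const, of c] by simp

lemma bastiani_smooth_on_add:
  fixes f g :: "'a::locally_convex_space \<Rightarrow> 'b::locally_convex_space"
  assumes "bastiani_smooth_on W N f" "bastiani_smooth_on W N g" "subspace W"
  shows "bastiani_smooth_on W N (\<lambda>x. f x + g x)"
proof -
  have "linear (\<lambda>p::'b\<times>'b. fst p + snd p)"
    by (rule linearI) (auto simp: algebra_simps)
  then have "bastiani_smooth_on UNIV UNIV (\<lambda>p::'b\<times>'b. fst p + snd p)"
    by (intro bastiani_smooth_on_linear) (auto intro!: continuous_on_add continuous_on_fst continuous_on_snd continuous_on_id)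
  from bastiani_smooth_on_compose[OF bastiani_smooth_on_Pair[OF assms] this _ assms(3)]
  show ?thesis by (simp add: comp_def)
qed

section \<open>Smooth functions of one real variable and a flat cutoff\<close>

lemma bastiani_smooth_on_real:
  fixes d :: "nat \<Rightarrow> real \<Rightarrow> real"
  assumes "\<And>k x. (d k has_real_derivative d (Suc k) x) (at x)"
  shows "bastiani_smooth_on UNIV UNIV (d 0)"
proof -
  have "bastiani UNIV UNIV (d 0) (\<lambda>k x v. d k x * (\<Prod>l<k. v l))"
  proof
    fix k x and v :: "nat \<Rightarrow> real"
    show "((\<lambda>t::real. (d k (x + t *\<^sub>R v k) * (\<Prod>l<k. v l) - d k x * (\<Prod>l<k. v l)) /\<^sub>R t) \<longlongrightarrow>
       d (Suc k) x * (\<Prod>l<Suc k. v l)) (at 0)"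
    proof -
      have "((\<lambda>t. d k (x + t * v k)) has_real_derivative d (Suc k) (x + 0 * v k) * v k) (at 0)"
        by (rule DERIV_chain'[where g = "d k"]) (auto intro!: derivative_eq_intros assms)
      then have "((\<lambda>t. (d k (x + t * v k) - d k x) / t) \<longlongrightarrow> d (Suc k) x * v k) (at 0)"
        by (simp add: DERIV_def)
      from tendsto_mult_right[OF this, of "\<Prod>l<k. v l"]
      show ?thesis by (simp add: divide_inverse algebra_simps)
    qed
  next
    fix k
    have dc: "continuous_on UNIV (d k)"
      using assms by (meson DERIV_continuous_on)
    have "continuous_on UNIV (\<lambda>p::real \<times> (nat \<Rightarrow> real). d k (fst p))"
      by (rule continuous_on_compose2[OF dc continuous_on_fst[OF continuous_on_id]]) simp
    moreover have "continuous_on UNIV (\<lambda>p::real \<times> (nat \<Rightarrow> real). \<Prod>l<k. snd p l)"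
      by (rule continuous_on_prod)
         (rule continuous_on_compose2[OF continuous_on_coordinate[of UNIV] continuous_on_snd[OF continuous_on_id]], simp)
    ultimately have "continuous_on UNIV (\<lambda>(x, v). d k x * (\<Prod>l<k. v l))"
      by (simp add: case_prod_beta continuous_on_mult)
    then show "continuous_on (UNIV \<times> (UNIV \<rightarrow> UNIV)) (\<lambda>(x, v). d k x * (\<Prod>l<k. v l))"
      by (rule continuous_on_subset) simp
  qed auto
  then show ?thesis by (auto simp: bastiani_smooth_on_iff)
qed

lemma poly_exp_tendsto_0:
  fixes p :: "real poly"
  assumes "r > 0"
  shows "((\<lambda>y. poly p y * exp (- r * y)) \<longlongrightarrow> 0) at_top"
proof -
  have "((\<lambda>y. y ^ i * exp (- r * y)) \<longlongrightarrow> 0) at_top" for i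
  proof -
    have "filterlim (\<lambda>y. r * y) at_top at_top"
      using assms by (simp add: filterlim_tendsto_pos_mult_at_top[OF tendsto_const _ filterlim_ident])
    from filterlim_compose[OF tendsto_power_div_exp_0 this]
    have "((\<lambda>y. (r * y) ^ i / exp (r * y)) \<longlongrightarrow> 0) at_top" .
    from tendsto_mult_right_zero[OF this, of "1 / r ^ i"] show ?thesis
      using assms by (simp add: power_mult_distrib exp_minus field_simps)
  qed
  then have "((\<lambda>y. \<Sum>i\<le>degree p. coeff p i * (y ^ i * exp (- r * y))) \<longlongrightarrow> 0) at_top"
    by (intro tendsto_null_sum tendsto_mult_right_zero) auto
  then show ?thesis by (simp add: poly_altdef sum_distrib_right mult.assoc)
qed

text \<open>For fixed \<open>r\<close> this class of functions is closed under differentiation, so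
  smoothness of all orders, in particular at 0, reduces to a single derivative.\<close>

definition flat :: "real \<Rightarrow> real poly \<Rightarrow> real \<Rightarrow> real" where
  "flat r p u = (if u \<le> 0 then 0 else poly p (1 / u) * exp (- r / u))"

lemma flat_over_tendsto_0:
  assumes "r > 0"
  shows "((\<lambda>u. flat r p u / u) \<longlongrightarrow> 0) (at 0)"
proof -
  have "((\<lambda>u. poly (pCons 0 p) (1 / u) * exp (- r * (1 / u))) \<longlongrightarrow> 0) (at_right 0)"
    by (rule filterlim_compose[OF poly_exp_tendsto_0[OF assms]])
       (simp add: filterlim_inverse_at_top_right flip: inverse_eq_divide)
  moreover have "eventually (\<lambda>u. poly (pCons 0 p) (1 / u) * exp (- r * (1 / u)) = flat r p u / u) (at_right 0)"
    by (auto simp: eventually_at_filter flat_def)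
  ultimately have "((\<lambda>u. flat r p u / u) \<longlongrightarrow> 0) (at_right 0)"
    by (rule Lim_transform_eventually)
  moreover have "((\<lambda>u. flat r p u / u) \<longlongrightarrow> 0) (at_left 0)"
    by (rule tendsto_eventually) (auto simp: eventually_at_filter flat_def)
  ultimately show ?thesis by (simp add: filterlim_split_at)
qed

text \<open>With y = 1/u, the chain rule contributes the factor -y^2, whence the polynomial y^2 (r p
  - p'). At 0 the exponential beats the polynomial in the difference quotient.\<close>

lemma flat_deriv:
  assumes "r > 0"
  shows "(flat r p has_real_derivative flat r ([:0, 0, 1:] * (smult r p - pderiv p)) x) (at x)"
proof -
  consider "x < 0" | "x = 0" | "x > 0" by linarith
  then show ?thesis
  proof cases
    case 1
    have "((\<lambda>_. 0) has_real_derivative 0) (at x)" by simp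
    then have "(flat r p has_real_derivative 0) (at x)"
      by (rule has_field_derivative_transform_within_open[of _ _ _ "{..<0}"]) (use 1 in \<open>auto simp: flat_def\<close>)
    then show ?thesis using 1 by (simp add: flat_def)
  next
    case 2
    then show ?thesis using flat_over_tendsto_0[OF assms, of p] by (simp add: DERIV_def flat_def)
  next
    case 3
    have "((\<lambda>u. poly p (1 / u) * exp (- r / u)) has_real_derivative
        (poly (pderiv p) (1 / x) * (- 1 / x\<^sup>2)) * exp (- r / x) + poly p (1 / x) * (exp (- r / x) * (r / x\<^sup>2))) (at x)"
      using 3 by (auto intro!: derivative_eq_intros DERIV_chain2[OF poly_DERIV] simp: power2_eq_square field_simps)
    then have "(flat r p has_real_derivative
        (poly (pderiv p) (1 / x) * (- 1 / x\<^sup>2)) * exp (- r / x) + poly p (1 / x) * (exp (- r / x) * (r / x\<^sup>2))) (at x)"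
      by (rule has_field_derivative_transform_within_open[of _ _ _ "{0<..}"]) (use 3 in \<open>auto simp: flat_def\<close>)
    then show ?thesis using 3 by (simp add: flat_def power2_eq_square field_simps)
  qed
qed

text \<open>The function is u exp(-r/u) for u > 0. Because exp(-r/u) \<ge> 1 - r/u, it falls short
  of u by at most r. Hence \<open>u - \<psi> u\<close> is the identity for u \<le> 0 and stays
  between 0 and \<open>r\<close> for u \<ge> 0, which is the use made of it in the retraction of the
  simplex.\<close>

lemma smooth_cutoff:
  assumes "r > 0"
  obtains \<psi> :: "real \<Rightarrow> real" where "bastiani_smooth_on UNIV UNIV \<psi>"
    "\<And>u. u \<le> 0 \<Longrightarrow> \<psi> u = 0" "\<And>u. u \<ge> 0 \<Longrightarrow> 0 \<le> \<psi> u \<and> \<psi> u \<le> u \<and> u - \<psi> u \<le> r"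
proof
  define \<psi> where "\<psi> u = u * flat r 1 u" for u
  define P where "P p = [:0, 0, 1:] * (smult r p - pderiv p)" for p :: "real poly"
  \<comment> \<open>The factor u in \<open>\<psi>\<close> lowers the degree in 1/u by one, so the
    first derivative already belongs to the class \<open>flat\<close>, with the polynomial 1 + r y;
    from there on \<open>P\<close> produces the next polynomial.\<close>
  define d where "d k = (if k = 0 then \<psi> else flat r ((P ^^ (k - 1)) (1 + [:0, r:])))" for k :: nat
  have "(d k has_real_derivative d (Suc k) x) (at x)" for k x
  proof (cases k)
    case 0
    have "(\<psi> has_real_derivative flat r 1 x + x * flat r (P 1) x) (at x)"
      unfolding \<psi>_def P_def using flat_deriv[OF assms, of 1 x] by (auto intro!: derivative_eq_intros)
    moreover have "flat r 1 x + x * flat r (P 1) x = flat r (1 + [:0, r:]) x"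
      by (simp add: flat_def P_def field_simps)
    ultimately show ?thesis by (simp add: d_def 0)
  next
    case (Suc n)
    then show ?thesis using flat_deriv[OF assms, of "(P ^^ n) (1 + [:0, r:])" x]
      by (simp add: d_def P_def)
  qed
  from bastiani_smooth_on_real[of d, OF this] show "bastiani_smooth_on UNIV UNIV \<psi>"
    by (simp add: d_def)
  show "\<psi> u = 0" if "u \<le> 0" for u using that by (simp add: \<psi>_def flat_def)
  show "0 \<le> \<psi> u \<and> \<psi> u \<le> u \<and> u - \<psi> u \<le> r" if "u \<ge> 0" for u
  proof (cases "u = 0")
    case False
    with that have u: "u > 0" by simp
    have "1 - r / u \<le> exp (- r / u)" using exp_ge_add_one_self[of "- r / u"] by simp
    from mult_left_mono[OF this, of u] u have "u - r \<le> u * exp (- r / u)" by (simp add: algebra_simps)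
    moreover have "exp (- r / u) \<le> 1" using assms u by simp
    ultimately show ?thesis using u by (simp add: \<psi>_def flat_def mult_left_le)
  qed (use assms in \<open>simp add: \<psi>_def\<close>)
qed

section \<open>Smooth maps between manifolds\<close>

abbreviation euc :: "nat \<Rightarrow> point set" where
  "euc n \<equiv> topspace (Euclidean_space n)"

lemma openin_Euclidean_space_iff: "openin (Euclidean_space n) N \<longleftrightarrow> openin (top_of_set (euc n)) N"
  by (simp add: Euclidean_space_def euclidean_product_topology)

lemma subspace_euc: "subspace (euc n)"
  by (auto simp: topspace_Euclidean_space subspace_def zero_fun_def plus_fun_def scaleR_fun_def)

lemma closed_euc: "closed (euc n)"
  using closedin_Euclidean_imp_closed[of n "euc n"] by simp

text \<open>The part of the manifold axioms on which the calculus of smooth maps relies.\<close>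

definition charted :: "('m, 'e::locally_convex_space) manifold \<Rightarrow> bool" where
  "charted M \<longleftrightarrow> subspace (model M) \<and> closed (model M) \<and> (\<Union>(U, \<phi>)\<in>charts M. U) = topspace (mtop M) \<and>
     (\<forall>(U, \<phi>)\<in>charts M. inj_on \<phi> U \<and> openin (top_of_set (model M)) (\<phi> ` U))"

lemma chartedD:
  assumes "charted M"
  shows "subspace (model M)" "closed (model M)"
    "\<And>x. x \<in> topspace (mtop M) \<Longrightarrow> \<exists>U \<phi>. (U, \<phi>) \<in> charts M \<and> x \<in> U"
    "\<And>U \<phi>. (U, \<phi>) \<in> charts M \<Longrightarrow> U \<subseteq> topspace (mtop M)"
    "\<And>U \<phi>. (U, \<phi>) \<in> charts M \<Longrightarrow> inj_on \<phi> U"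
    "\<And>U \<phi>. (U, \<phi>) \<in> charts M \<Longrightarrow> openin (top_of_set (model M)) (\<phi> ` U)"
    "\<And>U \<phi>. (U, \<phi>) \<in> charts M \<Longrightarrow> \<phi> ` U \<subseteq> model M"
proof -
  have U: "(\<Union>(U, \<phi>)\<in>charts M. U) = topspace (mtop M)"
    and c: "\<forall>(U, \<phi>)\<in>charts M. inj_on \<phi> U \<and> openin (top_of_set (model M)) (\<phi> ` U)"
    using assms by (simp_all add: charted_def)
  show "subspace (model M)" "closed (model M)"
    using assms by (simp_all add: charted_def)
  show "\<exists>U \<phi>. (U, \<phi>) \<in> charts M \<and> x \<in> U" if "x \<in> topspace (mtop M)" for x
    using that unfolding U[symmetric] by auto
  fix U \<phi> assume UM: "(U, \<phi>) \<in> charts M"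
  then show "U \<subseteq> topspace (mtop M)" unfolding U[symmetric] by auto
  show "inj_on \<phi> U" "openin (top_of_set (model M)) (\<phi> ` U)" using bspec[OF c UM] by simp_all
  then show "\<phi> ` U \<subseteq> model M" using openin_imp_subset by blast
qed

lemma smooth_mapD:
  assumes "smooth_map M K f"
  shows "continuous_map (mtop M) (mtop K) f"
    "\<And>U \<phi> V \<psi>. (U, \<phi>) \<in> charts M \<Longrightarrow> (V, \<psi>) \<in> charts K \<Longrightarrow>
        bastiani_smooth_on (model M) (\<phi> ` (U \<inter> f -` V)) (\<psi> \<circ> f \<circ> inv_into U \<phi>)"
  using assms by (auto simp: smooth_map_def)

lemma smooth_mapI:
  assumes "continuous_map (mtop M) (mtop K) f"
    "\<And>U \<phi> V \<psi>. (U, \<phi>) \<in> charts M \<Longrightarrow> (V, \<psi>) \<in> charts K \<Longrightarrow>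
        bastiani_smooth_on (model M) (\<phi> ` (U \<inter> f -` V)) (\<psi> \<circ> f \<circ> inv_into U \<phi>)"
  shows "smooth_map M K f"
  using assms by (auto simp: smooth_map_def)

lemma smooth_map_in: "smooth_map M K f \<Longrightarrow> x \<in> topspace (mtop M) \<Longrightarrow> f x \<in> topspace (mtop K)"
  using smooth_mapD(1)[of M K f] by (auto simp: continuous_map_def)

text \<open>One intermediate chart of \<open>K\<close> may capture only a part of the image of a
  chart of \<open>M\<close>, so the chain rule is applied on a neighbourhood of each point and
  smoothness follows from its local nature.\<close>

lemma smooth_map_compose:
  fixes M :: "('m, 'a::locally_convex_space) manifold" and K :: "('k, 'b::locally_convex_space) manifold"
    and L :: "('l, 'c::locally_convex_space) manifold"
  assumes M: "charted M" and K: "charted K" and f: "smooth_map M K f" and g: "smooth_map K L g"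
  shows "smooth_map M L (\<lambda>x. g (f x))"
proof (rule smooth_mapI)
  show "continuous_map (mtop M) (mtop L) (\<lambda>x. g (f x))"
    using continuous_map_compose[OF smooth_mapD(1)[OF f] smooth_mapD(1)[OF g]] by (simp add: comp_def)
next
  fix U \<phi> V \<psi> assume U: "(U, \<phi>) \<in> charts M" and V: "(V, \<psi>) \<in> charts L"
  let ?h = "\<psi> \<circ> (\<lambda>x. g (f x)) \<circ> inv_into U \<phi>"
  show "bastiani_smooth_on (model M) (\<phi> ` (U \<inter> (\<lambda>x. g (f x)) -` V)) ?h"
  proof (rule bastiani_smooth_on_local[OF chartedD(1)[OF M]])
    fix y assume "y \<in> \<phi> ` (U \<inter> (\<lambda>x. g (f x)) -` V)"
    then obtain x where x: "y = \<phi> x" "x \<in> U" "g (f x) \<in> V" by auto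
    have "f x \<in> topspace (mtop K)"
      using smooth_map_in[OF f] chartedD(4)[OF M U] x by auto
    then obtain U' \<phi>' where U': "(U', \<phi>') \<in> charts K" "f x \<in> U'"
      using chartedD(3)[OF K] by metis
    let ?h1 = "\<phi>' \<circ> f \<circ> inv_into U \<phi>" and ?h2 = "\<psi> \<circ> g \<circ> inv_into U' \<phi>'"
    let ?N1 = "\<phi> ` (U \<inter> f -` U')" and ?N2 = "\<phi>' ` (U' \<inter> g -` V)"
    note h1 = smooth_mapD(2)[OF f U U'(1)] and h2 = smooth_mapD(2)[OF g U'(1) V]
    note injU = chartedD(5)[OF M U] and injU' = chartedD(5)[OF K U'(1)]
    obtain T where T: "open T" "?N2 = model K \<inter> T"
      using bastiani_smooth_on_imp_open[OF h2] by (metis openin_open)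
    let ?N = "?N1 \<inter> ?h1 -` T"
    have opN: "openin (top_of_set (model M)) ?N"
      using continuous_openin_preimage_gen[OF bastiani_smooth_on_imp_continuous[OF h1 chartedD(1)[OF M]] T(1)]
        bastiani_smooth_on_imp_open[OF h1] openin_trans by blast
    have inv1: "inv_into U \<phi> (\<phi> z) = z" if "z \<in> U" for z
      using injU that by simp
    have inv2: "inv_into U' \<phi>' (\<phi>' z) = z" if "z \<in> U'" for z
      using injU' that by simp
    have h1N: "?h1 ` ?N \<subseteq> ?N2"
      using chartedD(7)[OF K U'(1)] inv1 T(2) by auto
    have "bastiani_smooth_on (model M) ?N (?h2 \<circ> ?h1)"
      by (rule bastiani_smooth_on_compose[OF bastiani_smooth_on_subset[OF h1 chartedD(1)[OF M] opN] h2 h1N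
            chartedD(1)[OF M] chartedD(1,2)[OF K]]) auto
    then have "bastiani_smooth_on (model M) ?N ?h"
      by (rule bastiani_smooth_on_subset[OF _ chartedD(1)[OF M] opN]) (auto simp: inv1 inv2)
    moreover have "y \<in> ?N"
      using x U' T(2) inv1 by auto
    moreover have "?N \<subseteq> \<phi> ` (U \<inter> (\<lambda>x. g (f x)) -` V)"
    proof
      fix z assume z: "z \<in> ?N"
      then obtain w where w: "z = \<phi> w" "w \<in> U" "f w \<in> U'" by auto
      have "?h1 z \<in> ?N2" using subsetD[OF h1N imageI[OF z]] .
      then have "\<phi>' (f w) \<in> ?N2" using w inv1 by simp
      then have "g (f w) \<in> V" using injU' w by (auto simp: inj_on_def)
      then show "z \<in> \<phi> ` (U \<inter> (\<lambda>x. g (f x)) -` V)" using w by auto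
    qed
    ultimately show "\<exists>N'\<subseteq>\<phi> ` (U \<inter> (\<lambda>x. g (f x)) -` V). y \<in> N' \<and> bastiani_smooth_on (model M) N' ?h"
      by blast
  qed
qed

lemma mtop_prod_manifold [simp]: "mtop (prod_manifold M K) = prod_topology (mtop M) (mtop K)"
  and model_prod_manifold [simp]: "model (prod_manifold M K) = model M \<times> model K"
  by (simp_all add: prod_manifold_def)

lemma charts_prod_manifoldE:
  assumes "(W, \<theta>) \<in> charts (prod_manifold M K)"
  obtains U \<phi> V \<psi> where "W = U \<times> V" "\<theta> = map_prod \<phi> \<psi>" "(U, \<phi>) \<in> charts M" "(V, \<psi>) \<in> charts K"
  using assms by (auto simp: prod_manifold_def)

lemma charts_prod_manifoldI:
  "(U, \<phi>) \<in> charts M \<Longrightarrow> (V, \<psi>) \<in> charts K \<Longrightarrow> (U \<times> V, map_prod \<phi> \<psi>) \<in> charts (prod_manifold M K)"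
  by (auto simp: prod_manifold_def)

lemma subspace_Times': "subspace A \<Longrightarrow> subspace B \<Longrightarrow> subspace (A \<times> B)"
  by (auto simp: subspace_def zero_prod_def)

lemma openin_top_of_set_Times:
  "openin (top_of_set A) S \<Longrightarrow> openin (top_of_set B) T \<Longrightarrow> openin (top_of_set (A \<times> B)) (S \<times> T)"
  by (metis openin_prod_Times_iff prod_topology_subtopology_eu)

lemma charted_prod_manifold:
  assumes M: "charted M" and K: "charted K"
  shows "charted (prod_manifold M K)"
  unfolding charted_def
proof (intro conjI)
  show "(\<Union>(U, \<phi>)\<in>charts (prod_manifold M K). U) = topspace (mtop (prod_manifold M K))"
  proof (intro equalityI subsetI)
    fix p assume "p \<in> (\<Union>(U, \<phi>)\<in>charts (prod_manifold M K). U)"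
    then obtain W \<theta> where "p \<in> W" "(W, \<theta>) \<in> charts (prod_manifold M K)" by blast
    then obtain U \<phi> V \<psi> where "p \<in> U \<times> V" "(U, \<phi>) \<in> charts M" "(V, \<psi>) \<in> charts K"
      by (metis charts_prod_manifoldE)
    then show "p \<in> topspace (mtop (prod_manifold M K))"
      using chartedD(4)[OF M, of U \<phi>] chartedD(4)[OF K, of V \<psi>] by auto
  next
    fix p assume "p \<in> topspace (mtop (prod_manifold M K))"
    then obtain x y where p: "p = (x, y)" "x \<in> topspace (mtop M)" "y \<in> topspace (mtop K)" by auto
    obtain U \<phi> V \<psi> where UV: "(U, \<phi>) \<in> charts M" "x \<in> U" "(V, \<psi>) \<in> charts K" "y \<in> V"
      using chartedD(3)[OF M p(2)] chartedD(3)[OF K p(3)] by blast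
    show "p \<in> (\<Union>(U, \<phi>)\<in>charts (prod_manifold M K). U)"
      by (rule UN_I[OF charts_prod_manifoldI[OF UV(1,3)]]) (simp add: p(1) UV)
  qed
  show "\<forall>(W, \<theta>)\<in>charts (prod_manifold M K). inj_on \<theta> W \<and> openin (top_of_set (model (prod_manifold M K))) (\<theta> ` W)"
  proof (intro ballI, clarify)
    fix W \<theta> assume "(W, \<theta>) \<in> charts (prod_manifold M K)"
    then obtain U \<phi> V \<psi> where WU: "W = U \<times> V" "\<theta> = map_prod \<phi> \<psi>" "(U, \<phi>) \<in> charts M" "(V, \<psi>) \<in> charts K"
      by (rule charts_prod_manifoldE)
    have "map_prod \<phi> \<psi> ` (U \<times> V) = \<phi> ` U \<times> \<psi> ` V" by force
    then show "inj_on \<theta> W \<and> openin (top_of_set (model (prod_manifold M K))) (\<theta> ` W)"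
      using chartedD(5,6)[OF M WU(3)] chartedD(5,6)[OF K WU(4)]
      by (simp add: WU map_prod_inj_on openin_top_of_set_Times)
  qed
qed (use chartedD[OF M] chartedD[OF K] in \<open>auto intro: subspace_Times' closed_Times\<close>)

lemma smooth_map_Pair:
  fixes M :: "('m, 'a::locally_convex_space) manifold" and K :: "('k, 'b::locally_convex_space) manifold"
    and L :: "('l, 'c::locally_convex_space) manifold"
  assumes M: "charted M" and f: "smooth_map M K f" and g: "smooth_map M L g"
  shows "smooth_map M (prod_manifold K L) (\<lambda>x. (f x, g x))"
proof (rule smooth_mapI)
  show "continuous_map (mtop M) (mtop (prod_manifold K L)) (\<lambda>x. (f x, g x))"
    using continuous_map_pairedI[OF smooth_mapD(1)[OF f] smooth_mapD(1)[OF g]] by simp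
next
  fix U \<phi> W \<theta> assume U: "(U, \<phi>) \<in> charts M" and "(W, \<theta>) \<in> charts (prod_manifold K L)"
  then obtain V \<psi> V' \<psi>' where W: "W = V \<times> V'" "\<theta> = map_prod \<psi> \<psi>'" "(V, \<psi>) \<in> charts K" "(V', \<psi>') \<in> charts L"
    by (metis charts_prod_manifoldE)
  note f' = smooth_mapD(2)[OF f U W(3)] and g' = smooth_mapD(2)[OF g U W(4)]
  have eq: "\<phi> ` (U \<inter> (\<lambda>x. (f x, g x)) -` W) = \<phi> ` (U \<inter> f -` V) \<inter> \<phi> ` (U \<inter> g -` V')" (is "?N = _")
    using chartedD(5)[OF M U] by (auto simp: W inj_on_def)
  have op: "openin (top_of_set (model M)) ?N"
    unfolding eq by (intro openin_Int bastiani_smooth_on_imp_open[OF f'] bastiani_smooth_on_imp_open[OF g'])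
  have "bastiani_smooth_on (model M) ?N (\<lambda>z. ((\<psi> \<circ> f \<circ> inv_into U \<phi>) z, (\<psi>' \<circ> g \<circ> inv_into U \<phi>) z))"
    by (intro bastiani_smooth_on_Pair bastiani_smooth_on_subset[OF f' _ op] bastiani_smooth_on_subset[OF g' _ op]
        chartedD(1)[OF M]) (auto simp: eq)
  then show "bastiani_smooth_on (model M) ?N (\<theta> \<circ> (\<lambda>x. (f x, g x)) \<circ> inv_into U \<phi>)"
    by (simp add: W comp_def)
qed

lemma inv_into_map_prod:
  assumes "inj_on \<phi> U" "inj_on \<psi> V" "x \<in> U" "y \<in> V"
  shows "inv_into (U \<times> V) (map_prod \<phi> \<psi>) (\<phi> x, \<psi> y) = (x, y)"
  using inv_into_f_f[OF map_prod_inj_on[OF assms(1,2)], of "(x, y)"] assms by simp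

text \<open>Between charts, \<open>fst\<close> is a linear projection followed by a chart transition
  of \<open>M\<close>; smoothness of the identity is the way in which smoothness of these
  transitions is expressed.\<close>

lemma smooth_map_fst:
  fixes M :: "('m, 'a::locally_convex_space) manifold" and K :: "('k, 'b::locally_convex_space) manifold"
  assumes M: "charted M" and K: "charted K" and id: "smooth_map M M (\<lambda>x. x)"
  shows "smooth_map (prod_manifold M K) M fst"
proof (rule smooth_mapI)
  show "continuous_map (mtop (prod_manifold M K)) (mtop M) fst" by (simp add: continuous_map_fst)
next
  fix W \<theta> V \<psi> assume "(W, \<theta>) \<in> charts (prod_manifold M K)" and V: "(V, \<psi>) \<in> charts M"
  then obtain U \<phi> U' \<phi>' where W: "W = U \<times> U'" "\<theta> = map_prod \<phi> \<phi>'" "(U, \<phi>) \<in> charts M" "(U', \<phi>') \<in> charts K"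
    by (metis charts_prod_manifoldE)
  note tr = smooth_mapD(2)[OF id W(3) V]
  have N: "\<theta> ` (W \<inter> fst -` V) = \<phi> ` (U \<inter> (\<lambda>x. x) -` V) \<times> \<phi>' ` U'" (is "?N = ?N1 \<times> _")
    by (force simp: W)
  have op: "openin (top_of_set (model M \<times> model K)) ?N"
    unfolding N by (intro openin_top_of_set_Times bastiani_smooth_on_imp_open[OF tr] chartedD(6)[OF K W(4)])
  have sub: "subspace (model M \<times> model K)"
    by (intro subspace_Times' chartedD(1) M K)
  have "bastiani_smooth_on (model M \<times> model K) ?N fst"
    by (rule bastiani_smooth_on_linear[OF sub op linear_fst continuous_on_fst[OF continuous_on_id]])
  from bastiani_smooth_on_compose[OF this tr _ sub chartedD(1,2)[OF M]]
  have "bastiani_smooth_on (model M \<times> model K) ?N ((\<psi> \<circ> (\<lambda>x. x) \<circ> inv_into U \<phi>) \<circ> fst)"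
    unfolding N by auto
  then have "bastiani_smooth_on (model M \<times> model K) ?N (\<psi> \<circ> fst \<circ> inv_into W \<theta>)"
    by (rule bastiani_smooth_on_subset[OF _ sub op])
       (auto simp: N W inv_into_map_prod chartedD(5)[OF M W(3)] chartedD(5)[OF K W(4)])
  then show "bastiani_smooth_on (model (prod_manifold M K)) ?N (\<psi> \<circ> fst \<circ> inv_into W \<theta>)" by simp
qed

lemma smooth_map_snd:
  fixes M :: "('m, 'a::locally_convex_space) manifold" and K :: "('k, 'b::locally_convex_space) manifold"
  assumes M: "charted M" and K: "charted K" and id: "smooth_map K K (\<lambda>x. x)"
  shows "smooth_map (prod_manifold M K) K snd"
proof (rule smooth_mapI)
  show "continuous_map (mtop (prod_manifold M K)) (mtop K) snd" by (simp add: continuous_map_snd)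
next
  fix W \<theta> V \<psi> assume "(W, \<theta>) \<in> charts (prod_manifold M K)" and V: "(V, \<psi>) \<in> charts K"
  then obtain U' \<phi>' U \<phi> where W: "W = U' \<times> U" "\<theta> = map_prod \<phi>' \<phi>" "(U', \<phi>') \<in> charts M" "(U, \<phi>) \<in> charts K"
    by (metis charts_prod_manifoldE)
  note tr = smooth_mapD(2)[OF id W(4) V]
  have N: "\<theta> ` (W \<inter> snd -` V) = \<phi>' ` U' \<times> \<phi> ` (U \<inter> (\<lambda>x. x) -` V)" (is "?N = _")
    by (force simp: W)
  have op: "openin (top_of_set (model M \<times> model K)) ?N"
    unfolding N by (intro openin_top_of_set_Times bastiani_smooth_on_imp_open[OF tr] chartedD(6)[OF M W(3)])
  have sub: "subspace (model M \<times> model K)"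
    by (intro subspace_Times' chartedD(1) M K)
  have "bastiani_smooth_on (model M \<times> model K) ?N snd"
    by (rule bastiani_smooth_on_linear[OF sub op linear_snd continuous_on_snd[OF continuous_on_id]])
  from bastiani_smooth_on_compose[OF this tr _ sub chartedD(1,2)[OF K]]
  have "bastiani_smooth_on (model M \<times> model K) ?N ((\<psi> \<circ> (\<lambda>x. x) \<circ> inv_into U \<phi>) \<circ> snd)"
    unfolding N by auto
  then have "bastiani_smooth_on (model M \<times> model K) ?N (\<psi> \<circ> snd \<circ> inv_into W \<theta>)"
    by (rule bastiani_smooth_on_subset[OF _ sub op])
       (auto simp: N W inv_into_map_prod chartedD(5)[OF M W(3)] chartedD(5)[OF K W(4)])
  then show "bastiani_smooth_on (model (prod_manifold M K)) ?N (\<psi> \<circ> snd \<circ> inv_into W \<theta>)" by simp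
qed

lemma smooth_map_const:
  assumes M: "charted M" and K: "charted K" and c: "c \<in> topspace (mtop K)"
  shows "smooth_map M K (\<lambda>_. c)"
proof (rule smooth_mapI)
  show "continuous_map (mtop M) (mtop K) (\<lambda>_. c)" using c by simp
next
  fix U \<phi> V \<psi> assume U: "(U, \<phi>) \<in> charts M" and "(V, \<psi>) \<in> charts K"
  have "\<phi> ` (U \<inter> (\<lambda>_. c) -` V) = (if c \<in> V then \<phi> ` U else {})" by auto
  then have op: "openin (top_of_set (model M)) (\<phi> ` (U \<inter> (\<lambda>_. c) -` V))"
    using chartedD(6)[OF M U] by simp
  show "bastiani_smooth_on (model M) (\<phi> ` (U \<inter> (\<lambda>_. c) -` V)) (\<psi> \<circ> (\<lambda>_. c) \<circ> inv_into U \<phi>)"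
    using bastiani_smooth_on_const[OF chartedD(1)[OF M] op, of "\<psi> c"] by (simp add: comp_def)
qed

lemma open_submanifold_simps [simp]:
  "mtop (open_submanifold n N) = subtopology (Euclidean_space n) N"
  "model (open_submanifold n N) = euc n"
  "charts (open_submanifold n N) = {(N, id)}"
  by (simp_all add: open_submanifold_def)

lemma charted_open_submanifold:
  assumes "openin (Euclidean_space n) N"
  shows "charted (open_submanifold n N)"
  unfolding charted_def using assms openin_subset[OF assms]
  by (auto simp: subspace_euc closed_euc openin_Euclidean_space_iff)

lemma smooth_map_open_submanifold_iff:
  assumes "openin (Euclidean_space m) N" "openin (Euclidean_space n) N'"
  shows "smooth_map (open_submanifold m N) (open_submanifold n N') h \<longleftrightarrow>
    h \<in> N \<rightarrow> N' \<and> bastiani_smooth_on (euc m) N h"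
    (is "?L \<longleftrightarrow> ?R")
proof
  have NN: "N \<subseteq> euc m" "N' \<subseteq> euc n" using assms openin_subset by blast+
  have inv: "inv_into N id x = x" if "x \<in> N" for x
    using inv_into_f_f[of id N x] that by simp
  {
    assume L: ?L
    then have h: "h \<in> N \<rightarrow> N'" using smooth_map_in[OF L] NN by auto
    then have e: "N \<inter> h -` N' = N" by auto
    from L have "bastiani_smooth_on (euc m) N (id \<circ> h \<circ> inv_into N id)"
      using smooth_mapD(2)[OF L, of N id N' id] by (simp add: e)
    then have "bastiani_smooth_on (euc m) N h"
      by (rule bastiani_smooth_on_subset[OF _ subspace_euc]) (use inv assms openin_Euclidean_space_iff in auto)
    with h show ?R ..
  }
  {
    assume R: ?R
    then have e: "N \<inter> h -` N' = N" by auto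
    show ?L
    proof (rule smooth_mapI)
      have "continuous_on N h"
        using R bastiani_smooth_on_imp_continuous[OF _ subspace_euc] by blast
      moreover have "subtopology (Euclidean_space m) N = top_of_set N" "subtopology (Euclidean_space n) N' = top_of_set N'"
        using NN by (simp_all add: Euclidean_space_def euclidean_product_topology subtopology_subtopology topspace_Euclidean_space Int_absorb1)
      ultimately show "continuous_map (mtop (open_submanifold m N)) (mtop (open_submanifold n N')) h"
        using R by (simp add: continuous_map_in_subtopology)
      show "bastiani_smooth_on (model (open_submanifold m N)) (\<phi> ` (U \<inter> h -` V)) (\<psi> \<circ> h \<circ> inv_into U \<phi>)"
        if "(U, \<phi>) \<in> charts (open_submanifold m N)" "(V, \<psi>) \<in> charts (open_submanifold n N')" for U \<phi> V \<psi>
      proof -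
        have "bastiani_smooth_on (euc m) N (id \<circ> h \<circ> inv_into N id)"
          by (rule bastiani_smooth_on_subset[of _ _ h, OF _ subspace_euc]) (use R inv assms openin_Euclidean_space_iff in auto)
        then show ?thesis using that by (simp add: e)
      qed
    qed
  }
qed

lemma smooth_map_restrict:
  fixes M :: "('m, 'a::locally_convex_space) manifold"
  assumes f: "smooth_map (open_submanifold n N) M f" and N: "openin (Euclidean_space n) N" "openin (Euclidean_space n) N'" "N' \<subseteq> N"
  shows "smooth_map (open_submanifold n N') M f"
proof -
  have "bastiani_smooth_on (euc n) N' (\<lambda>x. x)"
    by (rule bastiani_smooth_on_linear[OF subspace_euc])
       (use N in \<open>auto simp: openin_Euclidean_space_iff linear_ident\<close>)
  then have "smooth_map (open_submanifold n N') (open_submanifold n N) (\<lambda>x. x)"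
    using N by (auto simp: smooth_map_open_submanifold_iff)
  from smooth_map_compose[OF charted_open_submanifold charted_open_submanifold this f] N show ?thesis by simp
qed

lemma smooth_map_id_open_submanifold:
  assumes "openin (Euclidean_space n) N"
  shows "smooth_map (open_submanifold n N) (open_submanifold n N) (\<lambda>x. x)"
  using assms bastiani_smooth_on_linear[OF subspace_euc, of n N "\<lambda>x. x"]
  by (auto simp: smooth_map_open_submanifold_iff openin_Euclidean_space_iff linear_ident)

lemma locally_convex_manifold_charted:
  assumes "locally_convex_manifold M" "closed (model M)"
  shows "charted M" "smooth_map M M (\<lambda>x. x)"
proof -
  have "inj_on \<phi> U" if "(U, \<phi>) \<in> charts M" for U \<phi>
  proof -
    have "openin (mtop M) U" and h: "homeomorphic_map (subtopology (mtop M) U) (top_of_set (\<phi> ` U)) \<phi>"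
      using assms(1) that by (auto simp: locally_convex_manifold_def)
    then have "topspace (mtop M) \<inter> U = U" using openin_subset by blast
    with homeomorphic_imp_injective_map[OF h] show ?thesis by simp
  qed
  then show "charted M"
    using assms by (auto simp: charted_def locally_convex_manifold_def)
  show "smooth_map M M (\<lambda>x. x)"
  proof (rule smooth_mapI)
    show "bastiani_smooth_on (model M) (\<phi> ` (U \<inter> (\<lambda>x. x) -` V)) (\<psi> \<circ> (\<lambda>x. x) \<circ> inv_into U \<phi>)"
      if "(U, \<phi>) \<in> charts M" "(V, \<psi>) \<in> charts M" for U \<phi> V \<psi>
    proof -
      have "bastiani_smooth_on (model M) (\<phi> ` (U \<inter> V)) (\<psi> \<circ> inv_into U \<phi>)"
        using assms(1) that by (auto simp: locally_convex_manifold_def)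
      then show ?thesis by (simp add: comp_def)
    qed
  qed simp
qed

section \<open>Group-valued functions\<close>

locale lie_grp = group G for G :: "('g, 'e::locally_convex_space) lie_group" (structure) +
  assumes lie: "locally_convex_lie_group G"
begin

abbreviation carr :: "'g set" where "carr \<equiv> carrier G"
abbreviation GM where "GM \<equiv> mfd G"
abbreviation OS where "OS \<equiv> open_submanifold"

lemma topspace_GM [simp]: "topspace (mtop GM) = carr"
  using lie by (simp add: locally_convex_lie_group_def)

lemma charted_GM: "charted GM" and smooth_id_GM: "smooth_map GM GM (\<lambda>x. x)"
  using locally_convex_manifold_charted[of GM] lie by (simp_all add: locally_convex_lie_group_def)

lemma smooth_mult: "smooth_map (prod_manifold GM GM) GM (\<lambda>(x, y). x \<otimes> y)"
  and smooth_inv: "smooth_map GM GM (\<lambda>x. inv x)"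
  using lie by (simp_all add: locally_convex_lie_group_def)

lemma smooth_map_mult:
  fixes M :: "('m, 'a::locally_convex_space) manifold"
  assumes "charted M" "smooth_map M GM a" "smooth_map M GM b"
  shows "smooth_map M GM (\<lambda>x. a x \<otimes> b x)"
  using smooth_map_compose[OF assms(1) charted_prod_manifold[OF charted_GM charted_GM]
      smooth_map_Pair[OF assms] smooth_mult] by simp

text \<open>Smoothness of a group-valued function on an arbitrary set. The extensions are only local
  and may disagree off \<open>A\<close>, because values in a group cannot be averaged by a partition
  of unity.\<close>

definition ext :: "nat \<Rightarrow> point set \<Rightarrow> (point \<Rightarrow> 'g) \<Rightarrow> bool" where
  "ext d A a \<longleftrightarrow> (\<forall>x\<in>A. \<exists>N \<gamma>. openin (Euclidean_space d) N \<and> x \<in> N \<and> smooth_map (OS d N) GM \<gamma> \<and>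
     (\<forall>y\<in>N \<inter> A. \<gamma> y = a y))"

lemma extE:
  assumes "ext d A a" "x \<in> A"
  obtains N \<gamma> where "openin (Euclidean_space d) N" "x \<in> N" "smooth_map (OS d N) GM \<gamma>"
    "\<And>y. y \<in> N \<Longrightarrow> y \<in> A \<Longrightarrow> \<gamma> y = a y"
  using assms unfolding ext_def by (metis IntI)

lemma extI:
  assumes "\<And>x. x \<in> A \<Longrightarrow> \<exists>N \<gamma>. openin (Euclidean_space d) N \<and> x \<in> N \<and> smooth_map (OS d N) GM \<gamma> \<and>
     (\<forall>y\<in>N \<inter> A. \<gamma> y = a y)"
  shows "ext d A a"
  using assms by (simp add: ext_def)

lemma ext_subset: "ext d A a \<Longrightarrow> B \<subseteq> A \<Longrightarrow> ext d B a"
  unfolding ext_def by (meson IntD1 IntD2 IntI subsetD)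

lemma ext_cong: "ext d A a \<Longrightarrow> (\<And>x. x \<in> A \<Longrightarrow> a x = b x) \<Longrightarrow> ext d A b"
  unfolding ext_def by (metis IntD2)

lemma smooth_in_carr: "smooth_map (OS d N) GM \<gamma> \<Longrightarrow> openin (Euclidean_space d) N \<Longrightarrow> y \<in> N \<Longrightarrow> \<gamma> y \<in> carr"
  using smooth_map_in[of "OS d N" GM \<gamma> y] openin_subset[of "Euclidean_space d" N] by auto

lemma ext_in:
  assumes "ext d A a" "x \<in> A" shows "a x \<in> carr"
proof -
  obtain N \<gamma> where N: "openin (Euclidean_space d) N" "x \<in> N" "smooth_map (OS d N) GM \<gamma>"
    "\<And>y. y \<in> N \<Longrightarrow> y \<in> A \<Longrightarrow> \<gamma> y = a y"
    by (rule extE[OF assms]) blast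
  then show ?thesis using smooth_in_carr[OF N(3,1,2)] assms(2) by simp
qed

lemma ext_mult:
  assumes "ext d A a" "ext d A b"
  shows "ext d A (\<lambda>x. a x \<otimes> b x)"
proof (rule extI)
  fix x assume x: "x \<in> A"
  obtain N \<gamma> where N: "openin (Euclidean_space d) N" "x \<in> N" "smooth_map (OS d N) GM \<gamma>"
    "\<And>y. y \<in> N \<Longrightarrow> y \<in> A \<Longrightarrow> \<gamma> y = a y"
    by (rule extE[OF assms(1) x]) blast
  obtain N' \<gamma>' where N': "openin (Euclidean_space d) N'" "x \<in> N'" "smooth_map (OS d N') GM \<gamma>'"
    "\<And>y. y \<in> N' \<Longrightarrow> y \<in> A \<Longrightarrow> \<gamma>' y = b y"
    by (rule extE[OF assms(2) x]) blast
  have op: "openin (Euclidean_space d) (N \<inter> N')" using N N' by (intro openin_Int)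
  have "smooth_map (OS d (N \<inter> N')) GM (\<lambda>x. \<gamma> x \<otimes> \<gamma>' x)"
    by (intro smooth_map_mult charted_open_submanifold op
        smooth_map_restrict[OF N(3,1) op] smooth_map_restrict[OF N'(3,1) op]) auto
  then show "\<exists>N \<gamma>. openin (Euclidean_space d) N \<and> x \<in> N \<and> smooth_map (OS d N) GM \<gamma> \<and> (\<forall>y\<in>N \<inter> A. \<gamma> y = a y \<otimes> b y)"
    using op N N' by (intro exI[of _ "N \<inter> N'"] exI[of _ "\<lambda>x. \<gamma> x \<otimes> \<gamma>' x"]) auto
qed

lemma ext_inv:
  assumes "ext d A a"
  shows "ext d A (\<lambda>x. inv (a x))"
proof (rule extI)
  fix x assume x: "x \<in> A"
  obtain N \<gamma> where N: "openin (Euclidean_space d) N" "x \<in> N" "smooth_map (OS d N) GM \<gamma>"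
    "\<And>y. y \<in> N \<Longrightarrow> y \<in> A \<Longrightarrow> \<gamma> y = a y"
    by (rule extE[OF assms(1) x]) blast
  have "smooth_map (OS d N) GM (\<lambda>x. inv (\<gamma> x))"
    by (rule smooth_map_compose[OF charted_open_submanifold[OF N(1)] charted_GM N(3) smooth_inv])
  then show "\<exists>N \<gamma>. openin (Euclidean_space d) N \<and> x \<in> N \<and> smooth_map (OS d N) GM \<gamma> \<and> (\<forall>y\<in>N \<inter> A. \<gamma> y = inv (a y))"
    using N by (intro exI[of _ N] exI[of _ "\<lambda>x. inv (\<gamma> x)"]) auto
qed

lemma ext_const:
  assumes "g \<in> carr" "A \<subseteq> euc d"
  shows "ext d A (\<lambda>_. g)"
proof (rule extI)
  fix x assume x: "x \<in> A"
  have "smooth_map (OS d (euc d)) GM (\<lambda>_. g)"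
    by (rule smooth_map_const[OF charted_open_submanifold charted_GM]) (use assms in auto)
  then show "\<exists>N \<gamma>. openin (Euclidean_space d) N \<and> x \<in> N \<and> smooth_map (OS d N) GM \<gamma> \<and> (\<forall>y\<in>N \<inter> A. \<gamma> y = g)"
    using assms x by (intro exI[of _ "euc d"] exI[of _ "\<lambda>_. g"]) auto
qed

lemma ext_local:
  assumes "\<And>x. x \<in> A \<Longrightarrow> \<exists>N. openin (Euclidean_space d) N \<and> x \<in> N \<and> ext d (A \<inter> N) a"
  shows "ext d A a"
proof (rule extI)
  fix x assume x: "x \<in> A"
  then obtain M where M: "openin (Euclidean_space d) M" "x \<in> M" "ext d (A \<inter> M) a" using assms by blast
  have xM: "x \<in> A \<inter> M" using x M by auto
  obtain N \<gamma> where N: "openin (Euclidean_space d) N" "x \<in> N" "smooth_map (OS d N) GM \<gamma>"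
    "\<And>y. y \<in> N \<Longrightarrow> y \<in> A \<inter> M \<Longrightarrow> \<gamma> y = a y"
    by (rule extE[OF M(3) xM]) blast
  have op: "openin (Euclidean_space d) (N \<inter> M)" using N M by (intro openin_Int)
  have "smooth_map (OS d (N \<inter> M)) GM \<gamma>"
    by (rule smooth_map_restrict[OF N(3,1) op]) auto
  then show "\<exists>N \<gamma>. openin (Euclidean_space d) N \<and> x \<in> N \<and> smooth_map (OS d N) GM \<gamma> \<and> (\<forall>y\<in>N \<inter> A. \<gamma> y = a y)"
    using N M op by (intro exI[of _ "N \<inter> M"] exI[of _ \<gamma>]) auto
qed

lemma ext_continuous:
  assumes "ext d A a" "A \<subseteq> euc d"
  shows "continuous_map (subtopology (Euclidean_space d) A) (mtop GM) a"
proof -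
  have "\<forall>x\<in>A. \<exists>p. openin (Euclidean_space d) (fst p) \<and> x \<in> fst p \<and> smooth_map (OS d (fst p)) GM (snd p) \<and>
     (\<forall>y\<in>fst p \<inter> A. snd p y = a y)"
    using assms(1) by (simp add: ext_def)
  then obtain p where p: "\<And>x. x \<in> A \<Longrightarrow> openin (Euclidean_space d) (fst (p x)) \<and> x \<in> fst (p x) \<and>
     smooth_map (OS d (fst (p x))) GM (snd (p x)) \<and> (\<forall>y\<in>fst (p x) \<inter> A. snd (p x) y = a y)"
    by metis
  show ?thesis
  proof (rule pasting_lemma[where I = A and T = "\<lambda>x. A \<inter> fst (p x)" and f = "\<lambda>x. snd (p x)"])
    fix x assume x: "x \<in> A"
    show "openin (subtopology (Euclidean_space d) A) (A \<inter> fst (p x))"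
      using p[OF x] by (auto simp: openin_subtopology)
    have "continuous_map (subtopology (Euclidean_space d) (fst (p x))) (mtop GM) (snd (p x))"
      using p[OF x] smooth_mapD(1)[of "OS d (fst (p x))" GM "snd (p x)"] by simp
    then show "continuous_map (subtopology (subtopology (Euclidean_space d) A) (A \<inter> fst (p x))) (mtop GM) (snd (p x))"
      by (simp add: subtopology_subtopology continuous_map_from_subtopology_mono)
  next
    show "\<exists>j. j \<in> A \<and> x \<in> A \<inter> fst (p j) \<and> a x = snd (p j) x"
      if "x \<in> topspace (subtopology (Euclidean_space d) A)" for x
      using that p[of x] by (intro exI[of _ x]) auto
  next
    show "snd (p i) x = snd (p j) x"
      if "i \<in> A" "j \<in> A" "x \<in> topspace (subtopology (Euclidean_space d) A) \<inter> (A \<inter> fst (p i)) \<inter> (A \<inter> fst (p j))" for i j x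
      using that p[of i] p[of j] by auto
  qed
qed

end

section \<open>Locally extendable maps and their action on group-valued functions\<close>

definition lext :: "nat \<Rightarrow> nat \<Rightarrow> point set \<Rightarrow> (point \<Rightarrow> point) \<Rightarrow> bool" where
  "lext m n A f \<longleftrightarrow> (\<forall>x\<in>A. \<exists>N h. openin (Euclidean_space m) N \<and> x \<in> N \<and>
     smooth_map (open_submanifold m N) (euclidean_manifold n) h \<and> (\<forall>y\<in>N \<inter> A. h y = f y))"

lemma geom_simplex_euc: "geom_simplex n \<subseteq> euc n"
  by (auto simp: geom_simplex_def)

lemma smooth_maps_lext: "f \<in> smooth_maps m n \<Longrightarrow> lext m n (geom_simplex m) f"
proof -
  assume "f \<in> smooth_maps m n"
  then obtain N h where "openin (Euclidean_space m) N" "geom_simplex m \<subseteq> N"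
    "smooth_map (open_submanifold m N) (euclidean_manifold n) h" "\<forall>x\<in>geom_simplex m. h x = f x"
    unfolding smooth_maps_def by blast
  then show ?thesis unfolding lext_def by (intro ballI exI[of _ N] exI[of _ h]) auto
qed

lemma smooth_maps_in: "f \<in> smooth_maps m n \<Longrightarrow> x \<in> geom_simplex m \<Longrightarrow> f x \<in> geom_simplex n"
  by (auto simp: smooth_maps_def)

lemma continuous_smooth_map_OS:
  assumes "smooth_map (open_submanifold m N) (euclidean_manifold n) h"
  shows "continuous_map (subtopology (Euclidean_space m) N) (Euclidean_space n) h"
  using smooth_mapD(1)[OF assms] by simp

lemma preimage_open_OS:
  assumes "smooth_map (open_submanifold m N) (euclidean_manifold n) h" "openin (Euclidean_space m) N" "openin (Euclidean_space n) N'"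
  shows "openin (Euclidean_space m) (N \<inter> h -` N')"
proof -
  have "openin (subtopology (Euclidean_space m) N) {x \<in> topspace (subtopology (Euclidean_space m) N). h x \<in> N'}"
    by (rule openin_continuous_map_preimage[OF continuous_smooth_map_OS[OF assms(1)] assms(3)])
  moreover have "{x \<in> topspace (subtopology (Euclidean_space m) N). h x \<in> N'} = N \<inter> h -` N'"
    using openin_subset[OF assms(2)] by auto
  ultimately show ?thesis using assms(2) by (simp add: openin_open_subtopology)
qed

lemma smooth_map_into_OS:
  assumes h: "smooth_map (open_submanifold m N) (euclidean_manifold n) h" and N: "openin (Euclidean_space m) N" and N': "openin (Euclidean_space n) N'"
  shows "smooth_map (open_submanifold m (N \<inter> h -` N')) (open_submanifold n N') h"
proof -
  note op = preimage_open_OS[OF h N N']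
  have "smooth_map (open_submanifold m (N \<inter> h -` N')) (euclidean_manifold n) h"
    by (rule smooth_map_restrict[OF h N op]) auto
  then show ?thesis
    using smooth_map_open_submanifold_iff[OF op openin_topspace] smooth_map_open_submanifold_iff[OF op N'] by auto
qed

context lie_grp
begin

lemma ext_comp:
  assumes a: "ext n B a" and f: "lext m n A f" and fA: "f ` A \<subseteq> B"
  shows "ext m A (\<lambda>x. a (f x))"
proof (rule extI)
  fix x assume x: "x \<in> A"
  from bspec[OF f[unfolded lext_def] x]
  obtain N h where N: "openin (Euclidean_space m) N" "x \<in> N" "smooth_map (OS m N) (euclidean_manifold n) h"
    "\<And>y. y \<in> N \<inter> A \<Longrightarrow> h y = f y"
    by auto
  have fx: "f x \<in> B" using fA x by auto
  obtain N' \<gamma> where N': "openin (Euclidean_space n) N'" "f x \<in> N'" "smooth_map (OS n N') GM \<gamma>"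
    "\<And>y. y \<in> N' \<Longrightarrow> y \<in> B \<Longrightarrow> \<gamma> y = a y"
    by (rule extE[OF a fx]) blast
  have op: "openin (Euclidean_space m) (N \<inter> h -` N')"
    by (rule preimage_open_OS[OF N(3,1) N'(1)])
  have "smooth_map (OS m (N \<inter> h -` N')) GM (\<lambda>x. \<gamma> (h x))"
    by (rule smooth_map_compose[OF charted_open_submanifold[OF op] charted_open_submanifold[OF N'(1)]
          smooth_map_into_OS[OF N(3,1) N'(1)] N'(3)])
  then show "\<exists>N \<gamma>. openin (Euclidean_space m) N \<and> x \<in> N \<and> smooth_map (OS m N) GM \<gamma> \<and> (\<forall>y\<in>N \<inter> A. \<gamma> y = a (f y))"
    using op x N N' fA by (intro exI[of _ "N \<inter> h -` N'"] exI[of _ "\<lambda>x. \<gamma> (h x)"]) auto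
qed

text \<open>The local form of a bundle map: commuting with right translations of the fibre, it is a
  left translation by a function of the base point.\<close>

lemma smooth_translation:
  assumes N: "openin (Euclidean_space d) N" and h: "smooth_map (OS d N) (euclidean_manifold n) h" and \<gamma>: "smooth_map (OS d N) GM \<gamma>"
  shows "smooth_map (prod_manifold (OS d N) GM) (prod_manifold (euclidean_manifold n) GM) (\<lambda>p. (h (fst p), \<gamma> (fst p) \<otimes> snd p))"
proof -
  note c = charted_open_submanifold[OF N]
  note cp = charted_prod_manifold[OF c charted_GM]
  have f: "smooth_map (prod_manifold (OS d N) GM) (OS d N) fst"
    by (rule smooth_map_fst[OF c charted_GM smooth_map_id_open_submanifold[OF N]])
  have s: "smooth_map (prod_manifold (OS d N) GM) GM snd"
    by (rule smooth_map_snd[OF c charted_GM smooth_id_GM])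
  show ?thesis
    by (intro smooth_map_Pair cp smooth_map_mult s smooth_map_compose[OF cp c f h] smooth_map_compose[OF cp c f \<gamma>])
qed

text \<open>For a map of the form in \<open>smooth_translation\<close>, evaluation at the unit
  recovers the translating function. Transition maps and bundle maps are turned into group-valued
  functions this way.\<close>

lemma smooth_at_one:
  fixes K :: "('k, 'a::locally_convex_space) manifold"
  assumes N: "openin (Euclidean_space d) N" and K: "charted K"
    and H: "smooth_map (prod_manifold (OS d N) GM) (prod_manifold K GM) H"
  shows "smooth_map (OS d N) GM (\<lambda>y. snd (H (y, \<one>)))"
proof -
  note c = charted_open_submanifold[OF N]
  have "smooth_map (OS d N) GM (\<lambda>_. \<one>)" by (rule smooth_map_const[OF c charted_GM]) simp
  then have "smooth_map (OS d N) (prod_manifold (OS d N) GM) (\<lambda>y. (y, \<one>))"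
    by (intro smooth_map_Pair c smooth_map_id_open_submanifold N)
  from smooth_map_compose[OF c charted_prod_manifold[OF c charted_GM] this H]
  have "smooth_map (OS d N) (prod_manifold K GM) (\<lambda>y. H (y, \<one>))" .
  from smooth_map_compose[OF c charted_prod_manifold[OF K charted_GM] this smooth_map_snd[OF K charted_GM smooth_id_GM]]
  show ?thesis .
qed

end

section \<open>Sections of smooth bundles\<close>

lemma topspace_simplex_topology [simp]: "topspace (simplex_topology n) = geom_simplex n"
  using geom_simplex_euc by (auto simp: simplex_topology_def)

locale lie_bundle = lie_grp G for G :: "('g, 'e::locally_convex_space) lie_group" (structure) +
  fixes P :: "('p, 'g) gbundle"
  assumes smooth_P: "smooth_bundle G P"
begin

abbreviation "d \<equiv> base_dim P"
abbreviation "T \<equiv> topspace (total P)"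
abbreviation "pr \<equiv> proj P"
abbreviation "\<Delta> \<equiv> geom_simplex (base_dim P)"

definition coord :: "point set \<Rightarrow> (point \<times> 'g \<Rightarrow> 'p) \<Rightarrow> 'p \<Rightarrow> 'g" where
  "coord U \<phi> p = snd (inv_into (U \<times> carr) \<phi> p)"

lemma top_bundle: "topological_principal_bundle G P" and atlas: "smooth_atlas G P (atlas P)"
  using smooth_P by (simp_all add: smooth_bundle_def)

lemma pr_in: "p \<in> T \<Longrightarrow> pr p \<in> \<Delta>"
  using top_bundle by (auto simp: topological_principal_bundle_def continuous_map_def)

lemma act_in: "p \<in> T \<Longrightarrow> g \<in> carr \<Longrightarrow> act P (p, g) \<in> T"
  using top_bundle by (auto simp: topological_principal_bundle_def continuous_map_def Pi_iff)

lemma act_one: "p \<in> T \<Longrightarrow> act P (p, \<one>) = p"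
  and pr_act: "p \<in> T \<Longrightarrow> g \<in> carr \<Longrightarrow> pr (act P (p, g)) = pr p"
  and act_act: "p \<in> T \<Longrightarrow> g \<in> carr \<Longrightarrow> h \<in> carr \<Longrightarrow> act P (act P (p, g), h) = act P (p, g \<otimes> h)"
  using top_bundle by (simp_all add: topological_principal_bundle_def)

lemma chart_at: "x \<in> \<Delta> \<Longrightarrow> \<exists>U \<phi>. (U, \<phi>) \<in> atlas P \<and> x \<in> U"
proof -
  assume "x \<in> \<Delta>"
  then have "x \<in> (\<Union>(U, \<phi>)\<in>atlas P. U)" using atlas by (simp add: smooth_atlas_def)
  then show ?thesis by auto
qed

context
  fixes U \<phi> assumes chart: "(U, \<phi>) \<in> atlas P"
begin

lemma lt: "local_trivialization G P (U, \<phi>)"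
  using atlas chart by (simp add: smooth_atlas_def)

lemma chart_open: "openin (simplex_topology d) U"
  using lt by (simp add: local_trivialization_def)

lemma chart_sub: "U \<subseteq> \<Delta>"
  using openin_subset[OF chart_open] by simp

lemma chart_homeo: "homeomorphic_map
       (prod_topology (subtopology (simplex_topology d) U) (mtop GM))
       (subtopology (total P) {p \<in> T. pr p \<in> U}) \<phi>"
  using lt by (simp add: local_trivialization_def)

lemma chart_image: "\<phi> ` (U \<times> carr) = {p \<in> T. pr p \<in> U}" and chart_inj: "inj_on \<phi> (U \<times> carr)"
proof -
  have t: "topspace (prod_topology (subtopology (simplex_topology d) U) (mtop GM)) = U \<times> carr"
    using chart_sub by auto
  show "inj_on \<phi> (U \<times> carr)" using homeomorphic_imp_injective_map[OF chart_homeo] t by simp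
  have "topspace (subtopology (total P) {p \<in> T. pr p \<in> U}) = {p \<in> T. pr p \<in> U}" by auto
  then show "\<phi> ` (U \<times> carr) = {p \<in> T. pr p \<in> U}"
    using homeomorphic_imp_surjective_map[OF chart_homeo] t by simp
qed

lemma chart_in: "x \<in> U \<Longrightarrow> g \<in> carr \<Longrightarrow> \<phi> (x, g) \<in> T"
  using chart_image by blast

lemma chart_pr: "x \<in> U \<Longrightarrow> g \<in> carr \<Longrightarrow> pr (\<phi> (x, g)) = x"
  and chart_act: "x \<in> U \<Longrightarrow> g \<in> carr \<Longrightarrow> h \<in> carr \<Longrightarrow> \<phi> (x, g \<otimes> h) = act P (\<phi> (x, g), h)"
  using lt by (simp_all add: local_trivialization_def)

lemma inv_chart: "x \<in> U \<Longrightarrow> g \<in> carr \<Longrightarrow> inv_into (U \<times> carr) \<phi> (\<phi> (x, g)) = (x, g)"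
  by (rule inv_into_f_f[OF chart_inj]) simp

lemma coord_chart: "x \<in> U \<Longrightarrow> g \<in> carr \<Longrightarrow> coord U \<phi> (\<phi> (x, g)) = g"
  by (simp add: coord_def inv_chart)

lemma coord_props:
  assumes "p \<in> T" "pr p \<in> U"
  shows "coord U \<phi> p \<in> carr" "\<phi> (pr p, coord U \<phi> p) = p" "inv_into (U \<times> carr) \<phi> p = (pr p, coord U \<phi> p)"
proof -
  have "p \<in> \<phi> ` (U \<times> carr)" using chart_image assms by simp
  then obtain x g where "x \<in> U" "g \<in> carr" "p = \<phi> (x, g)" by auto
  then show "coord U \<phi> p \<in> carr" "\<phi> (pr p, coord U \<phi> p) = p" "inv_into (U \<times> carr) \<phi> p = (pr p, coord U \<phi> p)"
    by (simp_all add: coord_chart chart_pr inv_chart)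
qed

lemma coord_act: "p \<in> T \<Longrightarrow> pr p \<in> U \<Longrightarrow> g \<in> carr \<Longrightarrow> coord U \<phi> (act P (p, g)) = coord U \<phi> p \<otimes> g"
  using coord_chart[of "pr p" "coord U \<phi> p \<otimes> g"] chart_act[of "pr p" "coord U \<phi> p" g] coord_props[of p] by simp

end

lemma chart_one: "(U, \<phi>) \<in> atlas P \<Longrightarrow> x \<in> U \<Longrightarrow> g \<in> carr \<Longrightarrow> \<phi> (x, g) = act P (\<phi> (x, \<one>), g)"
  using chart_act[of U \<phi> x \<one> g] by simp

text \<open>The division map of a principal bundle, meaningful for two points of the same
  fibre.\<close>

definition dv :: "'p \<Rightarrow> 'p \<Rightarrow> 'g" where
  "dv p q = (THE g. g \<in> carr \<and> act P (p, g) = q)"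

lemma act_eq_iff:
  assumes "p \<in> T" "q \<in> T" "pr p = pr q" "(U, \<phi>) \<in> atlas P" "pr p \<in> U" "g \<in> carr"
  shows "act P (p, g) = q \<longleftrightarrow> g = inv (coord U \<phi> p) \<otimes> coord U \<phi> q"
proof -
  have c: "coord U \<phi> p \<in> carr" "coord U \<phi> q \<in> carr" "pr q \<in> U"
    using assms coord_props(1)[OF assms(4)] by simp_all
  have "act P (p, g) = q \<longleftrightarrow> coord U \<phi> p \<otimes> g = coord U \<phi> q"
  proof
    assume "act P (p, g) = q"
    then show "coord U \<phi> p \<otimes> g = coord U \<phi> q" using coord_act[OF assms(4,1,5,6)] by simp
  next
    assume "coord U \<phi> p \<otimes> g = coord U \<phi> q"
    then have "coord U \<phi> (act P (p, g)) = coord U \<phi> q" using coord_act[OF assms(4,1,5,6)] by simp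
    then show "act P (p, g) = q"
      using coord_props(2)[OF assms(4) assms(2) c(3)] coord_props(2)[OF assms(4) act_in[OF assms(1,6)]]
        pr_act[OF assms(1,6)] assms(3,5) by simp
  qed
  also have "\<dots> \<longleftrightarrow> g = inv (coord U \<phi> p) \<otimes> coord U \<phi> q"
    using c assms(6) by (metis inv_closed inv_solve_left)
  finally show ?thesis .
qed

lemma dv_eq_coord:
  assumes "p \<in> T" "q \<in> T" "pr p = pr q" "(U, \<phi>) \<in> atlas P" "pr p \<in> U"
  shows "dv p q = inv (coord U \<phi> p) \<otimes> coord U \<phi> q"
  unfolding dv_def
proof (rule the_equality)
  have c: "coord U \<phi> p \<in> carr" "coord U \<phi> q \<in> carr"
    using assms coord_props(1)[OF assms(4)] by simp_all
  then show "inv (coord U \<phi> p) \<otimes> coord U \<phi> q \<in> carr \<and> act P (p, inv (coord U \<phi> p) \<otimes> coord U \<phi> q) = q"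
    using act_eq_iff[OF assms] by simp
qed (use act_eq_iff[OF assms] in auto)

lemma dv_props:
  assumes "p \<in> T" "q \<in> T" "pr p = pr q"
  shows "dv p q \<in> carr" "act P (p, dv p q) = q"
proof -
  obtain U \<phi> where U: "(U, \<phi>) \<in> atlas P" "pr p \<in> U" using chart_at[OF pr_in[OF assms(1)]] by blast
  have c: "coord U \<phi> p \<in> carr" "coord U \<phi> q \<in> carr"
    using assms coord_props(1)[OF U(1)] U by simp_all
  then show "dv p q \<in> carr" using dv_eq_coord[OF assms U] by simp
  then show "act P (p, dv p q) = q" using act_eq_iff[OF assms U] dv_eq_coord[OF assms U] by simp
qed

lemma dv_act:
  assumes "p \<in> T" "g \<in> carr"
  shows "dv p (act P (p, g)) = g"
proof -
  obtain U \<phi> where U: "(U, \<phi>) \<in> atlas P" "pr p \<in> U" using chart_at[OF pr_in[OF assms(1)]] by blast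
  have q: "act P (p, g) \<in> T" "pr p = pr (act P (p, g))" using assms by (simp_all add: act_in pr_act)
  show ?thesis using act_eq_iff[OF assms(1) q U assms(2)] dv_eq_coord[OF assms(1) q U] by simp
qed

lemma act_cancel:
  assumes "p \<in> T" "g \<in> carr" "h \<in> carr" "act P (p, g) = act P (p, h)"
  shows "g = h"
  by (rule trans[OF dv_act[OF assms(1,2), symmetric]]) (simp only: assms(4) dv_act[OF assms(1,3)])

lemma transition_ext:
  assumes U: "(U, \<phi>) \<in> atlas P" and V: "(V, \<psi>) \<in> atlas P"
  shows "ext d (U \<inter> V) (\<lambda>y. coord V \<psi> (\<phi> (y, \<one>)))"
proof (rule extI)
  fix x assume x: "x \<in> U \<inter> V"
  have "smooth_transition G d (U, \<phi>) (V, \<psi>)"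
    using atlas U V unfolding smooth_atlas_def by blast
  then obtain N H where N: "openin (Euclidean_space d) N" "U \<inter> V \<subseteq> N"
    "smooth_map (prod_manifold (OS d N) GM) (prod_manifold (OS d N) GM) H"
    "\<forall>x\<in>U \<inter> V. \<forall>g\<in>carr. H (x, g) = inv_into (V \<times> carr) \<psi> (\<phi> (x, g))"
    unfolding smooth_transition_def by auto
  have "smooth_map (OS d N) GM (\<lambda>y. snd (H (y, \<one>)))"
    by (rule smooth_at_one[OF N(1) charted_open_submanifold[OF N(1)] N(3)])
  then show "\<exists>N \<gamma>. openin (Euclidean_space d) N \<and> x \<in> N \<and> smooth_map (OS d N) GM \<gamma> \<and>
      (\<forall>y\<in>N \<inter> (U \<inter> V). \<gamma> y = coord V \<psi> (\<phi> (y, \<one>)))"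
    using N x by (intro exI[of _ N] exI[of _ "\<lambda>y. snd (H (y, \<one>))"]) (auto simp: coord_def)
qed

definition sec :: "point set \<Rightarrow> (point \<Rightarrow> 'p) \<Rightarrow> bool" where
  "sec A s \<longleftrightarrow> A \<subseteq> \<Delta> \<and> (\<forall>x\<in>A. s x \<in> T \<and> pr (s x) = x) \<and>
     (\<forall>(U, \<phi>)\<in>atlas P. ext d (A \<inter> U) (\<lambda>x. coord U \<phi> (s x)))"

lemma secD:
  assumes "sec A s"
  shows "A \<subseteq> \<Delta>" "\<And>x. x \<in> A \<Longrightarrow> s x \<in> T" "\<And>x. x \<in> A \<Longrightarrow> pr (s x) = x"
    "\<And>U \<phi>. (U, \<phi>) \<in> atlas P \<Longrightarrow> ext d (A \<inter> U) (\<lambda>x. coord U \<phi> (s x))"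
  using assms by (auto simp: sec_def)

lemma secI:
  assumes "A \<subseteq> \<Delta>" "\<And>x. x \<in> A \<Longrightarrow> s x \<in> T" "\<And>x. x \<in> A \<Longrightarrow> pr (s x) = x"
    "\<And>U \<phi>. (U, \<phi>) \<in> atlas P \<Longrightarrow> ext d (A \<inter> U) (\<lambda>x. coord U \<phi> (s x))"
  shows "sec A s"
  using assms by (auto simp: sec_def)

lemma sec_chart:
  assumes U: "(U, \<phi>) \<in> atlas P"
  shows "sec U (\<lambda>x. \<phi> (x, \<one>))"
  using chart_sub[OF U] chart_in[OF U] chart_pr[OF U] transition_ext[OF U] by (intro secI) auto

lemma sec_subset: "sec A s \<Longrightarrow> B \<subseteq> A \<Longrightarrow> sec B s"
proof (rule secI)
  assume s: "sec A s" and B: "B \<subseteq> A"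
  show "B \<subseteq> \<Delta>" using B secD(1)[OF s] by blast
  show "s x \<in> T" "pr (s x) = x" if "x \<in> B" for x
    using secD(2,3)[OF s] B that by auto
  show "ext d (B \<inter> U) (\<lambda>x. coord U \<phi> (s x))" if "(U, \<phi>) \<in> atlas P" for U \<phi>
    by (rule ext_subset[OF secD(4)[OF s that]]) (use B in auto)
qed

lemma sec_cong: "sec A s \<Longrightarrow> (\<And>x. x \<in> A \<Longrightarrow> s x = t x) \<Longrightarrow> sec A t"
proof (rule secI)
  assume s: "sec A s" and eq: "\<And>x. x \<in> A \<Longrightarrow> s x = t x"
  show "A \<subseteq> \<Delta>" by (rule secD(1)[OF s])
  show "t x \<in> T" "pr (t x) = x" if "x \<in> A" for x
    using secD(2,3)[OF s that] eq[OF that] by simp_all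
  show "ext d (A \<inter> U) (\<lambda>x. coord U \<phi> (t x))" if "(U, \<phi>) \<in> atlas P" for U \<phi>
    by (rule ext_cong[OF secD(4)[OF s that]]) (simp add: eq)
qed

lemma sec_mult:
  assumes s: "sec A s" and a: "ext d A a"
  shows "sec A (\<lambda>x. act P (s x, a x))"
proof (rule secI)
  show "A \<subseteq> \<Delta>" by (rule secD[OF s])
  show "act P (s x, a x) \<in> T" "pr (act P (s x, a x)) = x" if "x \<in> A" for x
    using secD[OF s] that ext_in[OF a] by (simp_all add: act_in pr_act)
  show "ext d (A \<inter> U) (\<lambda>x. coord U \<phi> (act P (s x, a x)))" if U: "(U, \<phi>) \<in> atlas P" for U \<phi>
  proof (rule ext_cong)
    show "ext d (A \<inter> U) (\<lambda>x. coord U \<phi> (s x) \<otimes> a x)"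
      by (intro ext_mult secD(4)[OF s U] ext_subset[OF a]) auto
    show "coord U \<phi> (s x) \<otimes> a x = coord U \<phi> (act P (s x, a x))" if "x \<in> A \<inter> U" for x
      using coord_act[OF U] secD[OF s] ext_in[OF a] that by simp
  qed
qed

lemma chart_nbhd:
  assumes "x \<in> \<Delta>"
  obtains U \<phi> N where "(U, \<phi>) \<in> atlas P" "x \<in> U" "openin (Euclidean_space d) N" "U = \<Delta> \<inter> N"
proof -
  obtain U \<phi> where U: "(U, \<phi>) \<in> atlas P" "x \<in> U" using chart_at[OF assms] by blast
  have "\<exists>N. openin (Euclidean_space d) N \<and> U = \<Delta> \<inter> N"
    using chart_open[OF U(1)] unfolding simplex_topology_def openin_subtopology by blast
  then obtain N where "openin (Euclidean_space d) N" "U = \<Delta> \<inter> N" by blast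
  with U show ?thesis by (rule that)
qed

text \<open>Unlike the coordinates of a section, the quotient of two sections does not depend on a
  chart, so the local formulas define one function on all of \<open>A\<close>.\<close>

lemma sec_dv:
  assumes s: "sec A s" and t: "sec A t"
  shows "ext d A (\<lambda>x. dv (s x) (t x))"
proof (rule ext_local)
  fix x assume xA: "x \<in> A"
  then have "x \<in> \<Delta>" using secD(1)[OF s] by blast
  then obtain U \<phi> N where U: "(U, \<phi>) \<in> atlas P" "x \<in> U" "openin (Euclidean_space d) N" "U = \<Delta> \<inter> N"
    by (rule chart_nbhd)
  have "A \<inter> N = A \<inter> U" using U(4) secD(1)[OF s] by auto
  moreover have "ext d (A \<inter> U) (\<lambda>x. dv (s x) (t x))"
  proof (rule ext_cong)
    show "ext d (A \<inter> U) (\<lambda>x. inv (coord U \<phi> (s x)) \<otimes> coord U \<phi> (t x))"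
      by (intro ext_mult ext_inv secD(4)[OF s U(1)] secD(4)[OF t U(1)])
    show "inv (coord U \<phi> (s x)) \<otimes> coord U \<phi> (t x) = dv (s x) (t x)" if "x \<in> A \<inter> U" for x
      using that secD[OF s] secD[OF t] dv_eq_coord[OF _ _ _ U(1)] by simp
  qed
  ultimately show "\<exists>N. openin (Euclidean_space d) N \<and> x \<in> N \<and> ext d (A \<inter> N) (\<lambda>x. dv (s x) (t x))"
    using U by (intro exI[of _ N]) auto
qed

lemma sec_local:
  assumes A: "A \<subseteq> \<Delta>" and loc: "\<And>x. x \<in> A \<Longrightarrow> \<exists>N. openin (Euclidean_space d) N \<and> x \<in> N \<and> sec (A \<inter> N) s"
  shows "sec A s"
proof (rule secI)
  show "A \<subseteq> \<Delta>" by fact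
  show "s x \<in> T" "pr (s x) = x" if x: "x \<in> A" for x
  proof -
    obtain N where "x \<in> N" "sec (A \<inter> N) s" using loc[OF x] by blast
    then show "s x \<in> T" "pr (s x) = x" using secD(2,3)[of "A \<inter> N" s x] x by auto
  qed
  show "ext d (A \<inter> U) (\<lambda>x. coord U \<phi> (s x))" if U: "(U, \<phi>) \<in> atlas P" for U \<phi>
  proof (rule ext_local)
    fix x assume x: "x \<in> A \<inter> U"
    then obtain N where N: "openin (Euclidean_space d) N" "x \<in> N" "sec (A \<inter> N) s" using loc by blast
    have "A \<inter> U \<inter> N = A \<inter> N \<inter> U" by auto
    then show "\<exists>N. openin (Euclidean_space d) N \<and> x \<in> N \<and> ext d (A \<inter> U \<inter> N) (\<lambda>x. coord U \<phi> (s x))"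
      using secD(4)[OF N(3) U] N by (intro exI[of _ N]) auto
  qed
qed

lemma sec_empty: "sec {} s"
  by (rule secI) (auto simp: ext_def)

end

section \<open>Triviality of bundles over simplices\<close>

lemma openin_coordinate:
  assumes "open S"
  shows "openin (Euclidean_space n) {x \<in> euc n. x i \<in> S}"
proof -
  have "open ((\<lambda>x::point. x i) -` S)"
    by (intro open_vimage assms continuous_on_product_coordinates)
  moreover have "{x \<in> euc n. x i \<in> S} = euc n \<inter> (\<lambda>x::point. x i) -` S" by auto
  ultimately show ?thesis unfolding openin_Euclidean_space_iff openin_open by blast
qed

lemma cube_nbhd:
  assumes N: "openin (Euclidean_space n) N" and p: "p \<in> N"
  shows "\<exists>e>0. \<forall>x\<in>euc n. (\<forall>l<n. \<bar>x l - p l\<bar> < e) \<longrightarrow> x \<in> N"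
proof -
  obtain S where S: "open S" "N = euc n \<inter> S"
    using N unfolding openin_Euclidean_space_iff openin_open by blast
  obtain X where X: "p \<in> Pi\<^sub>E UNIV X" "\<And>i. open (X i)" "finite {i. X i \<noteq> UNIV}" "Pi\<^sub>E UNIV X \<subseteq> S"
    using product_topology_open_contains_basis[of "\<lambda>_. euclidean" UNIV S p] S p
    by (auto simp: euclidean_product_topology)
  have "\<exists>e>0. \<forall>y. \<bar>y - p l\<bar> < e \<longrightarrow> y \<in> X l" for l
  proof -
    have "p l \<in> X l" using X(1) by auto
    then obtain e where "e > 0" "ball (p l) e \<subseteq> X l" using X(2) open_contains_ball_eq by blast
    then show ?thesis by (intro exI[of _ e]) (auto simp: dist_real_def subset_iff abs_minus_commute)
  qed
  then obtain e where e: "\<And>l. e l > 0" "\<And>l y. \<bar>y - p l\<bar> < e l \<Longrightarrow> y \<in> X l" by metis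
  define m where "m = Min (insert 1 (e ` {..<n}))"
  have m: "m > 0" "\<And>l. l < n \<Longrightarrow> m \<le> e l" using e(1) by (auto simp: m_def)
  have "x \<in> N" if x: "x \<in> euc n" "\<forall>l<n. \<bar>x l - p l\<bar> < m" for x
  proof -
    have "x l \<in> X l" for l
    proof (cases "l < n")
      case True
      then show ?thesis using x(2) m(2)[OF True] by (intro e(2)) (meson less_le_trans)
    next
      case False
      then have "x l = p l" using x(1) p S(2) by (simp add: topspace_Euclidean_space)
      then show ?thesis using X(1) by auto
    qed
    then have "x \<in> Pi\<^sub>E UNIV X" by auto
    then show ?thesis using X(4) S(2) x(1) by blast
  qed
  with m show ?thesis by blast
qed

lemma closed_geom_simplex: "closed (geom_simplex n)"
proof -
  have "geom_simplex n = euc n \<inter> (\<Inter>i\<in>{..<n}. {x. 0 \<le> x i}) \<inter> {x. (\<Sum>i<n. x i) \<le> 1}"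
    by (auto simp: geom_simplex_def)
  moreover have "closed {x::point. 0 \<le> x i}" for i
    by (intro closed_Collect_le continuous_on_const continuous_on_coordinate)
  moreover have "closed {x::point. (\<Sum>i<n. x i) \<le> 1}"
    by (intro closed_Collect_le continuous_on_const continuous_on_sum continuous_on_coordinate)
  ultimately show ?thesis by (auto intro!: closed_Int closed_INT closed_euc)
qed

lemma geom_simplex_le_1: "x \<in> geom_simplex n \<Longrightarrow> i < n \<Longrightarrow> x i \<le> 1"
  using member_le_sum[of i "{..<n}" x] by (auto simp: geom_simplex_def)

text \<open>As the retraction never increases \<open>x\<^sub>i\<close>, it preserves the simplex.\<close>

lemma slab_retraction:
  assumes i: "i < n" and r: "r > 0"
  obtains \<rho> :: "point \<Rightarrow> point" where "lext n n (euc n) \<rho>"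
    "\<And>x. x \<in> euc n \<Longrightarrow> \<rho> x \<in> euc n"
    "\<And>x l. l \<noteq> i \<Longrightarrow> \<rho> x l = x l"
    "\<And>x. x i \<le> b \<Longrightarrow> \<rho> x = x"
    "\<And>x. x i \<ge> b \<Longrightarrow> b \<le> \<rho> x i \<and> \<rho> x i \<le> x i \<and> \<rho> x i \<le> b + r"
proof -
  obtain \<psi> where \<psi>: "bastiani_smooth_on UNIV UNIV \<psi>"
    "\<And>u. u \<le> 0 \<Longrightarrow> \<psi> u = 0" "\<And>u. u \<ge> 0 \<Longrightarrow> 0 \<le> \<psi> u \<and> \<psi> u \<le> u \<and> u - \<psi> u \<le> r"
    using smooth_cutoff[OF r] by metis
  define E :: "real \<Rightarrow> point" where "E t = (\<lambda>l. if l = i then - t else 0)" for t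
  \<comment> \<open>Subtracts \<open>\<psi>\<close> of the excess over \<open>b\<close> in
    coordinate \<open>i\<close>: below \<open>b\<close> nothing moves, above it at most
    \<open>r\<close> of the excess remains.\<close>
  define \<rho> where "\<rho> x = x + E (\<psi> (x i + (- b)))" for x
  have lc: "linear (\<lambda>x::point. x i)" by (auto simp: linear_iff plus_fun_def scaleR_fun_def)
  have lE: "linear E" by (auto simp: linear_iff plus_fun_def scaleR_fun_def E_def fun_eq_iff)
  have cE: "continuous_on UNIV E"
  proof (rule continuous_on_coordinatewise_then_product)
    show "continuous_on UNIV (\<lambda>t. E t l)" for l
      by (cases "l = i") (auto simp: E_def intro: continuous_intros)
  qed
  have op: "openin (top_of_set (euc n)) (euc n)" by simp
  have 1: "bastiani_smooth_on (euc n) (euc n) (\<lambda>x. x i + (- b))"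
    by (rule bastiani_smooth_on_affine[OF subspace_euc op lc continuous_on_coordinate])
  have "bastiani_smooth_on (euc n) (euc n) (\<psi> \<circ> (\<lambda>x. x i + (- b)))"
    by (rule bastiani_smooth_on_compose[OF 1 \<psi>(1) _ subspace_euc]) auto
  moreover have "bastiani_smooth_on UNIV UNIV E"
    by (rule bastiani_smooth_on_linear[OF _ _ lE cE]) auto
  ultimately have 2: "bastiani_smooth_on (euc n) (euc n) (E \<circ> (\<psi> \<circ> (\<lambda>x. x i + (- b))))"
    by (rule bastiani_smooth_on_compose) (auto simp: subspace_euc)
  have 3: "bastiani_smooth_on (euc n) (euc n) (\<lambda>x. x)"
    by (rule bastiani_smooth_on_linear[OF subspace_euc op linear_ident continuous_on_id])
  have "bastiani_smooth_on (euc n) (euc n) \<rho>"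
    using bastiani_smooth_on_add[OF 3 2 subspace_euc] by (simp add: \<rho>_def[abs_def] comp_def)
  moreover have euc: "\<rho> x \<in> euc n" if "x \<in> euc n" for x
    using that i by (auto simp: \<rho>_def E_def topspace_Euclidean_space plus_fun_def)
  ultimately have "smooth_map (open_submanifold n (euc n)) (euclidean_manifold n) \<rho>"
    by (subst smooth_map_open_submanifold_iff) auto
  then have "lext n n (euc n) \<rho>"
    unfolding lext_def by (intro ballI exI[of _ "euc n"] exI[of _ \<rho>]) auto
  moreover have "\<rho> x l = x l" if "l \<noteq> i" for x l
    using that by (simp add: \<rho>_def E_def plus_fun_def)
  moreover have "\<rho> x = x" if "x i \<le> b" for x
    using \<psi>(2)[of "x i + (- b)"] that by (auto simp: \<rho>_def E_def plus_fun_def fun_eq_iff)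
  moreover have "b \<le> \<rho> x i \<and> \<rho> x i \<le> x i \<and> \<rho> x i \<le> b + r" if "x i \<ge> b" for x
    using \<psi>(3)[of "x i + (- b)"] that by (simp add: \<rho>_def E_def plus_fun_def)
  ultimately show ?thesis using that euc by blast
qed

lemma lext_subset: "lext m n A f \<Longrightarrow> B \<subseteq> A \<Longrightarrow> lext m n B f"
proof -
  assume f: "lext m n A f" and B: "B \<subseteq> A"
  show ?thesis unfolding lext_def
  proof
    fix x assume "x \<in> B"
    then have "x \<in> A" using B by auto
    from bspec[OF f[unfolded lext_def] this] obtain N h where "openin (Euclidean_space m) N" "x \<in> N"
      "smooth_map (open_submanifold m N) (euclidean_manifold n) h" "\<forall>y\<in>N \<inter> A. h y = f y" by auto
    then show "\<exists>N h. openin (Euclidean_space m) N \<and> x \<in> N \<and>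
     smooth_map (open_submanifold m N) (euclidean_manifold n) h \<and> (\<forall>y\<in>N \<inter> B. h y = f y)"
      using B by (intro exI[of _ N] exI[of _ h]) auto
  qed
qed

context lie_bundle
begin

text \<open>Two sections over slabs overlapping near \<open>x\<^sub>i = b\<close> are glued by extending their ratio from the
  overlap to the upper slab along \<open>slab_retraction\<close>.\<close>

lemma sec_glue:
  assumes i: "i < d" and \<epsilon>: "\<epsilon> > 0" and ab: "0 \<le> a" "a \<le> b" "b \<le> c"
    and C: "C = {x \<in> \<Delta>. Q x}" and Q: "\<And>x y. (\<And>l. l < d \<Longrightarrow> l \<noteq> i \<Longrightarrow> x l = y l) \<Longrightarrow> Q x = Q y"
    and s1: "sec {x \<in> C. a - \<epsilon> < x i \<and> x i < b + \<epsilon>} s1"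
    and s2: "sec {x \<in> C. b - \<epsilon> < x i \<and> x i < c + \<epsilon>} s2"
  shows "\<exists>s. sec {x \<in> C. a - \<epsilon> < x i \<and> x i < c + \<epsilon>} s"
proof -
  define A where "A = {x \<in> C. a - \<epsilon> < x i \<and> x i < b + \<epsilon>}"
  define B where "B = {x \<in> C. b - \<epsilon> < x i \<and> x i < c + \<epsilon>}"
  \<comment> \<open>With width \<open>\<epsilon> / 2\<close> the upper slab \<open>B\<close> is
    mapped into the strip within \<open>\<epsilon>\<close> of \<open>b\<close>, where both sections
    are defined.\<close>
  obtain \<rho> where \<rho>: "lext d d (euc d) \<rho>"
    "\<And>x. x \<in> euc d \<Longrightarrow> \<rho> x \<in> euc d"
    "\<And>x l. l \<noteq> i \<Longrightarrow> \<rho> x l = x l"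
    "\<And>x. x i \<le> b \<Longrightarrow> \<rho> x = x"
    "\<And>x. x i \<ge> b \<Longrightarrow> b \<le> \<rho> x i \<and> \<rho> x i \<le> x i \<and> \<rho> x i \<le> b + \<epsilon> / 2"
    using slab_retraction[OF i, of "\<epsilon> / 2" b] \<epsilon> by (metis half_gt_zero)
  have \<rho>C: "\<rho> x \<in> C" if x: "x \<in> C" for x
  proof -
    have x\<Delta>: "x \<in> \<Delta>" using x C by auto
    have le: "\<rho> x l \<le> x l" for l
      using \<rho>(3)[of l x] \<rho>(4)[of x] \<rho>(5)[of x] by (cases "l = i"; cases "x i \<le> b") auto
    have "0 \<le> \<rho> x l" if "l < d" for l
      using \<rho>(3)[of l x] \<rho>(4)[of x] \<rho>(5)[of x] ab x\<Delta> that
      by (cases "l = i"; cases "x i \<le> b") (auto simp: geom_simplex_def)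
    moreover have "(\<Sum>l<d. \<rho> x l) \<le> (\<Sum>l<d. x l)" by (intro sum_mono le)
    ultimately have "\<rho> x \<in> \<Delta>" using x\<Delta> \<rho>(2) by (auto simp: geom_simplex_def)
    moreover have "Q (\<rho> x) = Q x" by (rule Q) (simp add: \<rho>(3))
    ultimately show ?thesis using x C by auto
  qed
  have \<rho>AB: "\<rho> ` B \<subseteq> A \<inter> B"
  proof
    fix y assume "y \<in> \<rho> ` B"
    then obtain x where x: "y = \<rho> x" "x \<in> C" "b - \<epsilon> < x i" "x i < c + \<epsilon>" by (auto simp: B_def)
    show "y \<in> A \<inter> B"
      using x \<rho>C[OF x(2)] \<rho>(4)[of x] \<rho>(5)[of x] \<epsilon> ab by (cases "x i \<le> b") (auto simp: A_def B_def)
  qed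
  have s1A: "sec A s1" and s2B: "sec B s2" using s1 s2 by (simp_all add: A_def B_def)
  have "ext d (A \<inter> B) (\<lambda>x. dv (s2 x) (s1 x))"
    by (rule sec_dv[OF sec_subset[OF s2B] sec_subset[OF s1A]]) auto
  from ext_comp[OF this lext_subset[OF \<rho>(1)] \<rho>AB]
  have "ext d B (\<lambda>x. dv (s2 (\<rho> x)) (s1 (\<rho> x)))"
    using C geom_simplex_euc by (auto simp: B_def)
  \<comment> \<open>The correction turns \<open>s2\<close> into \<open>s1\<close> at those points of
    the overlap that \<open>\<rho>\<close> fixes, that is, up to level \<open>b\<close>.\<close>
  from sec_mult[OF s2B this]
  have t2: "sec B (\<lambda>x. act P (s2 x, dv (s2 (\<rho> x)) (s1 (\<rho> x))))" (is "sec B ?t2") .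
  have t2_eq: "?t2 x = s1 x" if "x \<in> A \<inter> B" "x i \<le> b" for x
    using \<rho>(4)[of x, OF that(2)] that(1) secD(2,3)[OF s1A, of x] secD(2,3)[OF s2B, of x] by (simp add: dv_props)
  define s where "s x = (if x i < b then s1 x else ?t2 x)" for x
  let ?S = "{x \<in> C. a - \<epsilon> < x i \<and> x i < c + \<epsilon>}"
  have "sec ?S s"
  proof (rule sec_local)
    show "?S \<subseteq> \<Delta>" using C by auto
    fix x assume x: "x \<in> ?S"
    have xe: "x \<in> euc d" using x C geom_simplex_euc by auto
    let ?L = "{x \<in> euc d. x i \<in> {..<b}}" and ?R = "{x \<in> euc d. x i \<in> {b - \<epsilon><..}}"
    have L: "sec (?S \<inter> ?L) s"
      by (rule sec_cong[OF sec_subset[OF s1A]]) (use \<epsilon> in \<open>auto simp: A_def s_def\<close>)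
    have R: "sec (?S \<inter> ?R) s"
    proof (rule sec_cong[OF sec_subset[OF t2]])
      show "?S \<inter> ?R \<subseteq> B" by (auto simp: B_def)
      show "?t2 y = s y" if "y \<in> ?S \<inter> ?R" for y
        using t2_eq[of y] that ab \<epsilon> by (auto simp: s_def A_def B_def)
    qed
    show "\<exists>N. openin (Euclidean_space d) N \<and> x \<in> N \<and> sec (?S \<inter> N) s"
    proof (cases "x i < b")
      case True
      then show ?thesis using L xe openin_coordinate[OF open_lessThan] by (intro exI[of _ ?L]) auto
    next
      case False
      then show ?thesis using R xe \<epsilon> openin_coordinate[OF open_greaterThan] by (intro exI[of _ ?R]) auto
    qed
  qed
  then show ?thesis by blast
qed

text \<open>Induction on the number of unrestricted coordinates. Intervals of the next coordinate
  over which a section exists can be joined by \<open>sec_glue\<close>, and short intervals are good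
  by induction, so bisection reaches the whole range from 0 to 1. A positive
  \<open>\<epsilon>\<close> survives because each gluing takes the smaller of two.\<close>

lemma sec_cylinder:
  assumes "i \<le> d"
  shows "\<exists>\<epsilon>>0. \<exists>s. sec {x \<in> \<Delta>. \<forall>l<d. i \<le> l \<longrightarrow> \<bar>x l - p l\<bar> < \<epsilon>} s"
  using assms
proof (induction i arbitrary: p)
  case 0
  \<comment> \<open>Only the first \<open>d\<close> entries of \<open>p\<close> are read; cutting
    off the others gives a point of \<open>euc d\<close>.\<close>
  define q where "q l = (if l < d then p l else 0)" for l
  have q: "q \<in> euc d" by (simp add: q_def topspace_Euclidean_space)
  \<comment> \<open>The centre may lie outside the simplex; as the simplex is closed, a small
    cylinder around such a point is empty.\<close>
  have "\<exists>N. openin (Euclidean_space d) N \<and> q \<in> N \<and> (\<exists>s. sec (\<Delta> \<inter> N) s)"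
  proof (cases "q \<in> \<Delta>")
    case True
    then obtain U \<phi> N where U: "(U, \<phi>) \<in> atlas P" "q \<in> U" "openin (Euclidean_space d) N" "U = \<Delta> \<inter> N"
      by (rule chart_nbhd)
    then show ?thesis using sec_chart[OF U(1)] by auto
  next
    case False
    have "openin (Euclidean_space d) (euc d - \<Delta>)"
      unfolding openin_Euclidean_space_iff openin_open
      using closed_geom_simplex by (intro exI[of _ "- \<Delta>"]) auto
    moreover have "\<Delta> \<inter> (euc d - \<Delta>) = {}" by auto
    ultimately show ?thesis using q False sec_empty by (intro exI[of _ "euc d - \<Delta>"]) auto
  qed
  then obtain N s where N: "openin (Euclidean_space d) N" "q \<in> N" "sec (\<Delta> \<inter> N) s" by blast
  obtain e where e: "e > 0" "\<And>x. x \<in> euc d \<Longrightarrow> (\<forall>l<d. \<bar>x l - q l\<bar> < e) \<Longrightarrow> x \<in> N"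
    using cube_nbhd[OF N(1,2)] by blast
  have "sec {x \<in> \<Delta>. \<forall>l<d. 0 \<le> l \<longrightarrow> \<bar>x l - p l\<bar> < e} s"
    by (rule sec_subset[OF N(3)]) (use e(2) geom_simplex_euc in \<open>auto simp: q_def\<close>)
  with e(1) show ?case by blast
next
  case (Suc i)
  then have i: "i < d" by simp
  define C where "C \<epsilon> = {x \<in> \<Delta>. \<forall>l<d. Suc i \<le> l \<longrightarrow> \<bar>x l - p l\<bar> < \<epsilon>}" for \<epsilon>
  define Good where "Good a b \<longleftrightarrow> (\<exists>\<epsilon>>0. \<exists>s. sec {x \<in> C \<epsilon>. a - \<epsilon> < x i \<and> x i < b + \<epsilon>} s)" for a b
  \<comment> \<open>The premise carries \<open>0 \<le> a\<close> through the bisection: gluing needs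
    it so that the retraction keeps coordinates nonnegative.\<close>
  have "0 \<le> (0::real) \<longrightarrow> Good 0 1"
  proof (rule Bolzano[of 0 1 "\<lambda>a b. 0 \<le> a \<longrightarrow> Good a b"])
    fix a b c :: real
    assume ab: "0 \<le> a \<longrightarrow> Good a b" "0 \<le> b \<longrightarrow> Good b c" "a \<le> b" "b \<le> c"
    show "0 \<le> a \<longrightarrow> Good a c"
    proof
      assume a: "0 \<le> a"
      obtain e1 s1 where 1: "e1 > 0" "sec {x \<in> C e1. a - e1 < x i \<and> x i < b + e1} s1"
        using ab a unfolding Good_def by auto
      obtain e2 s2 where 2: "e2 > 0" "sec {x \<in> C e2. b - e2 < x i \<and> x i < c + e2} s2"
        using ab a unfolding Good_def by auto
      let ?e = "min e1 e2"
      have C: "C ?e \<subseteq> C e1" "C ?e \<subseteq> C e2" by (auto simp: C_def)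
      have "\<exists>s. sec {x \<in> C ?e. a - ?e < x i \<and> x i < c + ?e} s"
      proof (rule sec_glue[OF i _ a ab(3,4) C_def])
        show "sec {x \<in> C ?e. a - ?e < x i \<and> x i < b + ?e} s1"
          by (rule sec_subset[OF 1(2)]) (use C in auto)
        show "sec {x \<in> C ?e. b - ?e < x i \<and> x i < c + ?e} s2"
          by (rule sec_subset[OF 2(2)]) (use C in auto)
      qed (use 1 2 in auto)
      then show "Good a c" using 1(1) 2(1) unfolding Good_def by (intro exI[of _ ?e]) auto
    qed
  next
    fix t :: real assume "0 \<le> t" "t \<le> 1"
    obtain e s where e: "e > 0" "sec {x \<in> \<Delta>. \<forall>l<d. i \<le> l \<longrightarrow> \<bar>x l - (p(i := t)) l\<bar> < e} s"
      using Suc.IH[of "p(i := t)"] i by auto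
    have "Good a b" if ab: "a \<le> t" "t \<le> b" "b - a < e / 2" for a b
    proof -
      have "sec {x \<in> C (e / 2). a - e / 2 < x i \<and> x i < b + e / 2} s"
      proof (rule sec_subset[OF e(2)], rule subsetI, rule CollectI, intro conjI allI impI)
        fix x assume x: "x \<in> {x \<in> C (e / 2). a - e / 2 < x i \<and> x i < b + e / 2}"
        then show "x \<in> \<Delta>" by (simp add: C_def)
        fix l assume l: "l < d" "i \<le> l"
        show "\<bar>x l - (p(i := t)) l\<bar> < e"
        proof (cases "l = i")
          case True
          then show ?thesis using x ab by auto
        next
          case False
          then have "\<bar>x l - p l\<bar> < e / 2" using x l by (auto simp: C_def)
          then show ?thesis using False e(1) by simp
        qed
      qed
      then show ?thesis unfolding Good_def using e(1) by (intro exI[of _ "e / 2"]) auto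
    qed
    then show "\<exists>\<delta>>0. \<forall>a b. a \<le> t \<and> t \<le> b \<and> b - a < \<delta> \<longrightarrow> 0 \<le> a \<longrightarrow> Good a b"
      using e(1) by (intro exI[of _ "e / 2"]) auto
  qed auto
  then obtain e s where e: "e > 0" "sec {x \<in> C e. 0 - e < x i \<and> x i < 1 + e} s"
    unfolding Good_def by auto
  have "sec (C e) s"
  proof (rule sec_subset[OF e(2)], rule subsetI)
    fix x assume x: "x \<in> C e"
    then have x\<Delta>: "x \<in> \<Delta>" by (simp add: C_def)
    then show "x \<in> {x \<in> C e. 0 - e < x i \<and> x i < 1 + e}"
      using x e(1) i geom_simplex_le_1[OF x\<Delta> i] by (auto simp: geom_simplex_def)
  qed
  then show ?case using e(1) unfolding C_def by blast
qed

theorem global_section: "\<exists>s. sec \<Delta> s"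
proof -
  obtain e s where "sec {x \<in> \<Delta>. \<forall>l<d. d \<le> l \<longrightarrow> \<bar>x l - 0\<bar> < e} s"
    using sec_cylinder[of d "\<lambda>_. 0"] by auto
  then have "sec \<Delta> s" by (rule sec_subset) auto
  then show ?thesis by blast
qed

end

section \<open>Bundle maps and sections\<close>

lemma smooth_maps_open_preimage:
  assumes f: "f \<in> smooth_maps m n" and N: "openin (Euclidean_space n) N" and x: "x \<in> geom_simplex m" "f x \<in> N"
  shows "\<exists>M. openin (Euclidean_space m) M \<and> x \<in> M \<and> (\<forall>y\<in>geom_simplex m \<inter> M. f y \<in> N)"
proof -
  obtain M h where M: "openin (Euclidean_space m) M" "geom_simplex m \<subseteq> M"
    "smooth_map (open_submanifold m M) (euclidean_manifold n) h" "\<forall>x\<in>geom_simplex m. h x = f x"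
    using f unfolding smooth_maps_def by blast
  show ?thesis
    by (rule exI[of _ "M \<inter> h -` N"]) (use preimage_open_OS[OF M(3,1) N] M x in auto)
qed

lemma smooth_maps_continuous:
  assumes f: "f \<in> smooth_maps m n"
  shows "continuous_map (simplex_topology m) (simplex_topology n) f"
proof -
  obtain M h where M: "openin (Euclidean_space m) M" "geom_simplex m \<subseteq> M"
    "smooth_map (open_submanifold m M) (euclidean_manifold n) h" "\<forall>x\<in>geom_simplex m. h x = f x"
    using f unfolding smooth_maps_def by blast
  have "continuous_map (subtopology (Euclidean_space m) (geom_simplex m)) (Euclidean_space n) h"
    by (rule continuous_map_from_subtopology_mono[OF continuous_smooth_map_OS[OF M(3)] M(2)])
  then have "continuous_map (subtopology (Euclidean_space m) (geom_simplex m)) (Euclidean_space n) f"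
    by (rule continuous_map_eq) (use M(4) in auto)
  then show ?thesis
    using smooth_maps_in[OF f] by (auto simp: simplex_topology_def continuous_map_in_subtopology)
qed

lemma continuous_map_locally:
  assumes "\<And>x. x \<in> topspace X \<Longrightarrow> \<exists>S. openin X S \<and> x \<in> S \<and> continuous_map (subtopology X S) Y f"
  shows "continuous_map X Y f"
proof -
  obtain S where S: "\<And>x. x \<in> topspace X \<Longrightarrow> openin X (S x) \<and> x \<in> S x \<and> continuous_map (subtopology X (S x)) Y f"
    using assms by metis
  show ?thesis
    by (rule pasting_lemma[where I = "topspace X" and T = S and f = "\<lambda>_. f"]) (use S in auto)
qed

lemma (in lie_bundle) coord_continuous:
  assumes U: "(U, \<phi>) \<in> atlas P"
  shows "continuous_map (subtopology (total P) {p \<in> T. pr p \<in> U}) (mtop GM) (coord U \<phi>)"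
proof -
  obtain g where g: "homeomorphic_maps (prod_topology (subtopology (simplex_topology d) U) (mtop GM))
       (subtopology (total P) {p \<in> T. pr p \<in> U}) \<phi> g"
    using chart_homeo[OF U] by (auto simp: homeomorphic_map_maps)
  have "continuous_map (subtopology (total P) {p \<in> T. pr p \<in> U}) (mtop GM) (\<lambda>p. snd (g p))"
    using g continuous_map_compose[OF _ continuous_map_snd] unfolding homeomorphic_maps_def comp_def by blast
  then show ?thesis
  proof (rule continuous_map_eq)
    fix p assume "p \<in> topspace (subtopology (total P) {p \<in> T. pr p \<in> U})"
    then have p: "p \<in> T" "pr p \<in> U" by auto
    note c = coord_props[OF U p]
    have "(pr p, coord U \<phi> p) \<in> topspace (prod_topology (subtopology (simplex_topology d) U) (mtop GM))"
      using c p pr_in by auto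
    then have "g (\<phi> (pr p, coord U \<phi> p)) = (pr p, coord U \<phi> p)"
      using g unfolding homeomorphic_maps_def by blast
    then show "snd (g p) = coord U \<phi> p" using c by simp
  qed
qed

lemma (in lie_bundle) dv_act2:
  assumes "p \<in> T" "q \<in> T" "pr p = pr q" "g \<in> carr"
  shows "dv p (act P (q, g)) = dv p q \<otimes> g"
proof -
  have "act P (p, dv p q \<otimes> g) = act P (q, g)"
    using dv_props[OF assms(1-3)] assms by (simp flip: act_act)
  then show ?thesis using dv_act[OF assms(1), of "dv p q \<otimes> g"] dv_props[OF assms(1-3)] assms(4) by simp
qed

lemma (in lie_bundle) fiber_nonempty: "x \<in> \<Delta> \<Longrightarrow> \<exists>p\<in>T. pr p = x"
  using chart_at chart_in chart_pr one_closed by metis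

locale two_bundles = P: lie_bundle G P + Q: lie_bundle G Q
  for G :: "('g, 'e::locally_convex_space) lie_group" (structure) and P Q :: "('p, 'g) gbundle"
begin

lemma bundle_map_props:
  assumes "smooth_bundle_map G P Q F"
  shows "F \<in> extensional P.T" "\<And>p. p \<in> P.T \<Longrightarrow> F p \<in> Q.T"
    "\<And>p g. p \<in> P.T \<Longrightarrow> g \<in> carrier G \<Longrightarrow> F (act P (p, g)) = act Q (F p, g)"
  using assms by (auto simp: smooth_bundle_map_def continuous_map_def)

lemma bundle_map_ext:
  assumes F: "smooth_bundle_map G P Q F" and f: "covers P Q F f"
    and U: "(U, \<phi>) \<in> atlas P" and V: "(V, \<psi>) \<in> atlas Q"
  shows "P.ext P.d {y \<in> U. f y \<in> V} (\<lambda>y. Q.coord V \<psi> (F (\<phi> (y, \<one>))))"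
proof (rule P.extI)
  fix x assume x: "x \<in> {y \<in> U. f y \<in> V}"
  obtain f' where f': "covers P Q F f'"
    "\<forall>(U, \<phi>)\<in>atlas P. \<forall>(V, \<psi>)\<in>atlas Q. \<forall>x\<in>U. f' x \<in> V \<longrightarrow>
           (\<exists>N H. openin (Euclidean_space P.d) N \<and> x \<in> N \<and>
              smooth_map (prod_manifold (open_submanifold P.d N) (mfd G))
                (prod_manifold (euclidean_manifold Q.d) (mfd G)) H \<and>
              (\<forall>y\<in>N \<inter> U. f' y \<in> V \<longrightarrow>
                 (\<forall>g\<in>carrier G. H (y, g) = inv_into (V \<times> carrier G) \<psi> (F (\<phi> (y, g))))))"
    using F unfolding smooth_bundle_map_def by blast
  \<comment> \<open>A smooth bundle map comes with some smooth base map; since all fibres are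
    nonempty, it has to be \<open>f\<close>.\<close>
  have eq: "f' y = f y" if "y \<in> U" for y
  proof -
    have "y \<in> P.\<Delta>" using P.chart_sub[OF U] that by blast
    from P.fiber_nonempty[OF this] obtain p where "p \<in> P.T" "proj P p = y" by blast
    then show ?thesis using f f'(1) by (auto simp: covers_def)
  qed
  have "\<exists>N H. openin (Euclidean_space P.d) N \<and> x \<in> N \<and>
              smooth_map (prod_manifold (open_submanifold P.d N) (mfd G))
                (prod_manifold (euclidean_manifold Q.d) (mfd G)) H \<and>
              (\<forall>y\<in>N \<inter> U. f' y \<in> V \<longrightarrow>
                 (\<forall>g\<in>carrier G. H (y, g) = inv_into (V \<times> carrier G) \<psi> (F (\<phi> (y, g)))))"
    using bspec[OF f'(2) U, simplified, THEN bspec, OF V, simplified, THEN bspec, of x] x eq[of x] by auto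
  then obtain N H where N: "openin (Euclidean_space P.d) N" "x \<in> N"
     "smooth_map (prod_manifold (open_submanifold P.d N) (mfd G))
                (prod_manifold (euclidean_manifold Q.d) (mfd G)) H"
     "\<And>y g. y \<in> N \<inter> U \<Longrightarrow> f' y \<in> V \<Longrightarrow> g \<in> carrier G \<Longrightarrow> H (y, g) = inv_into (V \<times> carrier G) \<psi> (F (\<phi> (y, g)))"
    by blast
  have "smooth_map (open_submanifold P.d N) (mfd G) (\<lambda>y. snd (H (y, \<one>)))"
    by (rule P.smooth_at_one[OF N(1) charted_open_submanifold[OF openin_topspace] N(3)])
  then show "\<exists>N \<gamma>. openin (Euclidean_space P.d) N \<and> x \<in> N \<and> smooth_map (open_submanifold P.d N) (mfd G) \<gamma> \<and>
     (\<forall>y\<in>N \<inter> {y \<in> U. f y \<in> V}. \<gamma> y = Q.coord V \<psi> (F (\<phi> (y, \<one>))))"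
    using N eq by (intro exI[of _ N] exI[of _ "\<lambda>y. snd (H (y, \<one>))"]) (auto simp: Q.coord_def)
qed

lemma fiber_unique:
  assumes F: "smooth_bundle_map G P Q F" and "p \<in> P.T" "q \<in> P.T" "proj P p = proj P q" "F p = F q"
  shows "p = q"
proof -
  note dv = P.dv_props[OF assms(2-4)]
  have "act Q (F p, P.dv p q) = act Q (F p, \<one>)"
    using bundle_map_props(3)[OF F assms(2) dv(1)] dv(2) assms(5) Q.act_one[OF bundle_map_props(2)[OF F assms(2)]] by simp
  then have "P.dv p q = \<one>"
    by (rule Q.act_cancel[OF bundle_map_props(2)[OF F assms(2)] dv(1) P.one_closed])
  then show ?thesis using dv(2) P.act_one[OF assms(2)] by simp
qed

text \<open>A bundle map is bijective on fibres, so \<open>t (f x)\<close> has a unique preimage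
  over each \<open>x\<close>. In charts the preimage is \<open>t\<close> divided by the image of the
  unit section of the chart, so only multiplication and inversion of smooth functions enter.\<close>

lemma pullback_section:
  assumes F: "smooth_bundle_map G P Q F" and f: "f \<in> smooth_maps P.d Q.d" "covers P Q F f" and t: "Q.sec Q.\<Delta> t"
  obtains s where "P.sec P.\<Delta> s" "\<And>x. x \<in> P.\<Delta> \<Longrightarrow> F (s x) = t (f x)"
proof -
  have "\<exists>q. q \<in> P.T \<and> proj P q = x \<and> F q = t (f x)" if x: "x \<in> P.\<Delta>" for x
  proof -
    obtain p where p: "p \<in> P.T" "proj P p = x" using P.fiber_nonempty[OF x] by blast
    have Fp: "F p \<in> Q.T" "proj Q (F p) = f x" using bundle_map_props(2)[OF F p(1)] f(2) p by (auto simp: covers_def)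
    have tf: "t (f x) \<in> Q.T" "proj Q (t (f x)) = f x" using Q.secD(2,3)[OF t] smooth_maps_in[OF f(1) x] by auto
    have dv: "Q.dv (F p) (t (f x)) \<in> carrier G" "act Q (F p, Q.dv (F p) (t (f x))) = t (f x)"
      using Q.dv_props[OF Fp(1) tf(1)] Fp tf by auto
    show ?thesis
      by (rule exI[of _ "act P (p, Q.dv (F p) (t (f x)))"])
         (use dv p bundle_map_props(3)[OF F p(1) dv(1)] in \<open>simp add: P.act_in P.pr_act\<close>)
  qed
  then obtain s where s: "\<And>x. x \<in> P.\<Delta> \<Longrightarrow> s x \<in> P.T \<and> proj P (s x) = x \<and> F (s x) = t (f x)" by metis
  have "P.sec P.\<Delta> s"
  proof (rule P.secI)
    fix U \<phi> assume U: "(U, \<phi>) \<in> atlas P"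
    show "P.ext P.d (P.\<Delta> \<inter> U) (\<lambda>x. P.coord U \<phi> (s x))"
    proof (rule P.ext_local)
      fix x assume x: "x \<in> P.\<Delta> \<inter> U"
      have fx: "f x \<in> Q.\<Delta>" using smooth_maps_in[OF f(1)] x by auto
      then obtain V \<psi> N where V: "(V, \<psi>) \<in> atlas Q" "f x \<in> V" "openin (Euclidean_space Q.d) N" "V = Q.\<Delta> \<inter> N"
        by (rule Q.chart_nbhd)
      obtain M where M: "openin (Euclidean_space P.d) M" "x \<in> M" "\<forall>y\<in>P.\<Delta> \<inter> M. f y \<in> N"
        using smooth_maps_open_preimage[OF f(1) V(3), of x] x V by auto
      let ?A = "P.\<Delta> \<inter> U \<inter> M"
      have fA: "f y \<in> V" if "y \<in> ?A" for y using that M(3) V(4) smooth_maps_in[OF f(1)] by auto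
      have "P.ext P.d ?A (\<lambda>y. inv (Q.coord V \<psi> (F (\<phi> (y, \<one>)))) \<otimes> Q.coord V \<psi> (t (f y)))"
      proof (rule P.ext_mult[OF P.ext_inv])
        show "P.ext P.d ?A (\<lambda>y. Q.coord V \<psi> (F (\<phi> (y, \<one>))))"
          by (rule P.ext_subset[OF bundle_map_ext[OF F f(2) U V(1)]]) (use fA in auto)
        show "P.ext P.d ?A (\<lambda>y. Q.coord V \<psi> (t (f y)))"
          by (rule P.ext_comp[OF Q.secD(4)[OF t V(1)] lext_subset[OF smooth_maps_lext[OF f(1)]]])
             (use fA Q.chart_sub[OF V(1)] in auto)
      qed
      moreover have "inv (Q.coord V \<psi> (F (\<phi> (y, \<one>)))) \<otimes> Q.coord V \<psi> (t (f y)) = P.coord U \<phi> (s y)" if y: "y \<in> ?A" for y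
      proof -
        have sy: "s y \<in> P.T" "proj P (s y) = y" "F (s y) = t (f y)" using s y by auto
        let ?g = "P.coord U \<phi> (s y)" and ?p = "\<phi> (y, \<one>)"
        have g: "?g \<in> carrier G" "\<phi> (y, ?g) = s y" using P.coord_props[OF U sy(1)] sy y by auto
        have p: "?p \<in> P.T" "proj P ?p = y" using P.chart_in[OF U] P.chart_pr[OF U] y by auto
        have Fp: "F ?p \<in> Q.T" "proj Q (F ?p) = f y" using bundle_map_props(2)[OF F p(1)] f(2) p by (auto simp: covers_def)
        have "t (f y) = act Q (F ?p, ?g)"
          using sy(3) g P.chart_one[OF U _ g(1), of y] bundle_map_props(3)[OF F p(1) g(1)] y by simp
        then have "Q.coord V \<psi> (t (f y)) = Q.coord V \<psi> (F ?p) \<otimes> ?g"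
          using Q.coord_act[OF V(1) Fp(1) _ g(1)] fA[OF y] Fp(2) by simp
        moreover have "Q.coord V \<psi> (F ?p) \<in> carrier G" using Q.coord_props(1)[OF V(1) Fp(1)] fA[OF y] Fp(2) by simp
        ultimately show ?thesis using g(1) by (simp add: P.m_assoc[symmetric])
      qed
      ultimately have "P.ext P.d ?A (\<lambda>x. P.coord U \<phi> (s x))" by (rule P.ext_cong)
      then show "\<exists>N. openin (Euclidean_space P.d) N \<and> x \<in> N \<and> P.ext P.d (P.\<Delta> \<inter> U \<inter> N) (\<lambda>x. P.coord U \<phi> (s x))"
        using M by blast
    qed
  qed (use s in auto)
  then show ?thesis using that s by blast
qed

text \<open>The sections trivialize both bundles: \<open>s x\<close> translated by \<open>g\<close>
  goes to \<open>t (f x)\<close> translated by the same \<open>g\<close>.\<close>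

definition sec_map :: "(point \<Rightarrow> 'p) \<Rightarrow> (point \<Rightarrow> 'p) \<Rightarrow> (point \<Rightarrow> point) \<Rightarrow> 'p \<Rightarrow> 'p" where
  "sec_map s t f = (\<lambda>p\<in>P.T. act Q (t (f (proj P p)), P.dv (s (proj P p)) p))"

context
  fixes s t f assumes s: "P.sec P.\<Delta> s" and t: "Q.sec Q.\<Delta> t" and f: "f \<in> smooth_maps P.d Q.d"
begin

lemma sec_map_aux:
  assumes p: "p \<in> P.T"
  shows "s (proj P p) \<in> P.T" "proj P (s (proj P p)) = proj P p" "t (f (proj P p)) \<in> Q.T"
    "proj Q (t (f (proj P p))) = f (proj P p)" "P.dv (s (proj P p)) p \<in> carrier G"
    "act P (s (proj P p), P.dv (s (proj P p)) p) = p"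
proof -
  have x: "proj P p \<in> P.\<Delta>" by (rule P.pr_in[OF p])
  show a: "s (proj P p) \<in> P.T" "proj P (s (proj P p)) = proj P p" using P.secD(2,3)[OF s x] by auto
  show "t (f (proj P p)) \<in> Q.T" "proj Q (t (f (proj P p))) = f (proj P p)"
    using Q.secD(2,3)[OF t smooth_maps_in[OF f x]] by auto
  show "P.dv (s (proj P p)) p \<in> carrier G" "act P (s (proj P p), P.dv (s (proj P p)) p) = p"
    using P.dv_props[OF a(1) p a(2)] by auto
qed

lemma covers_sec_map: "covers P Q (sec_map s t f) f"
  by (simp add: covers_def sec_map_def sec_map_aux Q.pr_act)

lemma sec_map_act:
  assumes "x \<in> P.\<Delta>" "g \<in> carrier G"
  shows "sec_map s t f (act P (s x, g)) = act Q (t (f x), g)"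
  using P.secD(2,3)[OF s assms(1)] assms(2)
  by (simp add: sec_map_def P.act_in P.pr_act P.dv_act)

lemma sec_map_equivariant:
  assumes p: "p \<in> P.T" and g: "g \<in> carrier G"
  shows "sec_map s t f (act P (p, g)) = act Q (sec_map s t f p, g)"
  using sec_map_aux[OF p] p g
  by (simp add: sec_map_def P.act_in P.pr_act P.dv_act2 Q.act_act)

text \<open>In charts the map is left translation by \<open>\<gamma>\<close>, a function of the base
  point alone, so continuity and smoothness of the map are inherited from
  \<open>\<gamma>\<close>.\<close>

lemma sec_map_chart:
  assumes U: "(U, \<phi>) \<in> atlas P" and V: "(V, \<psi>) \<in> atlas Q" and p: "p \<in> P.T" "proj P p \<in> U" "f (proj P p) \<in> V"
  defines "\<gamma> \<equiv> \<lambda>x. Q.coord V \<psi> (t (f x)) \<otimes> inv (P.coord U \<phi> (s x))"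
  shows "\<gamma> (proj P p) \<in> carrier G" "sec_map s t f p = \<psi> (f (proj P p), \<gamma> (proj P p) \<otimes> P.coord U \<phi> p)"
proof -
  let ?x = "proj P p"
  note a = sec_map_aux[OF p(1)]
  have c: "P.coord U \<phi> (s ?x) \<in> carrier G" "P.coord U \<phi> p \<in> carrier G" "Q.coord V \<psi> (t (f ?x)) \<in> carrier G"
    "\<psi> (f ?x, Q.coord V \<psi> (t (f ?x))) = t (f ?x)"
    using P.coord_props[OF U] Q.coord_props[OF V, of "t (f ?x)"] a p by auto
  then show "\<gamma> ?x \<in> carrier G" by (simp add: \<gamma>_def)
  have "P.dv (s ?x) p = inv (P.coord U \<phi> (s ?x)) \<otimes> P.coord U \<phi> p"
    using P.dv_eq_coord[OF a(1) p(1) a(2) U] a p by simp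
  then have "sec_map s t f p = act Q (\<psi> (f ?x, Q.coord V \<psi> (t (f ?x))), inv (P.coord U \<phi> (s ?x)) \<otimes> P.coord U \<phi> p)"
    using p(1) c(4) by (simp add: sec_map_def)
  also have "\<dots> = \<psi> (f ?x, Q.coord V \<psi> (t (f ?x)) \<otimes> (inv (P.coord U \<phi> (s ?x)) \<otimes> P.coord U \<phi> p))"
    by (rule Q.chart_act[OF V p(3), symmetric]) (use c in auto)
  finally show "sec_map s t f p = \<psi> (f ?x, \<gamma> ?x \<otimes> P.coord U \<phi> p)"
    using c by (simp add: \<gamma>_def P.m_assoc)
qed

lemma sec_map_coord_ext:
  assumes U: "(U, \<phi>) \<in> atlas P" and V: "(V, \<psi>) \<in> atlas Q"
  shows "P.ext P.d {x \<in> U. f x \<in> V} (\<lambda>x. Q.coord V \<psi> (t (f x)) \<otimes> inv (P.coord U \<phi> (s x)))"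
proof (rule P.ext_mult[OF _ P.ext_inv])
  show "P.ext P.d {x \<in> U. f x \<in> V} (\<lambda>x. Q.coord V \<psi> (t (f x)))"
    by (rule P.ext_comp[OF Q.secD(4)[OF t V] lext_subset[OF smooth_maps_lext[OF f]]])
       (use P.chart_sub[OF U] Q.chart_sub[OF V] in auto)
  show "P.ext P.d {x \<in> U. f x \<in> V} (\<lambda>x. P.coord U \<phi> (s x))"
    by (rule P.ext_subset[OF P.secD(4)[OF s U]]) (use P.chart_sub[OF U] in auto)
qed

lemma sec_map_continuous: "continuous_map (total P) (total Q) (sec_map s t f)"
proof (rule continuous_map_locally)
  fix p assume p: "p \<in> P.T"
  have x: "proj P p \<in> P.\<Delta>" "f (proj P p) \<in> Q.\<Delta>"
    using P.pr_in[OF p] smooth_maps_in[OF f] by auto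
  obtain U \<phi> where U: "(U, \<phi>) \<in> atlas P" "proj P p \<in> U" using P.chart_at[OF x(1)] by blast
  obtain V \<psi> where V: "(V, \<psi>) \<in> atlas Q" "f (proj P p) \<in> V" using Q.chart_at[OF x(2)] by blast
  let ?W = "{x \<in> U. f x \<in> V}" and ?\<gamma> = "\<lambda>x. Q.coord V \<psi> (t (f x)) \<otimes> inv (P.coord U \<phi> (s x))"
  have prc: "continuous_map (total P) (simplex_topology P.d) (proj P)"
    using P.top_bundle by (simp add: topological_principal_bundle_def)
  have "openin (simplex_topology P.d) {x \<in> topspace (simplex_topology P.d). f x \<in> V}"
    by (rule openin_continuous_map_preimage[OF smooth_maps_continuous[OF f] Q.chart_open[OF V(1)]])
  then have "openin (simplex_topology P.d) (U \<inter> {x \<in> topspace (simplex_topology P.d). f x \<in> V})"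
    by (intro openin_Int P.chart_open[OF U(1)])
  moreover have "U \<inter> {x \<in> topspace (simplex_topology P.d). f x \<in> V} = ?W" using P.chart_sub[OF U(1)] by auto
  ultimately have oW: "openin (simplex_topology P.d) ?W" by simp
  let ?S = "{q \<in> P.T. proj P q \<in> ?W}"
  have oS: "openin (total P) ?S" by (rule openin_continuous_map_preimage[OF prc oW])
  let ?X = "subtopology (total P) ?S"
  have pr1: "continuous_map ?X (simplex_topology P.d) (proj P)"
    by (rule continuous_map_from_subtopology[OF prc])
  have "continuous_map ?X (simplex_topology Q.d) (\<lambda>q. f (proj P q))"
    using continuous_map_compose[OF pr1 smooth_maps_continuous[OF f]] by (simp add: comp_def)
  then have 1: "continuous_map ?X (subtopology (simplex_topology Q.d) V) (\<lambda>q. f (proj P q))"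
    by (rule continuous_map_into_subtopology) auto
  have "continuous_map ?X (subtopology (Euclidean_space P.d) ?W) (proj P)"
    using pr1 P.chart_sub[OF U(1)] by (auto simp: simplex_topology_def continuous_map_in_subtopology)
  from continuous_map_compose[OF this P.ext_continuous[OF sec_map_coord_ext[OF U(1) V(1)]]]
  have 2: "continuous_map ?X (mtop (mfd G)) (\<lambda>q. ?\<gamma> (proj P q))"
    using P.chart_sub[OF U(1)] geom_simplex_euc by (auto simp: comp_def)
  have 3: "continuous_map ?X (mtop (mfd G)) (P.coord U \<phi>)"
    by (rule continuous_map_from_subtopology_mono[OF P.coord_continuous[OF U(1)]]) auto
  have m: "continuous_map (prod_topology (mtop (mfd G)) (mtop (mfd G))) (mtop (mfd G)) (\<lambda>(x, y). x \<otimes> y)"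
    using smooth_mapD(1)[OF P.smooth_mult] by simp
  have 4: "continuous_map ?X (mtop (mfd G)) (\<lambda>q. ?\<gamma> (proj P q) \<otimes> P.coord U \<phi> q)"
    using continuous_map_compose[OF continuous_map_pairedI[OF 2 3] m] by (simp add: comp_def)
  have \<psi>: "continuous_map (prod_topology (subtopology (simplex_topology Q.d) V) (mtop (mfd G))) (total Q) \<psi>"
    using homeomorphic_imp_continuous_map[OF Q.chart_homeo[OF V(1)]] by (simp add: continuous_map_in_subtopology)
  from continuous_map_compose[OF continuous_map_pairedI[OF 1 4] \<psi>]
  have "continuous_map ?X (total Q) (\<lambda>q. \<psi> (f (proj P q), ?\<gamma> (proj P q) \<otimes> P.coord U \<phi> q))"
    by (simp add: comp_def)
  then have "continuous_map ?X (total Q) (sec_map s t f)"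
    by (rule continuous_map_eq) (use sec_map_chart(2)[OF U(1) V(1)] in auto)
  then show "\<exists>S. openin (total P) S \<and> p \<in> S \<and> continuous_map (subtopology (total P) S) (total Q) (sec_map s t f)"
    using oS p U V by (intro exI[of _ ?S]) auto
qed

theorem smooth_sec_map: "smooth_bundle_map G P Q (sec_map s t f)"
  unfolding smooth_bundle_map_def
proof (intro conjI ballI bexI[OF _ f])
  show "sec_map s t f \<in> extensional P.T" by (simp add: sec_map_def)
  show "continuous_map (total P) (total Q) (sec_map s t f)" by (rule sec_map_continuous)
  show "sec_map s t f (act P (p, g)) = act Q (sec_map s t f p, g)" if "p \<in> P.T" "g \<in> carrier G" for p g
    using that by (rule sec_map_equivariant)
  show "covers P Q (sec_map s t f) f" by (rule covers_sec_map)
  show "case \<tau> of (U, \<phi>) \<Rightarrow> \<forall>(V, \<psi>)\<in>atlas Q. \<forall>x\<in>U. f x \<in> V \<longrightarrow>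
           (\<exists>N H. openin (Euclidean_space P.d) N \<and> x \<in> N \<and>
              smooth_map (prod_manifold (open_submanifold P.d N) (mfd G))
                (prod_manifold (euclidean_manifold Q.d) (mfd G)) H \<and>
              (\<forall>y\<in>N \<inter> U. f y \<in> V \<longrightarrow>
                 (\<forall>g\<in>carrier G. H (y, g) = inv_into (V \<times> carrier G) \<psi> (sec_map s t f (\<phi> (y, g))))))"
    if "\<tau> \<in> atlas P" for \<tau>
  proof (cases \<tau>, clarify)
    fix U \<phi> V \<psi> x assume \<tau>: "\<tau> = (U, \<phi>)" and V: "(V, \<psi>) \<in> atlas Q" and x: "x \<in> U" "f x \<in> V"
    have U: "(U, \<phi>) \<in> atlas P" using that \<tau> by simp
    let ?W = "{x \<in> U. f x \<in> V}" and ?\<gamma> = "\<lambda>x. Q.coord V \<psi> (t (f x)) \<otimes> inv (P.coord U \<phi> (s x))"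
    have xW: "x \<in> ?W" using x by simp
    obtain N \<gamma> where N: "openin (Euclidean_space P.d) N" "x \<in> N" "smooth_map (open_submanifold P.d N) (mfd G) \<gamma>"
      "\<And>y. y \<in> N \<Longrightarrow> y \<in> ?W \<Longrightarrow> \<gamma> y = ?\<gamma> y"
      by (rule P.extE[OF sec_map_coord_ext[OF U V] xW]) blast
    obtain M h where M: "openin (Euclidean_space P.d) M" "P.\<Delta> \<subseteq> M"
      "smooth_map (open_submanifold P.d M) (euclidean_manifold Q.d) h" "\<forall>x\<in>P.\<Delta>. h x = f x"
      using f unfolding smooth_maps_def by blast
    have op: "openin (Euclidean_space P.d) (N \<inter> M)" using N(1) M(1) by (rule openin_Int)
    have "smooth_map (prod_manifold (open_submanifold P.d (N \<inter> M)) (mfd G))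
                (prod_manifold (euclidean_manifold Q.d) (mfd G)) (\<lambda>p. (h (fst p), \<gamma> (fst p) \<otimes> snd p))"
      by (rule P.smooth_translation[OF op smooth_map_restrict[OF M(3,1) op] smooth_map_restrict[OF N(3,1) op]]) auto
    moreover have "(h y, \<gamma> y \<otimes> g) = inv_into (V \<times> carrier G) \<psi> (sec_map s t f (\<phi> (y, g)))"
      if y: "y \<in> N \<inter> M \<inter> U" "f y \<in> V" and g: "g \<in> carrier G" for y g
    proof -
      have p: "\<phi> (y, g) \<in> P.T" "proj P (\<phi> (y, g)) = y" using P.chart_in[OF U] P.chart_pr[OF U] y g by auto
      have "sec_map s t f (\<phi> (y, g)) = \<psi> (f y, ?\<gamma> y \<otimes> g)" "?\<gamma> y \<in> carrier G"
        using sec_map_chart[OF U V p(1)] p(2) y P.coord_chart[OF U _ g, of y] by auto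
      moreover have "h y = f y" "\<gamma> y = ?\<gamma> y" using M(4) N(4)[of y] y P.chart_sub[OF U] by auto
      ultimately show ?thesis using Q.inv_chart[OF V y(2)] g by simp
    qed
    ultimately show "\<exists>N H. openin (Euclidean_space P.d) N \<and> x \<in> N \<and>
              smooth_map (prod_manifold (open_submanifold P.d N) (mfd G))
                (prod_manifold (euclidean_manifold Q.d) (mfd G)) H \<and>
              (\<forall>y\<in>N \<inter> U. f y \<in> V \<longrightarrow>
                 (\<forall>g\<in>carrier G. H (y, g) = inv_into (V \<times> carrier G) \<psi> (sec_map s t f (\<phi> (y, g)))))"
      using op N(2) M(2) x P.chart_sub[OF U]
      by (intro exI[of _ "N \<inter> M"] exI[of _ "\<lambda>p. (h (fst p), \<gamma> (fst p) \<otimes> snd p)"]) auto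
  qed
qed

text \<open>Every point is a translate of a value of \<open>s\<close>, so equivariance leaves no
  choice. This identifies the given bundle maps of the horn with those built from sections.\<close>

lemma sec_map_unique:
  assumes F: "smooth_bundle_map G P Q F" and Fs: "\<And>x. x \<in> P.\<Delta> \<Longrightarrow> F (s x) = t (f x)"
  shows "F = sec_map s t f"
proof (rule extensionalityI[OF bundle_map_props(1)[OF F]])
  show "sec_map s t f \<in> extensional P.T" by (simp add: sec_map_def)
  fix p assume p: "p \<in> P.T"
  note a = sec_map_aux[OF p]
  have "F p = act Q (F (s (proj P p)), P.dv (s (proj P p)) p)"
    using bundle_map_props(3)[OF F a(1,5)] a(6) by simp
  then show "F p = sec_map s t f p" using Fs[OF P.pr_in[OF p]] p by (simp add: sec_map_def)
qed

end

end

section \<open>Simplicial bundles and their pull-backs\<close>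

abbreviation scomp :: "nat \<Rightarrow> (point \<Rightarrow> point) \<Rightarrow> (point \<Rightarrow> point) \<Rightarrow> point \<Rightarrow> point" where
  "scomp d g f \<equiv> compose (geom_simplex d) g f"

lemma smooth_mapsI:
  assumes "\<sigma> \<in> geom_simplex m \<rightarrow>\<^sub>E geom_simplex n" "openin (Euclidean_space m) N" "geom_simplex m \<subseteq> N"
    "smooth_map (open_submanifold m N) (euclidean_manifold n) h" "\<And>x. x \<in> geom_simplex m \<Longrightarrow> h x = \<sigma> x"
  shows "\<sigma> \<in> smooth_maps m n"
  using assms unfolding smooth_maps_def by blast

lemma smooth_maps_ext: "f \<in> smooth_maps m n \<Longrightarrow> f \<in> extensional (geom_simplex m)"
  by (auto simp: smooth_maps_def PiE_def)

lemma smooth_maps_eqI: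
  "f \<in> smooth_maps m n \<Longrightarrow> g \<in> smooth_maps m n' \<Longrightarrow> (\<And>x. x \<in> geom_simplex m \<Longrightarrow> f x = g x) \<Longrightarrow> f = g"
  by (rule extensionalityI[OF smooth_maps_ext smooth_maps_ext])

lemma smooth_maps_scomp:
  assumes f: "f \<in> smooth_maps l m" and g: "g \<in> smooth_maps m n"
  shows "scomp l g f \<in> smooth_maps l n"
proof -
  obtain M h where M: "openin (Euclidean_space l) M" "geom_simplex l \<subseteq> M"
    "smooth_map (open_submanifold l M) (euclidean_manifold m) h" "\<forall>x\<in>geom_simplex l. h x = f x"
    using f unfolding smooth_maps_def by blast
  obtain N h' where N: "openin (Euclidean_space m) N" "geom_simplex m \<subseteq> N"
    "smooth_map (open_submanifold m N) (euclidean_manifold n) h'" "\<forall>x\<in>geom_simplex m. h' x = g x"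
    using g unfolding smooth_maps_def by blast
  have op: "openin (Euclidean_space l) (M \<inter> h -` N)" by (rule preimage_open_OS[OF M(3,1) N(1)])
  show ?thesis
  proof (rule smooth_mapsI[OF _ op])
    show "smooth_map (open_submanifold l (M \<inter> h -` N)) (euclidean_manifold n) (\<lambda>x. h' (h x))"
      by (rule smooth_map_compose[OF charted_open_submanifold[OF op] charted_open_submanifold[OF N(1)]
            smooth_map_into_OS[OF M(3,1) N(1)] N(3)])
    show "scomp l g f \<in> geom_simplex l \<rightarrow>\<^sub>E geom_simplex n"
      using smooth_maps_in[OF f] smooth_maps_in[OF g] by (auto simp: compose_def)
    show "geom_simplex l \<subseteq> M \<inter> h -` N" using M N smooth_maps_in[OF f] by (auto intro!: subsetD[OF N(2)])
    show "h' (h x) = scomp l g f x" if "x \<in> geom_simplex l" for x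
      using that M(4) N(4) smooth_maps_in[OF f that] by (simp add: compose_eq)
  qed
qed

abbreviation sid :: "nat \<Rightarrow> point \<Rightarrow> point" where
  "sid d \<equiv> \<lambda>x\<in>geom_simplex d. x"

lemma smooth_maps_affine:
  assumes L: "linear L" "continuous_on UNIV L" and e: "\<And>x. x \<in> euc m \<Longrightarrow> L x + c \<in> euc n"
    and \<sigma>: "\<sigma> \<in> extensional (geom_simplex m)" "\<And>x. x \<in> geom_simplex m \<Longrightarrow> \<sigma> x \<in> geom_simplex n"
      "\<And>x. x \<in> geom_simplex m \<Longrightarrow> \<sigma> x = L x + c"
  shows "\<sigma> \<in> smooth_maps m n"
proof (rule smooth_mapsI[of _ _ _ "euc m" "\<lambda>x. L x + c"])
  have "bastiani_smooth_on (euc m) (euc m) (\<lambda>x. L x + c)"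
    by (rule bastiani_smooth_on_affine[OF subspace_euc _ L]) simp
  then show "smooth_map (open_submanifold m (euc m)) (euclidean_manifold n) (\<lambda>x. L x + c)"
    using e by (subst smooth_map_open_submanifold_iff) auto
qed (use \<sigma> geom_simplex_euc in \<open>auto simp: PiE_def\<close>)

lemma sid_smooth: "sid d \<in> smooth_maps d d"
  by (rule smooth_maps_affine[OF linear_ident continuous_on_id, where c = 0]) auto

lemma scomp_sid: "f \<in> smooth_maps d n \<Longrightarrow> scomp d f (sid d) = f"
  by (rule extensionalityI[of _ "geom_simplex d"]) (auto simp: compose_def smooth_maps_ext)

lemma sid_scomp: "f \<in> smooth_maps d n \<Longrightarrow> scomp d (sid n) f = f"
  by (rule extensionalityI[of _ "geom_simplex d"]) (auto simp: compose_def smooth_maps_ext smooth_maps_in)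

lemma scomp_assoc: "f \<in> smooth_maps l m \<Longrightarrow> scomp l (scomp m h g) f = scomp l h (scomp l g f)"
  by (rule extensionalityI[of _ "geom_simplex l"]) (auto simp: compose_def smooth_maps_in)

lemma scomp_apply: "x \<in> geom_simplex d \<Longrightarrow> scomp d g f x = g (f x)"
  by (simp add: compose_eq)

section \<open>Affine maps of simplices in barycentric coordinates\<close>

lemma barycentric_sum: "(\<Sum>a\<le>m. barycentric m x a) = 1"
proof -
  have "(\<Sum>a\<le>m. barycentric m x a) = barycentric m x 0 + (\<Sum>l<m. barycentric m x (Suc l))"
    by (simp add: sum.atMost_shift lessThan_Suc_atMost)
  then show ?thesis by (simp add: barycentric_def)
qed

lemma barycentric_nonneg: "x \<in> geom_simplex m \<Longrightarrow> a \<le> m \<Longrightarrow> 0 \<le> barycentric m x a"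
  by (auto simp: barycentric_def geom_simplex_def)

lemma affine_coord:
  "(\<Sum>a\<le>m. barycentric m x a *\<^sub>R vertex (i a)) l = (\<Sum>a | a \<le> m \<and> i a = Suc l. barycentric m x a)"
proof -
  have "(\<Sum>a\<in>A. barycentric m x a *\<^sub>R vertex (i a)) l = (\<Sum>a\<in>A. if i a = Suc l then barycentric m x a else 0)"
    if "finite A" for A
    using that by (induction A) (auto simp: scaleR_fun_def vertex_def zero_fun_def plus_fun_def)
  then show ?thesis by (simp add: sum.If_cases Collect_conj_eq atMost_def Int_commute)
qed

text \<open>Weights are pushed forward along \<open>i\<close>. For positive \<open>b\<close> the
  weight is a coordinate of the point; the weight at 0 is what the others leave of the total weight
  1.\<close>

lemma barycentric_affine:
  assumes i: "\<And>a. a \<le> m \<Longrightarrow> i a \<le> n" and b: "b \<le> n"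
  shows "barycentric n (\<Sum>a\<le>m. barycentric m x a *\<^sub>R vertex (i a)) b = (\<Sum>a | a \<le> m \<and> i a = b. barycentric m x a)"
proof (cases b)
  case (Suc l)
  then show ?thesis by (simp add: barycentric_def[of n] affine_coord)
next
  case 0
  have "(\<Sum>b\<le>n. \<Sum>a | a \<in> {..m} \<and> i a = b. barycentric m x a) = (\<Sum>a\<le>m. barycentric m x a)"
    by (rule sum.group) (use i in auto)
  then have "(\<Sum>b\<le>n. \<Sum>a | a \<le> m \<and> i a = b. barycentric m x a) = 1" by (simp add: barycentric_sum)
  moreover have "(\<Sum>b\<le>n. \<Sum>a | a \<le> m \<and> i a = b. barycentric m x a) =
    (\<Sum>a | a \<le> m \<and> i a = 0. barycentric m x a) + (\<Sum>l<n. \<Sum>a | a \<le> m \<and> i a = Suc l. barycentric m x a)"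
    by (simp add: sum.atMost_shift lessThan_Suc_atMost)
  ultimately show ?thesis using 0 by (simp add: barycentric_def[of n] affine_coord)
qed

lemma geom_simplex_eqI:
  assumes "x \<in> geom_simplex n" "y \<in> geom_simplex n" "\<And>b. b \<le> n \<Longrightarrow> barycentric n x b = barycentric n y b"
  shows "x = y"
proof
  fix l
  show "x l = y l"
  proof (cases "l < n")
    case True
    then show ?thesis using assms(3)[of "Suc l"] by (simp add: barycentric_def)
  next
    case False
    then show ?thesis using assms(1,2) by (simp add: geom_simplex_def topspace_Euclidean_space)
  qed
qed

lemma affine_in_geom_simplex:
  assumes i: "\<And>a. a \<le> m \<Longrightarrow> i a \<le> n" and x: "x \<in> geom_simplex m"
  shows "(\<Sum>a\<le>m. barycentric m x a *\<^sub>R vertex (i a)) \<in> geom_simplex n" (is "?y \<in> _")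
proof -
  have nn: "0 \<le> (\<Sum>a | a \<le> m \<and> i a = b. barycentric m x a)" for b
    by (rule sum_nonneg) (use barycentric_nonneg[OF x] in auto)
  have "?y l = 0" if "l \<ge> n" for l
  proof -
    have "{a. a \<le> m \<and> i a = Suc l} = {}" using i that by fastforce
    then show ?thesis unfolding affine_coord by (simp only: sum.empty)
  qed
  moreover have "0 \<le> ?y l" for l by (simp only: affine_coord nn)
  moreover have "(\<Sum>l<n. ?y l) \<le> 1"
    using barycentric_affine[of m i n 0 x, OF i] nn[of 0] by (simp add: barycentric_def[of n])
  ultimately show ?thesis by (simp add: geom_simplex_def topspace_Euclidean_space)
qed

lemma affine_simplex_map_in:
  assumes "\<And>a. a \<le> m \<Longrightarrow> i a \<le> n" "x \<in> geom_simplex m"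
  shows "affine_simplex_map m i x \<in> geom_simplex n"
  using affine_in_geom_simplex[OF assms] assms(2) by (simp add: affine_simplex_map_def)

lemma barycentric_affine_simplex_map:
  assumes "\<And>a. a \<le> m \<Longrightarrow> i a \<le> n" "b \<le> n" "x \<in> geom_simplex m"
  shows "barycentric n (affine_simplex_map m i x) b = (\<Sum>a | a \<le> m \<and> i a = b. barycentric m x a)"
  using barycentric_affine[OF assms(1,2)] assms(3) by (simp add: affine_simplex_map_def)

lemma affine_smooth:
  assumes i: "\<And>a. a \<le> m \<Longrightarrow> i a \<le> n"
  shows "affine_simplex_map m i \<in> smooth_maps m n"
proof -
  \<comment> \<open>The linear part of the affine map: the constant 1 in the weight of vertex 0 is
    split off and contributes the translation by \<open>vertex (i 0)\<close>.\<close>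
  define L :: "point \<Rightarrow> point" where
    "L x = (\<Sum>a\<le>m. (if a = 0 then - (\<Sum>l<m. x l) else x (a - 1)) *\<^sub>R vertex (i a))" for x
  have v: "vertex b \<in> euc n" if "b \<le> n" for b
    using that by (auto simp: vertex_def topspace_Euclidean_space)
  have Leq: "(\<Sum>a\<le>m. barycentric m x a *\<^sub>R vertex (i a)) = L x + vertex (i 0)" for x
  proof -
    have "(\<Sum>a\<le>m. barycentric m x a *\<^sub>R vertex (i a)) =
      (\<Sum>a\<le>m. (if a = 0 then - (\<Sum>l<m. x l) else x (a - 1)) *\<^sub>R vertex (i a) + (if a = 0 then vertex (i 0) else 0))"
      by (rule sum.cong) (auto simp: barycentric_def algebra_simps)
    also have "\<dots> = L x + (\<Sum>a\<le>m. if a = 0 then vertex (i 0) else 0)"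
      by (simp only: sum.distrib L_def)
    finally show ?thesis by simp
  qed
  show ?thesis
  proof (rule smooth_maps_affine[of L m "vertex (i 0)" n])
    show "linear L"
    proof (rule linearI)
      show "L (x + y) = L x + L y" for x y
        unfolding L_def sum.distrib[symmetric]
        by (rule sum.cong) (auto simp: sum.distrib scaleR_left_distrib scaleR_left_diff_distrib)
      show "L (c *\<^sub>R x) = c *\<^sub>R L x" for c x
        unfolding L_def scaleR_sum_right
        by (rule sum.cong) (auto simp: scaleR_fun_def sum_distrib_left)
    qed
    show "continuous_on UNIV L"
      unfolding L_def
    proof (rule continuous_on_sum, rule continuous_on_scaleR_lc[OF _ continuous_on_const])
      show "continuous_on UNIV (\<lambda>x::point. if a = 0 then - (\<Sum>l<m. x l) else x (a - 1))" for a
        by (cases "a = 0") (auto intro!: continuous_on_minus continuous_on_sum continuous_on_coordinate)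
    qed
    show "L x + vertex (i 0) \<in> euc n" for x
      unfolding Leq[symmetric]
      by (intro subspace_sum[OF subspace_euc] subspace_scale[OF subspace_euc] v i) auto
    show "affine_simplex_map m i x = L x + vertex (i 0)" if "x \<in> geom_simplex m" for x
      using that Leq by (simp add: affine_simplex_map_def)
  qed (use affine_simplex_map_in[OF i] in \<open>auto simp: affine_simplex_map_def\<close>)
qed

lemma affine_comp:
  assumes i: "\<And>a. a \<le> l \<Longrightarrow> i a \<le> m" and j: "\<And>a. a \<le> m \<Longrightarrow> j a \<le> n"
    and ji: "\<And>a. a \<le> l \<Longrightarrow> ji a = j (i a)"
  shows "scomp l (affine_simplex_map m j) (affine_simplex_map l i) = affine_simplex_map l ji"
proof (rule smooth_maps_eqI[OF smooth_maps_scomp[OF affine_smooth[OF i] affine_smooth[OF j]] affine_smooth[of l ji n]])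
  fix x assume x: "x \<in> geom_simplex l"
  show "scomp l (affine_simplex_map m j) (affine_simplex_map l i) x = affine_simplex_map l ji x"
  proof (rule geom_simplex_eqI)
    note ix = affine_simplex_map_in[OF i x]
    have jin: "ji a \<le> n" if "a \<le> l" for a using that i j ji by simp
    show "scomp l (affine_simplex_map m j) (affine_simplex_map l i) x \<in> geom_simplex n"
      using affine_simplex_map_in[OF j ix] x by (simp add: scomp_apply)
    show "affine_simplex_map l ji x \<in> geom_simplex n"
      using affine_simplex_map_in[OF jin x] .
    fix b assume b: "b \<le> n"
    have "barycentric n (scomp l (affine_simplex_map m j) (affine_simplex_map l i) x) b
      = (\<Sum>c | c \<le> m \<and> j c = b. \<Sum>a | a \<le> l \<and> i a = c. barycentric l x a)"
      using barycentric_affine_simplex_map[OF j b ix] barycentric_affine_simplex_map[OF i _ x] x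
      by (simp add: scomp_apply)
    also have "\<dots> = (\<Sum>c | c \<le> m \<and> j c = b. \<Sum>a | a \<in> {a. a \<le> l \<and> ji a = b} \<and> i a = c. barycentric l x a)"
      by (intro sum.cong refl) (auto simp: ji)
    also have "\<dots> = (\<Sum>a | a \<le> l \<and> ji a = b. barycentric l x a)"
      by (rule sum.group) (use i ji in auto)
    finally show "barycentric n (scomp l (affine_simplex_map m j) (affine_simplex_map l i) x) b
      = barycentric n (affine_simplex_map l ji x) b"
      using barycentric_affine_simplex_map[OF jin b x] by simp
  qed
qed (use i j ji in auto)

text \<open>A point does not notice that vertices are moved to which it gives no weight.\<close>

lemma affine_fix:
  assumes i: "\<And>a. a \<le> n \<Longrightarrow> i a \<le> n" and y: "y \<in> geom_simplex n"
    and fix_or_0: "\<And>a. a \<le> n \<Longrightarrow> i a = a \<or> barycentric n y a = 0"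
  shows "affine_simplex_map n i y = y"
proof (rule geom_simplex_eqI[OF affine_simplex_map_in[OF i y] y])
  fix b assume b: "b \<le> n"
  have "(\<Sum>a | a \<le> n \<and> i a = b. barycentric n y a) = (\<Sum>a | a \<le> n \<and> a = b. barycentric n y a)"
  proof (rule sum.mono_neutral_cong)
    show "barycentric n y a = 0" if "a \<in> {a. a \<le> n \<and> a = b} - {a. a \<le> n \<and> i a = b}" for a
      using that fix_or_0[of a] by auto
    show "barycentric n y a = 0" if "a \<in> {a. a \<le> n \<and> i a = b} - {a. a \<le> n \<and> a = b}" for a
      using that fix_or_0[of a] by auto
  qed auto
  also have "\<dots> = barycentric n y b"
  proof -
    have "{a. a \<le> n \<and> a = b} = {b}" using b by auto
    then show ?thesis by simp
  qed
  finally show "barycentric n (affine_simplex_map n i y) b = barycentric n y b"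
    by (simp add: barycentric_affine_simplex_map[OF i b y])
qed

lemma affine_id: "affine_simplex_map n (\<lambda>a\<in>{..n}. a) = sid n"
proof (rule smooth_maps_eqI[OF affine_smooth[where n = n] sid_smooth])
  show "affine_simplex_map n (\<lambda>a\<in>{..n}. a) x = sid n x" if "x \<in> geom_simplex n" for x
    using that affine_fix[of n "\<lambda>a\<in>{..n}. a" x] by simp
qed auto

lemma delta_hom_le: "i \<in> delta_hom m n \<Longrightarrow> a \<le> m \<Longrightarrow> i a \<le> n"
  by (auto simp: delta_hom_def)

section \<open>Objects and arrows of the category of smooth simplices\<close>

definition obj :: "nat \<Rightarrow> (point \<Rightarrow> point) \<Rightarrow> nat \<times> smap" where
  "obj d \<tau> = (d, induced_smap d \<tau>)"

text \<open>As in the Yoneda lemma, \<open>\<tau>\<close> is the value of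
  \<open>induced_smap d \<tau>\<close> at the identity. Smooth simplicial maps can thus be traded
  for smooth maps of simplices, in terms of which everything below is stated.\<close>

definition unobj :: "nat \<times> smap \<Rightarrow> point \<Rightarrow> point" where
  "unobj a = snd a (fst a) (sid (fst a))"

lemma simplices_smooth [simp]: "simplices (smooth_simplices d) k = smooth_maps k d"
  by (simp add: smooth_simplices_def)

lemma unobj_obj [simp]: "\<tau> \<in> smooth_maps d n \<Longrightarrow> unobj (obj d \<tau>) = \<tau>"
  by (simp add: unobj_def obj_def induced_smap_def sid_smooth scomp_sid)

lemma fst_obj [simp]: "fst (obj d \<tau>) = d"
  by (simp add: obj_def)

lemma smap_comp_induced:
  assumes "\<tau> \<in> smooth_maps d m"
  shows "smap_comp d (induced_smap m \<sigma>) (induced_smap d \<tau>) = induced_smap d (scomp d \<sigma> \<tau>)"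
proof
  fix k
  show "smap_comp d (induced_smap m \<sigma>) (induced_smap d \<tau>) k = induced_smap d (scomp d \<sigma> \<tau>) k"
  proof
    fix \<rho>
    show "smap_comp d (induced_smap m \<sigma>) (induced_smap d \<tau>) k \<rho> = induced_smap d (scomp d \<sigma> \<tau>) k \<rho>"
    proof (cases "\<rho> \<in> smooth_maps k d")
      case True
      have "smap_comp d (induced_smap m \<sigma>) (induced_smap d \<tau>) k \<rho> = induced_smap m \<sigma> k (scomp k \<tau> \<rho>)"
        using True by (simp add: smap_comp_def compose_eq induced_smap_def[of d])
      then show ?thesis
        using True smooth_maps_scomp[OF True assms] scomp_assoc[OF True] by (simp add: induced_smap_def)
    next
      case False
      then show ?thesis by (simp add: smap_comp_def compose_def induced_smap_def)
    qed
  qed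
qed

lemma induced_inj: "\<tau> \<in> smooth_maps d n \<Longrightarrow> \<sigma> \<in> smooth_maps d n' \<Longrightarrow> induced_smap d \<tau> = induced_smap d \<sigma> \<Longrightarrow> \<tau> = \<sigma>"
  using unobj_obj[of \<tau> d n] unobj_obj[of \<sigma> d n'] by (simp add: obj_def)

lemma ob_dsm: "ob (dsm_cat n) = {obj d \<tau> |d \<tau>. \<tau> \<in> smooth_maps d n}"
  by (auto simp: dsm_cat_def smooth_smaps_def obj_def)

lemma obj_in_ob [simp]: "\<tau> \<in> smooth_maps d n \<Longrightarrow> obj d \<tau> \<in> ob (dsm_cat n)"
  by (auto simp: ob_dsm)

lemma arrows_dsm_iff:
  assumes "\<tau>1 \<in> smooth_maps d1 n" "\<tau>2 \<in> smooth_maps d2 n"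
  shows "(obj d1 \<tau>1, obj d2 \<tau>2, f) \<in> arrows (dsm_cat n) \<longleftrightarrow> f \<in> smooth_maps d1 d2 \<and> scomp d1 \<tau>2 f = \<tau>1"
proof -
  have "smap_comp d1 (induced_smap d2 \<tau>2) (induced_smap d1 f) = induced_smap d1 \<tau>1 \<longleftrightarrow> scomp d1 \<tau>2 f = \<tau>1"
    if f: "f \<in> smooth_maps d1 d2"
    using smap_comp_induced[OF f] induced_inj[OF smooth_maps_scomp[OF f assms(2)] assms(1)] by auto
  then show ?thesis
    using assms by (auto simp: arrows_def dsm_cat_def smooth_smaps_def obj_def)
qed

lemma arrows_dsmE:
  assumes "(a, b, f) \<in> arrows (dsm_cat n)"
  obtains d1 \<tau>1 d2 \<tau>2 where "a = obj d1 \<tau>1" "b = obj d2 \<tau>2" "\<tau>1 \<in> smooth_maps d1 n" "\<tau>2 \<in> smooth_maps d2 n"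
    "f \<in> smooth_maps d1 d2" "scomp d1 \<tau>2 f = \<tau>1"
proof -
  have "a \<in> ob (dsm_cat n)" "b \<in> ob (dsm_cat n)" using assms by (auto simp: arrows_def)
  then obtain d1 \<tau>1 d2 \<tau>2 where "a = obj d1 \<tau>1" "b = obj d2 \<tau>2" "\<tau>1 \<in> smooth_maps d1 n" "\<tau>2 \<in> smooth_maps d2 n"
    unfolding ob_dsm by blast
  then show ?thesis using that assms arrows_dsm_iff by blast
qed

lemma ident_dsm [simp]: "ident (dsm_cat n) (obj d \<tau>) = sid d"
  by (simp add: dsm_cat_def obj_def)

lemma cat_comp_dsm [simp]: "cat_comp (dsm_cat n) (obj d \<tau>) b c g f = scomp d g f"
  by (simp add: dsm_cat_def obj_def)

lemma bundle_cat_simps [simp]: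
  "ob (bundle_cat G) = {P. smooth_bundle G P}" "hom_set (bundle_cat G) P Q = {F. smooth_bundle_map G P Q F}"
  "ident (bundle_cat G) P = (\<lambda>p\<in>topspace (total P). p)"
  "cat_comp (bundle_cat G) P Q R F' F = compose (topspace (total P)) F' F"
  by (simp_all add: bundle_cat_def)

definition mor :: "nat \<Rightarrow> (point \<Rightarrow> point) \<Rightarrow> nat \<Rightarrow> (point \<Rightarrow> point) \<Rightarrow> (point \<Rightarrow> point) \<Rightarrow>
    (nat \<times> smap) \<times> (nat \<times> smap) \<times> (point \<Rightarrow> point)" where
  "mor d1 \<tau>1 d2 \<tau>2 f = (obj d1 \<tau>1, obj d2 \<tau>2, f)"

lemma mor_arrow: "\<tau>2 \<in> smooth_maps d2 n \<Longrightarrow> f \<in> smooth_maps d1 d2 \<Longrightarrow> mor d1 (scomp d1 \<tau>2 f) d2 \<tau>2 f \<in> arrows (dsm_cat n)"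
  by (simp add: mor_def arrows_dsm_iff smooth_maps_scomp)

text \<open>An arrow is determined by its target \<open>\<tau>\<close> and the map \<open>f\<close>,
  its source being forced to be the composite. Indexing arrows this way turns the functor axioms
  into equations about composable maps.\<close>

lemma is_simplicial_bundleI:
  assumes "fobj P \<in> extensional (ob (dsm_cat n))" "fmor P \<in> extensional (arrows (dsm_cat n))"
    "\<And>d \<tau>. \<tau> \<in> smooth_maps d n \<Longrightarrow> smooth_bundle G (fobj P (obj d \<tau>)) \<and> base_dim (fobj P (obj d \<tau>)) = d"
    "\<And>d1 d2 \<tau> f. \<tau> \<in> smooth_maps d2 n \<Longrightarrow> f \<in> smooth_maps d1 d2 \<Longrightarrow>
        smooth_bundle_map G (fobj P (obj d1 (scomp d1 \<tau> f))) (fobj P (obj d2 \<tau>)) (fmor P (mor d1 (scomp d1 \<tau> f) d2 \<tau> f)) \<and>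
        covers (fobj P (obj d1 (scomp d1 \<tau> f))) (fobj P (obj d2 \<tau>)) (fmor P (mor d1 (scomp d1 \<tau> f) d2 \<tau> f)) f"
    "\<And>d \<tau>. \<tau> \<in> smooth_maps d n \<Longrightarrow> fmor P (mor d \<tau> d \<tau> (sid d)) = (\<lambda>p\<in>topspace (total (fobj P (obj d \<tau>))). p)"
    "\<And>d1 d2 d3 \<tau> f g. \<tau> \<in> smooth_maps d3 n \<Longrightarrow> f \<in> smooth_maps d1 d2 \<Longrightarrow> g \<in> smooth_maps d2 d3 \<Longrightarrow>
        fmor P (mor d1 (scomp d1 \<tau> (scomp d1 g f)) d3 \<tau> (scomp d1 g f)) =
        compose (topspace (total (fobj P (obj d1 (scomp d1 \<tau> (scomp d1 g f))))))
          (fmor P (mor d2 (scomp d2 \<tau> g) d3 \<tau> g)) (fmor P (mor d1 (scomp d1 \<tau> (scomp d1 g f)) d2 (scomp d2 \<tau> g) f))"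
  shows "is_simplicial_bundle G n P"
  unfolding is_simplicial_bundle_def is_functor_def
proof (intro conjI)
  show "fobj P \<in> ob (dsm_cat n) \<rightarrow>\<^sub>E ob (bundle_cat G)" using assms(1,3) by (auto simp: ob_dsm PiE_def)
  show "fmor P \<in> extensional (arrows (dsm_cat n))" by fact
  show "\<forall>(a, b, f)\<in>arrows (dsm_cat n). fmor P (a, b, f) \<in> hom_set (bundle_cat G) (fobj P a) (fobj P b)"
  proof (intro ballI, clarify)
    fix a and b and f assume "(a, b, f) \<in> arrows (dsm_cat n)"
    then show "fmor P (a, b, f) \<in> hom_set (bundle_cat G) (fobj P a) (fobj P b)"
      by (rule arrows_dsmE) (use assms(4) in \<open>auto simp: mor_def\<close>)
  qed
  show "\<forall>a\<in>ob (dsm_cat n). fmor P (a, a, ident (dsm_cat n) a) = ident (bundle_cat G) (fobj P a)"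
    using assms(5) by (auto simp: ob_dsm mor_def)
  show "\<forall>(d, \<Sigma>)\<in>ob (dsm_cat n). base_dim (fobj P (d, \<Sigma>)) = d"
    using assms(3) by (auto simp: ob_dsm obj_def)
  show "\<forall>(a, b, f)\<in>arrows (dsm_cat n). covers (fobj P a) (fobj P b) (fmor P (a, b, f)) f"
  proof (intro ballI, clarify)
    fix a and b and f assume "(a, b, f) \<in> arrows (dsm_cat n)"
    then show "covers (fobj P a) (fobj P b) (fmor P (a, b, f)) f"
      by (rule arrows_dsmE) (use assms(4) in \<open>auto simp: mor_def\<close>)
  qed
  show "\<forall>a b c f g. (a, b, f) \<in> arrows (dsm_cat n) \<longrightarrow> (b, c, g) \<in> arrows (dsm_cat n) \<longrightarrow>
        fmor P (a, c, cat_comp (dsm_cat n) a b c g f) =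
        cat_comp (bundle_cat G) (fobj P a) (fobj P b) (fobj P c) (fmor P (b, c, g)) (fmor P (a, b, f))"
  proof (intro allI impI)
    fix a b c f g assume ab: "(a, b, f) \<in> arrows (dsm_cat n)" and bc: "(b, c, g) \<in> arrows (dsm_cat n)"
    from bc obtain d2 \<tau>2 d3 \<tau>3 where 2: "b = obj d2 \<tau>2" "c = obj d3 \<tau>3" "\<tau>2 \<in> smooth_maps d2 n" "\<tau>3 \<in> smooth_maps d3 n"
      "g \<in> smooth_maps d2 d3" "scomp d2 \<tau>3 g = \<tau>2" by (rule arrows_dsmE)
    from ab obtain d1 \<tau>1 d2' \<tau>2' where 1: "a = obj d1 \<tau>1" "b = obj d2' \<tau>2'" "\<tau>1 \<in> smooth_maps d1 n" "\<tau>2' \<in> smooth_maps d2' n"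
      "f \<in> smooth_maps d1 d2'" "scomp d1 \<tau>2' f = \<tau>1" by (rule arrows_dsmE)
    have e: "d2' = d2" "\<tau>2' = \<tau>2"
      using 1(2,4) 2(1,3) fst_obj unobj_obj by metis+
    have "\<tau>1 = scomp d1 \<tau>3 (scomp d1 g f)"
      using 1 2 e scomp_assoc[of f d1 d2 \<tau>3 g] by simp
    then show "fmor P (a, c, cat_comp (dsm_cat n) a b c g f) =
        cat_comp (bundle_cat G) (fobj P a) (fobj P b) (fobj P c) (fmor P (b, c, g)) (fmor P (a, b, f))"
      using assms(6)[OF 2(4) 1(5)[unfolded e] 2(5)] 1(1) 2(1,2,6) by (simp add: mor_def)
  qed
qed

locale simplicial_bundle =
  fixes G :: "('g, 'e::locally_convex_space) lie_group" and n :: nat and P :: "('p, 'g) simplicial_bundle"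
  assumes sb: "is_simplicial_bundle G n P"
begin

abbreviation B :: "nat \<Rightarrow> (point \<Rightarrow> point) \<Rightarrow> ('p, 'g) gbundle" where
  "B d \<tau> \<equiv> fobj P (obj d \<tau>)"

abbreviation M :: "nat \<Rightarrow> nat \<Rightarrow> (point \<Rightarrow> point) \<Rightarrow> (point \<Rightarrow> point) \<Rightarrow> 'p \<Rightarrow> 'p" where
  "M d1 d2 \<tau> f \<equiv> fmor P (mor d1 (scomp d1 \<tau> f) d2 \<tau> f)"

lemma fobj_ext: "fobj P \<in> extensional (ob (dsm_cat n))" and fmor_ext: "fmor P \<in> extensional (arrows (dsm_cat n))"
  using sb by (simp_all add: is_simplicial_bundle_def is_functor_def PiE_def)

lemma bundle_B: "\<tau> \<in> smooth_maps d n \<Longrightarrow> smooth_bundle G (B d \<tau>)"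
  and base_B: "\<tau> \<in> smooth_maps d n \<Longrightarrow> base_dim (B d \<tau>) = d"
proof -
  assume \<tau>: "\<tau> \<in> smooth_maps d n"
  have "fobj P \<in> ob (dsm_cat n) \<rightarrow>\<^sub>E ob (bundle_cat G)"
    using sb by (simp add: is_simplicial_bundle_def is_functor_def)
  from PiE_mem[OF this obj_in_ob[OF \<tau>]] show "smooth_bundle G (B d \<tau>)" by simp
  have b: "\<forall>(d, \<Sigma>)\<in>ob (dsm_cat n). base_dim (fobj P (d, \<Sigma>)) = d"
    using sb by (simp add: is_simplicial_bundle_def)
  from bspec[OF b obj_in_ob[OF \<tau>]] show "base_dim (B d \<tau>) = d" by (simp add: obj_def)
qed

lemma
  assumes "\<tau> \<in> smooth_maps d2 n" "f \<in> smooth_maps d1 d2"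
  shows bundle_map_M: "smooth_bundle_map G (B d1 (scomp d1 \<tau> f)) (B d2 \<tau>) (M d1 d2 \<tau> f)"
    and covers_M: "covers (B d1 (scomp d1 \<tau> f)) (B d2 \<tau>) (M d1 d2 \<tau> f) f"
proof -
  have "\<forall>(a, b, f)\<in>arrows (dsm_cat n). fmor P (a, b, f) \<in> hom_set (bundle_cat G) (fobj P a) (fobj P b)"
    "\<forall>(a, b, f)\<in>arrows (dsm_cat n). covers (fobj P a) (fobj P b) (fmor P (a, b, f)) f"
    using sb by (simp_all add: is_simplicial_bundle_def is_functor_def)
  from this[THEN bspec, OF mor_arrow[OF assms]]
  show "smooth_bundle_map G (B d1 (scomp d1 \<tau> f)) (B d2 \<tau>) (M d1 d2 \<tau> f)"
    "covers (B d1 (scomp d1 \<tau> f)) (B d2 \<tau>) (M d1 d2 \<tau> f) f"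
    by (simp_all add: mor_def)
qed

lemma M_id: 
  assumes "\<tau> \<in> smooth_maps d n"
  shows "fmor P (mor d \<tau> d \<tau> (sid d)) = (\<lambda>p\<in>topspace (total (B d \<tau>)). p)"
proof -
  have "\<forall>a\<in>ob (dsm_cat n). fmor P (a, a, ident (dsm_cat n) a) = ident (bundle_cat G) (fobj P a)"
    using sb by (simp add: is_simplicial_bundle_def is_functor_def)
  from bspec[OF this obj_in_ob[OF assms]] show ?thesis by (simp add: mor_def)
qed

lemma M_comp:
  assumes \<tau>: "\<tau> \<in> smooth_maps d3 n" and f: "f \<in> smooth_maps d1 d2" and g: "g \<in> smooth_maps d2 d3"
  shows "M d1 d3 \<tau> (scomp d1 g f) = compose (topspace (total (B d1 (scomp d1 \<tau> (scomp d1 g f)))))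
     (M d2 d3 \<tau> g) (fmor P (mor d1 (scomp d1 \<tau> (scomp d1 g f)) d2 (scomp d2 \<tau> g) f))"
proof -
  have "\<forall>a b c f g. (a, b, f) \<in> arrows (dsm_cat n) \<longrightarrow> (b, c, g) \<in> arrows (dsm_cat n) \<longrightarrow>
        fmor P (a, c, cat_comp (dsm_cat n) a b c g f) =
        cat_comp (bundle_cat G) (fobj P a) (fobj P b) (fobj P c) (fmor P (b, c, g)) (fmor P (a, b, f))"
    using sb by (simp add: is_simplicial_bundle_def is_functor_def)
  note * = this[rule_format]
  have \<tau>g: "scomp d2 \<tau> g \<in> smooth_maps d2 n" by (rule smooth_maps_scomp[OF g \<tau>])
  show ?thesis
    using *[OF mor_arrow[OF \<tau>g f, unfolded mor_def] mor_arrow[OF \<tau> g, unfolded mor_def]]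
    by (simp add: mor_def scomp_assoc[OF f])
qed

lemma M_comp_apply:
  assumes \<tau>: "\<tau> \<in> smooth_maps d3 n" and f: "f \<in> smooth_maps d1 d2" and g: "g \<in> smooth_maps d2 d3"
    and p: "p \<in> topspace (total (B d1 (scomp d1 \<tau> (scomp d1 g f))))"
  shows "M d1 d3 \<tau> (scomp d1 g f) p = M d2 d3 \<tau> g (M d1 d2 (scomp d2 \<tau> g) f p)"
  using fun_cong[OF M_comp[OF \<tau> f g], of p] p by (simp add: compose_eq scomp_assoc[OF f])

end

section \<open>Strict functoriality of pull-backs\<close>

definition pull :: "nat \<Rightarrow> (point \<Rightarrow> point) \<Rightarrow> ('p, 'g) simplicial_bundle \<Rightarrow> ('p, 'g) simplicial_bundle" where
  "pull m \<alpha> P = bundle_pullback m (induced_smap m \<alpha>) P"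

lemma dsm_functor_simps:
  "\<tau> \<in> smooth_maps d m \<Longrightarrow> fobj (dsm_functor m (induced_smap m \<alpha>)) (obj d \<tau>) = obj d (scomp d \<alpha> \<tau>)"
  "x \<in> arrows (dsm_cat m) \<Longrightarrow> fmor (dsm_functor m (induced_smap m \<alpha>)) x = snd (snd x)"
  using obj_in_ob[of \<tau> d m]
  by (auto simp: dsm_functor_def obj_def smap_comp_induced split: prod.splits)

lemma fobj_pull: "\<tau> \<in> smooth_maps d m \<Longrightarrow> fobj (pull m \<alpha> P) (obj d \<tau>) = fobj P (obj d (scomp d \<alpha> \<tau>))"
  by (simp add: pull_def bundle_pullback_def functor_comp_def dsm_functor_simps)

lemma fmor_pull:
  assumes "\<tau>1 \<in> smooth_maps d1 m" "\<tau>2 \<in> smooth_maps d2 m" "mor d1 \<tau>1 d2 \<tau>2 f \<in> arrows (dsm_cat m)"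
  shows "fmor (pull m \<alpha> P) (mor d1 \<tau>1 d2 \<tau>2 f) = fmor P (mor d1 (scomp d1 \<alpha> \<tau>1) d2 (scomp d2 \<alpha> \<tau>2) f)"
  using assms by (simp add: pull_def bundle_pullback_def functor_comp_def mor_def dsm_functor_simps)

lemma pull_ext: "fobj (pull m \<alpha> P) \<in> extensional (ob (dsm_cat m))" "fmor (pull m \<alpha> P) \<in> extensional (arrows (dsm_cat m))"
  by (simp_all add: pull_def bundle_pullback_def functor_comp_def)

lemma functor_eqI:
  fixes P Q :: "('p, 'g) simplicial_bundle"
  assumes "fobj P \<in> extensional (ob (dsm_cat n))" "fmor P \<in> extensional (arrows (dsm_cat n))"
    "fobj Q \<in> extensional (ob (dsm_cat n))" "fmor Q \<in> extensional (arrows (dsm_cat n))"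
    "\<And>d \<tau>. \<tau> \<in> smooth_maps d n \<Longrightarrow> fobj P (obj d \<tau>) = fobj Q (obj d \<tau>)"
    "\<And>d1 d2 \<tau> f. \<tau> \<in> smooth_maps d2 n \<Longrightarrow> f \<in> smooth_maps d1 d2 \<Longrightarrow>
       fmor P (mor d1 (scomp d1 \<tau> f) d2 \<tau> f) = fmor Q (mor d1 (scomp d1 \<tau> f) d2 \<tau> f)"
  shows "P = Q"
proof -
  have "fobj P = fobj Q"
    by (rule extensionalityI[OF assms(1,3)]) (use assms(5) in \<open>auto simp: ob_dsm\<close>)
  moreover have "fmor P = fmor Q"
  proof (rule extensionalityI[OF assms(2,4)])
    fix x assume x: "x \<in> arrows (dsm_cat n)"
    obtain a b f where abf: "x = (a, b, f)" by (cases x)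
    from x[unfolded abf] show "fmor P x = fmor Q x"
      by (rule arrows_dsmE) (use assms(6) in \<open>auto simp: mor_def abf\<close>)
  qed
  ultimately show ?thesis by simp
qed

lemma is_simplicial_bundle_pull:
  assumes P: "is_simplicial_bundle G n P" and \<alpha>: "\<alpha> \<in> smooth_maps m n"
  shows "is_simplicial_bundle G m (pull m \<alpha> P)"
proof -
  interpret simplicial_bundle G n P by unfold_locales (rule P)
  note sc = smooth_maps_scomp[OF _ \<alpha>]
  have fm: "fmor (pull m \<alpha> P) (mor d1 (scomp d1 \<tau> f) d2 \<tau> f) = fmor P (mor d1 (scomp d1 (scomp d2 \<alpha> \<tau>) f) d2 (scomp d2 \<alpha> \<tau>) f)"
    if "\<tau> \<in> smooth_maps d2 m" "f \<in> smooth_maps d1 d2" for d1 d2 \<tau> f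
    using fmor_pull[OF smooth_maps_scomp[OF that(2,1)] that(1) mor_arrow[OF that]] scomp_assoc[OF that(2), of \<alpha> \<tau>] by simp
  show ?thesis
  proof (rule is_simplicial_bundleI[OF pull_ext])
    show "smooth_bundle G (fobj (pull m \<alpha> P) (obj d \<tau>)) \<and> base_dim (fobj (pull m \<alpha> P) (obj d \<tau>)) = d"
      if "\<tau> \<in> smooth_maps d m" for d \<tau>
      using that by (simp add: fobj_pull bundle_B base_B sc)
  next
    fix d1 d2 \<tau> f assume \<tau>: "\<tau> \<in> smooth_maps d2 m" and f: "f \<in> smooth_maps d1 d2"
    show "smooth_bundle_map G (fobj (pull m \<alpha> P) (obj d1 (scomp d1 \<tau> f))) (fobj (pull m \<alpha> P) (obj d2 \<tau>)) (fmor (pull m \<alpha> P) (mor d1 (scomp d1 \<tau> f) d2 \<tau> f)) \<and>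
        covers (fobj (pull m \<alpha> P) (obj d1 (scomp d1 \<tau> f))) (fobj (pull m \<alpha> P) (obj d2 \<tau>)) (fmor (pull m \<alpha> P) (mor d1 (scomp d1 \<tau> f) d2 \<tau> f)) f"
      using bundle_map_M[OF sc[OF \<tau>] f] covers_M[OF sc[OF \<tau>] f] scomp_assoc[OF f, of \<alpha> \<tau>]
      by (simp add: fm[OF \<tau> f] fobj_pull smooth_maps_scomp[OF f \<tau>] \<tau>)
  next
    fix d \<tau> assume \<tau>: "\<tau> \<in> smooth_maps d m"
    show "fmor (pull m \<alpha> P) (mor d \<tau> d \<tau> (sid d)) = (\<lambda>p\<in>topspace (total (fobj (pull m \<alpha> P) (obj d \<tau>))). p)"
      using fm[OF \<tau> sid_smooth] M_id[OF sc[OF \<tau>]] by (simp add: fobj_pull \<tau> scomp_sid[OF \<tau>] scomp_sid[OF sc[OF \<tau>]])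
  next
    fix d1 d2 d3 \<tau> f g assume \<tau>: "\<tau> \<in> smooth_maps d3 m" and f: "f \<in> smooth_maps d1 d2" and g: "g \<in> smooth_maps d2 d3"
    have gf: "scomp d1 g f \<in> smooth_maps d1 d3" by (rule smooth_maps_scomp[OF f g])
    have \<tau>g: "scomp d2 \<tau> g \<in> smooth_maps d2 m" by (rule smooth_maps_scomp[OF g \<tau>])
    have 1: "scomp d1 \<tau> (scomp d1 g f) = scomp d1 (scomp d2 \<tau> g) f"
      using scomp_assoc[OF f] by simp
    have 2: "scomp d2 \<alpha> (scomp d2 \<tau> g) = scomp d2 (scomp d3 \<alpha> \<tau>) g"
      using scomp_assoc[OF g] by simp
    have 3: "scomp d1 (scomp d3 \<alpha> \<tau>) (scomp d1 g f) = scomp d1 (scomp d2 (scomp d3 \<alpha> \<tau>) g) f"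
      using scomp_assoc[OF f] by simp
    have 4: "scomp d1 \<alpha> (scomp d1 \<tau> (scomp d1 g f)) = scomp d1 (scomp d3 \<alpha> \<tau>) (scomp d1 g f)"
      using scomp_assoc[OF gf] by simp
    show "fmor (pull m \<alpha> P) (mor d1 (scomp d1 \<tau> (scomp d1 g f)) d3 \<tau> (scomp d1 g f)) =
        compose (topspace (total (fobj (pull m \<alpha> P) (obj d1 (scomp d1 \<tau> (scomp d1 g f))))))
          (fmor (pull m \<alpha> P) (mor d2 (scomp d2 \<tau> g) d3 \<tau> g)) (fmor (pull m \<alpha> P) (mor d1 (scomp d1 \<tau> (scomp d1 g f)) d2 (scomp d2 \<tau> g) f))"
      unfolding fm[OF \<tau> gf] fm[OF \<tau> g] fobj_pull[OF smooth_maps_scomp[OF gf \<tau>]] 4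
      unfolding 1 fm[OF \<tau>g f] 2
      using M_comp[OF sc[OF \<tau>] f g] unfolding 3 .
  qed
qed

text \<open>Pulling back relabels objects and leaves the bundles themselves untouched, so
  functoriality holds as an equality, as the axioms of a simplicial set demand.\<close>

lemma pull_pull:
  assumes \<beta>: "\<beta> \<in> smooth_maps l m" and \<alpha>: "\<alpha> \<in> smooth_maps m n"
  shows "pull l \<beta> (pull m \<alpha> P) = pull l (scomp l \<alpha> \<beta>) P"
proof (rule functor_eqI[OF pull_ext pull_ext])
  fix d \<tau> assume \<tau>: "\<tau> \<in> smooth_maps d l"
  show "fobj (pull l \<beta> (pull m \<alpha> P)) (obj d \<tau>) = fobj (pull l (scomp l \<alpha> \<beta>) P) (obj d \<tau>)"
    using smooth_maps_scomp[OF \<tau> \<beta>] scomp_assoc[OF \<tau>] by (simp add: fobj_pull \<tau>)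
next
  fix d1 d2 \<tau> f assume \<tau>: "\<tau> \<in> smooth_maps d2 l" and f: "f \<in> smooth_maps d1 d2"
  have \<tau>f: "scomp d1 \<tau> f \<in> smooth_maps d1 l" by (rule smooth_maps_scomp[OF f \<tau>])
  have b: "scomp d2 \<beta> \<tau> \<in> smooth_maps d2 m" "scomp d1 \<beta> (scomp d1 \<tau> f) \<in> smooth_maps d1 m"
    by (intro smooth_maps_scomp[OF _ \<beta>] \<tau> \<tau>f)+
  have ar: "mor d1 (scomp d1 \<beta> (scomp d1 \<tau> f)) d2 (scomp d2 \<beta> \<tau>) f \<in> arrows (dsm_cat m)"
    using mor_arrow[OF b(1) f] scomp_assoc[OF f] by simp
  show "fmor (pull l \<beta> (pull m \<alpha> P)) (mor d1 (scomp d1 \<tau> f) d2 \<tau> f) =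
       fmor (pull l (scomp l \<alpha> \<beta>) P) (mor d1 (scomp d1 \<tau> f) d2 \<tau> f)"
    unfolding fmor_pull[OF \<tau>f \<tau> mor_arrow[OF \<tau> f]] fmor_pull[OF b(2,1) ar]
    by (simp add: scomp_assoc[OF \<tau>] scomp_assoc[OF \<tau>f])
qed

lemma pull_sid:
  assumes P: "is_simplicial_bundle G n P"
  shows "pull n (sid n) P = P"
proof -
  interpret simplicial_bundle G n P by unfold_locales (rule P)
  show ?thesis
  proof (rule functor_eqI[OF pull_ext fobj_ext fmor_ext])
    fix d \<tau> assume \<tau>: "\<tau> \<in> smooth_maps d n"
    show "fobj (pull n (sid n) P) (obj d \<tau>) = fobj P (obj d \<tau>)"
      by (simp add: fobj_pull \<tau> sid_scomp[OF \<tau>])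
  next
    fix d1 d2 \<tau> f assume \<tau>: "\<tau> \<in> smooth_maps d2 n" and f: "f \<in> smooth_maps d1 d2"
    have \<tau>f: "scomp d1 \<tau> f \<in> smooth_maps d1 n" by (rule smooth_maps_scomp[OF f \<tau>])
    show "fmor (pull n (sid n) P) (mor d1 (scomp d1 \<tau> f) d2 \<tau> f) = fmor P (mor d1 (scomp d1 \<tau> f) d2 \<tau> f)"
      unfolding fmor_pull[OF \<tau>f \<tau> mor_arrow[OF \<tau> f]] by (simp only: sid_scomp[OF \<tau>] sid_scomp[OF \<tau>f])
  qed
qed

section \<open>Universes and extension from facets\<close>

lemma elts_vset:
  assumes "A \<in> range elts"
  shows "elts (vset A) = A"
proof -
  obtain x where x: "elts x = A" using assms by auto
  have "vset A = x"
    unfolding vset_def by (rule the_equality) (use x zf_extensionality in auto)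
  then show ?thesis using x by simp
qed

lemma belongs_toE:
  assumes "belongs_to A U"
  shows "elts (vset A) = A" "vset A \<in> elts U"
proof -
  obtain a where a: "a \<in> elts U" "elts a = A" using assms by (auto simp: belongs_to_def)
  then show "elts (vset A) = A" by (intro elts_vset) auto
  then have "vset A = a" using a(2) by (intro zf_extensionality) simp
  then show "vset A \<in> elts U" using a(1) by simp
qed

context
  fixes U :: "'v::zf_sets"
  assumes U: "grothendieck_universe U"
begin

lemma universe_elements: "belongs_to A U \<Longrightarrow> A \<subseteq> elts U"
  using U belongs_toE[of A U] unfolding grothendieck_universe_def by metis

lemma universe_Pow:
  assumes "belongs_to A U" shows "belongs_to {y. elts y \<subseteq> A} U"
  using U belongs_toE[OF assms] unfolding grothendieck_universe_def by metis

lemma universe_subset: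
  assumes A: "belongs_to A U" and B: "B \<subseteq> A"
  shows "belongs_to B U"
proof -
  have "B \<in> range elts" using zf_separation[of B "vset A"] belongs_toE(1)[OF A] B by simp
  then have "elts (vset B) = B" by (rule elts_vset)
  moreover from this have "vset B \<in> elts U" using universe_elements[OF universe_Pow[OF A]] B by auto
  ultimately show ?thesis by (auto simp: belongs_to_def)
qed

lemma universe_doubleton: "x \<in> elts U \<Longrightarrow> y \<in> elts U \<Longrightarrow> belongs_to {x, y} U"
  using U by (simp add: grothendieck_universe_def)

lemma universe_singleton: "x \<in> elts U \<Longrightarrow> belongs_to {x} U"
  using universe_doubleton[of x x] by simp

lemma universe_vpair: "x \<in> elts U \<Longrightarrow> y \<in> elts U \<Longrightarrow> vpair x y \<in> elts U"
  unfolding vpair_def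
  by (intro belongs_toE(2) universe_doubleton universe_singleton)

lemma universe_UN:
  assumes A: "belongs_to A U" and f: "\<And>x. x \<in> A \<Longrightarrow> belongs_to (f x) U"
  shows "belongs_to (\<Union>x\<in>A. f x) U"
proof -
  have U4: "\<forall>I\<in>elts U. \<forall>f. f ` elts I \<subseteq> elts U \<longrightarrow> belongs_to (\<Union>i\<in>elts I. elts (f i)) U"
    using U by (simp add: grothendieck_universe_def)
  have "(\<lambda>x. vset (f x)) ` elts (vset A) \<subseteq> elts U"
    using belongs_toE(1)[OF A] belongs_toE(2)[OF f] by auto
  from U4[rule_format, OF belongs_toE(2)[OF A] this]
  have "belongs_to (\<Union>i\<in>elts (vset A). elts ((\<lambda>x. vset (f x)) i)) U" .
  moreover have "(\<Union>i\<in>elts (vset A). elts ((\<lambda>x. vset (f x)) i)) = (\<Union>x\<in>A. f x)"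
    using belongs_toE(1)[OF A] belongs_toE(1)[OF f] by auto
  ultimately show ?thesis by simp
qed

lemma universe_product:
  assumes "belongs_to A U" "belongs_to B U"
  shows "belongs_to (\<Union>x\<in>A. \<Union>y\<in>B. {vpair x y}) U"
  using assms universe_elements[OF assms(1)] universe_elements[OF assms(2)]
  by (intro universe_UN universe_singleton universe_vpair) auto

end

text \<open>Each graph is a subset of a product of two members of the universe, so the set of all
  graphs is a subset of a power set. This settles the smallness condition on the simplices of the
  base once and for all.\<close>

lemma universe_vgraphs:
  fixes U :: "'v::zf_sets"
  assumes "admissible_universe G U"
  shows "belongs_to (vgraph k n ` smooth_maps k n) U"
proof -
  have U: "grothendieck_universe U" and v: "\<And>n. belongs_to (vpoint n ` geom_simplex n) U"
    using assms by (auto simp: admissible_universe_def)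
  define C :: "'v set" where "C = (\<Union>x\<in>vpoint k ` geom_simplex k. \<Union>y\<in>vpoint n ` geom_simplex n. {vpair x y})"
  have C: "belongs_to C U" unfolding C_def by (rule universe_product[OF U v v])
  have "elts (vgraph k n \<sigma> :: 'v) \<subseteq> C" if "\<sigma> \<in> smooth_maps k n" for \<sigma>
  proof -
    have s: "(\<lambda>x. vpair (vpoint k x) (vpoint n (\<sigma> x)) :: 'v) ` geom_simplex k \<subseteq> C"
      using smooth_maps_in[OF that] by (auto simp: C_def)
    from belongs_toE(1)[OF universe_subset[OF U C s]] s show ?thesis by (simp only: vgraph_def)
  qed
  then show ?thesis by (intro universe_subset[OF U universe_Pow[OF U C]]) auto
qed

section \<open>The simplicial set of small bundles\<close>

lemma simplices_BG: "simplices (BG G U) n = {P. is_simplicial_bundle G n P \<and> small_simplicial_bundle U n P}"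
  and struct_map_BG: "struct_map (BG G U) m n i P = pull m (affine_simplex_map m i) P"
  by (simp_all add: BG_def pull_def)

lemma small_iff:
  assumes "admissible_universe G U"
  shows "small_simplicial_bundle U n P \<longleftrightarrow> (\<forall>d. \<forall>\<tau>\<in>smooth_maps d n. belongs_to (topspace (total (fobj P (obj d \<tau>)))) U)"
proof -
  have "(\<forall>a\<in>ob (dsm_cat n). Q a) \<longleftrightarrow> (\<forall>d. \<forall>\<tau>\<in>smooth_maps d n. Q (obj d \<tau>))" for Q
    unfolding ob_dsm by blast
  then show ?thesis
    using universe_vgraphs[OF assms] by (simp add: small_simplicial_bundle_def)
qed

lemma pull_in_BG:
  assumes U: "admissible_universe G U" and P: "P \<in> simplices (BG G U) n" and \<alpha>: "\<alpha> \<in> smooth_maps m n"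
  shows "pull m \<alpha> P \<in> simplices (BG G U) m"
  using P is_simplicial_bundle_pull[OF _ \<alpha>] smooth_maps_scomp[OF _ \<alpha>]
  by (auto simp: simplices_BG small_iff[OF U] fobj_pull)

lemma simplicial_set_BG:
  assumes U: "admissible_universe G U"
  shows "simplicial_set (BG G U)"
  unfolding simplicial_set_def struct_map_BG
proof (intro conjI allI ballI)
  show "pull m (affine_simplex_map m i) \<in> simplices (BG G U) n \<rightarrow> simplices (BG G U) m" if "i \<in> delta_hom m n" for m n i
    using pull_in_BG[OF U _ affine_smooth] delta_hom_le[OF that] by auto
  show "pull n (affine_simplex_map n (\<lambda>a\<in>{..n}. a)) P = P" if "P \<in> simplices (BG G U) n" for n P
  proof -
    have "is_simplicial_bundle G n P" using that by (simp add: simplices_BG)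
    from pull_sid[OF this] show ?thesis by (simp add: affine_id)
  qed
  fix l m n i j P assume i: "i \<in> delta_hom l m" and j: "j \<in> delta_hom m n"
  have "scomp l (affine_simplex_map m j) (affine_simplex_map l i) = affine_simplex_map l (compose {..l} j i)"
    by (rule affine_comp) (use delta_hom_le[OF i] delta_hom_le[OF j] in \<open>auto simp: compose_eq\<close>)
  then show "pull l (affine_simplex_map l (compose {..l} j i)) P =
      pull l (affine_simplex_map l i) (pull m (affine_simplex_map m j) P)"
    by (simp add: pull_pull[OF affine_smooth[of l i m, OF delta_hom_le[OF i]] affine_smooth[of m j n, OF delta_hom_le[OF j]]])
qed

lemma (in two_bundles) dv_bundle_map:
  assumes F: "smooth_bundle_map G P Q F" and f: "covers P Q F f" and p: "p \<in> P.T" "q \<in> P.T" "proj P p = proj P q"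
  shows "Q.dv (F p) (F q) = P.dv p q"
proof -
  note dv = P.dv_props[OF p]
  have "F q = act Q (F p, P.dv p q)" using bundle_map_props(3)[OF F p(1) dv(1)] dv(2) by simp
  then show ?thesis using Q.dv_act[OF bundle_map_props(2)[OF F p(1)] dv(1)] by simp
qed

section \<open>Points and facets of a simplex\<close>

definition origin :: point where "origin = (\<lambda>_. 0)"

text \<open>The 0-simplex at \<open>y\<close>. Evaluation at such simplices turns data indexed by
  simplices into functions of points.\<close>

definition pt :: "point \<Rightarrow> point \<Rightarrow> point" where "pt y = (\<lambda>_\<in>geom_simplex 0. y)"

lemma origin_in: "origin \<in> geom_simplex 0"
  by (simp add: origin_def geom_simplex_def topspace_Euclidean_space)

lemma pt_smooth: "y \<in> geom_simplex n \<Longrightarrow> pt y \<in> smooth_maps 0 n"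
  by (rule smooth_maps_affine[OF linear_zero continuous_on_const, where c = y])
     (use geom_simplex_euc in \<open>auto simp: pt_def\<close>)

lemma pt_origin [simp]: "pt y origin = y"
  by (simp add: pt_def origin_in)

lemma scomp_pt: "scomp 0 \<tau> (pt x) = pt (\<tau> x)"
  by (auto simp: pt_def compose_def)

text \<open>Simplices in the facet opposite to vertex \<open>j\<close>, described by a condition on
  their points instead of a factorization through a simplex of lower dimension.\<close>

definition face :: "nat \<Rightarrow> nat \<Rightarrow> nat \<Rightarrow> (point \<Rightarrow> point) \<Rightarrow> bool" where
  "face n j d \<tau> \<longleftrightarrow> \<tau> \<in> smooth_maps d n \<and> (\<forall>x\<in>geom_simplex d. barycentric n (\<tau> x) j = 0)"

lemma face_smooth: "face n j d \<tau> \<Longrightarrow> \<tau> \<in> smooth_maps d n"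
  by (simp add: face_def)

lemma face_scomp: "face n j d2 \<tau> \<Longrightarrow> f \<in> smooth_maps d1 d2 \<Longrightarrow> face n j d1 (scomp d1 \<tau> f)"
  by (auto simp: face_def smooth_maps_scomp scomp_apply smooth_maps_in)

lemma face_pt: "y \<in> geom_simplex n \<Longrightarrow> barycentric n y j = 0 \<Longrightarrow> face n j 0 (pt y)"
  by (auto simp: face_def pt_smooth) (simp add: pt_def)

text \<open>The function is extended from one facet at a time by means of the linear retraction that moves
  the barycentric weight of \<open>l\<close> onto \<open>k\<close>; it preserves all facets through \<open>k\<close>.\<close>

lemma (in lie_grp) extend_from_faces:
  assumes k: "k \<le> n" and j: "j \<le> n" "j \<noteq> k" and I: "finite I" "\<And>i. i \<in> I \<Longrightarrow> i \<le> n \<and> i \<noteq> k \<and> i \<noteq> j"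
    and a: "\<And>i d \<tau>. i \<in> I \<Longrightarrow> face n i d \<tau> \<Longrightarrow> face n j d \<tau> \<Longrightarrow> ext d (geom_simplex d) (\<lambda>x. a (\<tau> x))"
  shows "\<exists>b. (\<forall>d \<tau>. face n j d \<tau> \<longrightarrow> ext d (geom_simplex d) (\<lambda>x. b (\<tau> x))) \<and>
    (\<forall>i\<in>I. \<forall>y\<in>geom_simplex n. barycentric n y i = 0 \<longrightarrow> barycentric n y j = 0 \<longrightarrow> b y = a y)"
  using I a
proof (induction I rule: finite_induct)
  case empty
  have "ext d (geom_simplex d) (\<lambda>x. \<one>)" for d
    by (rule ext_const[OF one_closed geom_simplex_euc])
  then show ?case by (intro exI[of _ "\<lambda>_. \<one>"]) auto
next
  case (insert l I)
  have "\<exists>b. (\<forall>d \<tau>. face n j d \<tau> \<longrightarrow> ext d (geom_simplex d) (\<lambda>x. b (\<tau> x))) \<and>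
    (\<forall>i\<in>I. \<forall>y\<in>geom_simplex n. barycentric n y i = 0 \<longrightarrow> barycentric n y j = 0 \<longrightarrow> b y = a y)"
    by (rule insert.IH) (use insert.prems in auto)
  then obtain e where e: "\<And>d \<tau>. face n j d \<tau> \<Longrightarrow> ext d (geom_simplex d) (\<lambda>x. e (\<tau> x))"
    "\<And>i y. i \<in> I \<Longrightarrow> y \<in> geom_simplex n \<Longrightarrow> barycentric n y i = 0 \<Longrightarrow> barycentric n y j = 0 \<Longrightarrow> e y = a y"
    by blast
  have l: "l \<le> n" "l \<noteq> k" "l \<noteq> j" using insert.prems by auto
  define \<rho> where "\<rho> c = (if c = l then k else c)" for c
  define r where "r = affine_simplex_map n \<rho>"
  have \<rho>n: "\<rho> c \<le> n" if "c \<le> n" for c using that k by (simp add: \<rho>_def)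
  have r: "r \<in> smooth_maps n n" unfolding r_def by (rule affine_smooth[of n \<rho> n, OF \<rho>n])
  have bl: "barycentric n (r y) l = 0" if "y \<in> geom_simplex n" for y
  proof -
    have empty: "{c. c \<le> n \<and> \<rho> c = l} = {}" using l by (auto simp: \<rho>_def)
    have "barycentric n (affine_simplex_map n \<rho> y) l = (\<Sum>c | c \<le> n \<and> \<rho> c = l. barycentric n y c)"
      by (rule barycentric_affine_simplex_map[OF \<rho>n l(1) that])
    then show ?thesis by (simp only: r_def empty sum.empty)
  qed
  have bi: "barycentric n (r y) i = barycentric n y i" if "y \<in> geom_simplex n" "i \<le> n" "i \<noteq> k" "i \<noteq> l" for y i
  proof -
    have single: "{c. c \<le> n \<and> \<rho> c = i} = {i}" using that by (auto simp: \<rho>_def)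
    have "barycentric n (affine_simplex_map n \<rho> y) i = (\<Sum>c | c \<le> n \<and> \<rho> c = i. barycentric n y c)"
      by (rule barycentric_affine_simplex_map[OF \<rho>n that(2,1)])
    then show ?thesis by (simp add: r_def single)
  qed
  have rfix: "r y = y" if "y \<in> geom_simplex n" "barycentric n y l = 0" for y
    unfolding r_def by (rule affine_fix[of n \<rho>, OF \<rho>n that(1)]) (use that(2) in \<open>auto simp: \<rho>_def\<close>)
  have carr: "e y \<in> carr" if "y \<in> geom_simplex n" "barycentric n y j = 0" for y
    using ext_in[OF e(1)[OF face_pt[OF that]] origin_in] by simp
  have acarr: "a y \<in> carr" if "y \<in> geom_simplex n" "barycentric n y j = 0" "i \<in> insert l I" "barycentric n y i = 0" for y i
    using ext_in[OF insert.prems(2)[OF that(3) face_pt[OF that(1,4)] face_pt[OF that(1,2)]] origin_in] by simp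
  \<comment> \<open>\<open>b\<close> corrects \<open>e\<close> by its error on the facet opposite to
    \<open>l\<close>, extended along \<open>r\<close>. On that facet the error disappears because
    \<open>r\<close> fixes it. On an earlier facet nothing changes: \<open>r\<close> maps it to
    itself and \<open>e\<close> agrees with \<open>a\<close> there.\<close>
  define b where "b y = e y \<otimes> (inv (e (r y)) \<otimes> a (r y))" for y
  show ?case
  proof (intro exI[of _ b] conjI allI impI ballI)
    fix d \<tau> assume \<tau>: "face n j d \<tau>"
    have \<tau>s: "\<tau> \<in> smooth_maps d n" by (rule face_smooth[OF \<tau>])
    have rj: "face n j d (scomp d r \<tau>)" and rl: "face n l d (scomp d r \<tau>)"
      using \<tau> j l bl bi smooth_maps_scomp[OF \<tau>s r] smooth_maps_in[OF \<tau>s] by (auto simp: face_def scomp_apply)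
    have "ext d (geom_simplex d) (\<lambda>x. e (\<tau> x) \<otimes> (inv (e (scomp d r \<tau> x)) \<otimes> a (scomp d r \<tau> x)))"
      by (intro ext_mult ext_inv e(1) \<tau> rj insert.prems(2)[OF _ rl rj]) simp
    then show "ext d (geom_simplex d) (\<lambda>x. b (\<tau> x))"
      by (rule ext_cong) (simp add: b_def scomp_apply)
  next
    fix i y assume i: "i \<in> insert l I" and y: "y \<in> geom_simplex n" "barycentric n y i = 0" "barycentric n y j = 0"
    have ry: "r y \<in> geom_simplex n" by (rule smooth_maps_in[OF r y(1)])
    show "b y = a y"
    proof (cases "i = l")
      case True
      then have "r y = y" using rfix y by simp
      then show ?thesis
        using carr[OF y(1,3)] acarr[OF y(1,3) i y(2)] by (simp add: b_def m_assoc[symmetric])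
    next
      case False
      then have iI: "i \<in> I" using i by simp
      then have "i \<le> n" "i \<noteq> k" using insert.prems(1) by auto
      then have "barycentric n (r y) i = 0" "barycentric n (r y) j = 0"
        using bi[OF y(1)] y j l False by auto
      then have "e (r y) = a (r y)" "a (r y) \<in> carr"
        using e(2)[OF iI ry] acarr[OF ry _ i] by auto
      then show ?thesis using e(2)[OF iI y] acarr[OF y(1,3) i y(2)] by (simp add: b_def)
    qed
  qed
qed

section \<open>Horn fillers\<close>

locale horn_filling =
  fixes G :: "('v::zf_sets, 'e::locally_convex_space) lie_group" and U :: 'v
    and n k :: nat and h :: "nat \<Rightarrow> (nat \<Rightarrow> nat) \<Rightarrow> ('v, 'v) simplicial_bundle"
  assumes lie: "locally_convex_lie_group G" and adm: "admissible_universe G U"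
    and n: "1 \<le> n" and k: "k \<le> n" and h: "simplicial_map (horn_sset n k) (BG G U) h"
begin

sublocale lie_grp G
  using lie by (simp add: lie_grp_def lie_grp_axioms_def locally_convex_lie_group_def)

lemma lie_bundleI: "smooth_bundle G P \<Longrightarrow> lie_bundle G P"
  by unfold_locales

lemma two_bundlesI: "smooth_bundle G P \<Longrightarrow> smooth_bundle G Q \<Longrightarrow> two_bundles G P Q"
  by (simp add: two_bundles_def lie_bundleI)

definition idx :: "nat \<Rightarrow> bool" where "idx j \<longleftrightarrow> j \<le> n \<and> j \<noteq> k"

text \<open>The monotone idempotent of \<open>{..n}\<close> that moves each point of \<open>A\<close> towards \<open>k\<close> until it leaves \<open>A\<close>.\<close>

definition squash :: "nat set \<Rightarrow> nat \<Rightarrow> nat" where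
  "squash A = (\<lambda>a\<in>{..n}. if k \<le> a then Max {b. k \<le> b \<and> b \<le> a \<and> b \<notin> A} else Min {b. a \<le> b \<and> b \<le> k \<and> b \<notin> A})"

context
  fixes A assumes kA: "k \<notin> A"
begin

lemma squash_upper: "k \<le> a \<Longrightarrow> finite {b. k \<le> b \<and> b \<le> a \<and> b \<notin> A} \<and> k \<in> {b. k \<le> b \<and> b \<le> a \<and> b \<notin> A}"
  and squash_lower: "a \<le> k \<Longrightarrow> finite {b. a \<le> b \<and> b \<le> k \<and> b \<notin> A} \<and> k \<in> {b. a \<le> b \<and> b \<le> k \<and> b \<notin> A}"
  using kA by auto

lemma squash_cases:
  assumes "a \<le> n"
  shows "squash A a \<notin> A \<and> (k \<le> a \<longrightarrow> k \<le> squash A a \<and> squash A a \<le> a) \<and> (a \<le> k \<longrightarrow> a \<le> squash A a \<and> squash A a \<le> k)"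
proof (cases "k \<le> a")
  case True
  have "Max {b. k \<le> b \<and> b \<le> a \<and> b \<notin> A} \<in> {b. k \<le> b \<and> b \<le> a \<and> b \<notin> A}"
    using squash_upper[OF True] by (intro Max_in) auto
  then show ?thesis using True assms by (auto simp: squash_def)
next
  case False
  have "Min {b. a \<le> b \<and> b \<le> k \<and> b \<notin> A} \<in> {b. a \<le> b \<and> b \<le> k \<and> b \<notin> A}"
    using squash_lower[of a] False by (intro Min_in) auto
  then show ?thesis using False assms by (auto simp: squash_def)
qed

lemma squash_le: "a \<le> n \<Longrightarrow> squash A a \<le> n"
  using squash_cases[of a] k by (cases "k \<le> a") auto

lemma squash_fix:
  assumes "a \<le> n" "a \<notin> A" shows "squash A a = a"
proof (cases "k \<le> a")
  case True
  have "Max {b. k \<le> b \<and> b \<le> a \<and> b \<notin> A} = a"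
    by (rule Max_eqI) (use True assms squash_upper[OF True] in auto)
  then show ?thesis using True assms by (simp add: squash_def)
next
  case False
  have "Min {b. a \<le> b \<and> b \<le> k \<and> b \<notin> A} = a"
    by (rule Min_eqI) (use False assms squash_lower[of a] in auto)
  then show ?thesis using False assms by (simp add: squash_def)
qed

lemma squash_hom: "squash A \<in> delta_hom n n"
  unfolding delta_hom_def
proof (intro CollectI conjI)
  show "squash A \<in> {..n} \<rightarrow>\<^sub>E {..n}"
    using squash_le by (auto simp: squash_def[of A] PiE_def)
  show "mono_on {..n} (squash A)"
  proof (rule mono_onI)
    fix a a' assume a: "a \<in> {..n}" "a' \<in> {..n}" "a \<le> a'"
    consider "k \<le> a" | "a < k" "k \<le> a'" | "a' < k" using a by linarith
    then show "squash A a \<le> squash A a'"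
    proof cases
      case 1
      have "Max {b. k \<le> b \<and> b \<le> a \<and> b \<notin> A} \<le> Max {b. k \<le> b \<and> b \<le> a' \<and> b \<notin> A}"
        by (rule Max_mono) (use a squash_upper[OF 1] squash_upper[of a'] 1 in auto)
      then show ?thesis using 1 a by (simp add: squash_def)
    next
      case 2
      then show ?thesis using squash_cases[of a] squash_cases[of a'] a by force
    next
      case 3
      have "Min {b. a \<le> b \<and> b \<le> k \<and> b \<notin> A} \<le> Min {b. a' \<le> b \<and> b \<le> k \<and> b \<notin> A}"
        by (rule Min_antimono) (use a squash_lower[of a] squash_lower[of a'] 3 in auto)
      then show ?thesis using 3 a by (simp add: squash_def)
    qed
  qed
qed

lemma squash_horn: "j \<in> A \<Longrightarrow> j \<le> n \<Longrightarrow> squash A \<in> simplices (horn_sset n k) n"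
  using squash_hom squash_cases kA by (auto simp: horn_sset_def intro!: exI[of _ j])

lemma squash_absorb:
  assumes f: "f \<in> delta_hom m n" "f ` {..m} \<inter> A = {}"
  shows "compose {..m} (squash A) f = f"
proof (rule extensionalityI[of _ "{..m}"])
  show "f \<in> extensional {..m}" using f by (simp add: delta_hom_def PiE_def)
  show "compose {..m} (squash A) f a = f a" if "a \<in> {..m}" for a
    using that squash_fix[of "f a"] delta_hom_le[OF f(1)] f(2) by (auto simp: compose_eq)
qed simp

lemma squash_fix_point:
  assumes "y \<in> geom_simplex n" "\<And>a. a \<in> A \<Longrightarrow> a \<le> n \<Longrightarrow> barycentric n y a = 0"
  shows "affine_simplex_map n (squash A) y = y"
  by (rule affine_fix) (use assms squash_le squash_fix in auto)

end

text \<open>The datum of the horn on the facet opposite to \<open>j\<close>, taken at the degenerate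
  \<open>n\<close>-simplex \<open>squash {j}\<close>. All facets thereby contribute bundles over the
  same simplex, without reindexing by coface maps.\<close>

definition H :: "nat \<Rightarrow> ('v, 'v) simplicial_bundle" where "H j = h n (squash {j})"

lemma h_in: "f \<in> simplices (horn_sset n k) m \<Longrightarrow> h m f \<in> simplices (BG G U) m"
  using h by (auto simp: simplicial_map_def)

lemma h_comp:
  assumes "i \<in> delta_hom l m" "f \<in> simplices (horn_sset n k) m"
  shows "h l (compose {..l} f i) = pull l (affine_simplex_map l i) (h m f)"
  using h assms by (auto simp: simplicial_map_def struct_map_BG horn_sset_def)

lemma H_in: "idx j \<Longrightarrow> H j \<in> simplices (BG G U) n"
  unfolding H_def by (rule h_in[OF squash_horn]) (auto simp: idx_def)

lemma H_bundle: "idx j \<Longrightarrow> is_simplicial_bundle G n (H j)"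
  using H_in by (simp add: simplices_BG)

text \<open>A map that misses \<open>j\<close> is unchanged by \<open>squash {j}\<close>, hence
  factors through it, and naturality of \<open>h\<close> applies.\<close>

lemma h_eq_pull:
  assumes j: "idx j" and f: "f \<in> delta_hom m n" "j \<notin> f ` {..m}"
  shows "h m f = pull m (affine_simplex_map m f) (H j)"
proof -
  have kj: "k \<notin> {j}" using j by (auto simp: idx_def)
  have "h m (compose {..m} (squash {j}) f) = pull m (affine_simplex_map m f) (h n (squash {j}))"
    by (rule h_comp[OF f(1) squash_horn[OF kj]]) (use j in \<open>auto simp: idx_def\<close>)
  then show ?thesis using squash_absorb[OF kj f(1)] f(2) by (simp add: H_def)
qed

lemma pull_fix:
  assumes \<alpha>: "\<And>y. y \<in> \<tau> ` geom_simplex d2 \<Longrightarrow> \<alpha> y = y" and \<tau>: "\<tau> \<in> smooth_maps d2 n"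
  shows "fobj (pull n \<alpha> P) (obj d2 \<tau>) = fobj P (obj d2 \<tau>)"
    and "f \<in> smooth_maps d1 d2 \<Longrightarrow>
      fmor (pull n \<alpha> P) (mor d1 (scomp d1 \<tau> f) d2 \<tau> f) = fmor P (mor d1 (scomp d1 \<tau> f) d2 \<tau> f)"
proof -
  have 1: "scomp d2 \<alpha> \<tau> = \<tau>"
    by (rule extensionalityI[of _ "geom_simplex d2"]) (use \<alpha> \<tau> in \<open>auto simp: compose_eq smooth_maps_ext\<close>)
  then show "fobj (pull n \<alpha> P) (obj d2 \<tau>) = fobj P (obj d2 \<tau>)" by (simp add: fobj_pull[OF \<tau>])
  assume f: "f \<in> smooth_maps d1 d2"
  have "scomp d1 \<alpha> (scomp d1 \<tau> f) = scomp d1 \<tau> f"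
    using scomp_assoc[OF f, of \<alpha> \<tau>] 1 by simp
  then show "fmor (pull n \<alpha> P) (mor d1 (scomp d1 \<tau> f) d2 \<tau> f) = fmor P (mor d1 (scomp d1 \<tau> f) d2 \<tau> f)"
    using 1 by (simp add: fmor_pull[OF smooth_maps_scomp[OF f \<tau>] \<tau> mor_arrow[OF \<tau> f]])
qed

abbreviation B where "B j d \<tau> \<equiv> fobj (H j) (obj d \<tau>)"
abbreviation M where "M j d1 d2 \<tau> f \<equiv> fmor (H j) (mor d1 (scomp d1 \<tau> f) d2 \<tau> f)"
abbreviation tot where "tot P \<equiv> topspace (total P)"

text \<open>Pulled back along \<open>squash {i, j}\<close>, both simplicial bundles become the value
  of \<open>h\<close> there, because this simplex of the horn misses \<open>i\<close> and
  \<open>j\<close>. A simplex \<open>\<tau>\<close> in both facets is fixed by that retraction, so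
  the pull-back does not alter the data at \<open>\<tau>\<close>.\<close>

lemma overlap:
  assumes i: "idx i" and j: "idx j" and \<tau>i: "face n i d2 \<tau>" and \<tau>j: "face n j d2 \<tau>"
  shows "B i d2 \<tau> = B j d2 \<tau>" and "f \<in> smooth_maps d1 d2 \<Longrightarrow> M i d1 d2 \<tau> f = M j d1 d2 \<tau> f"
proof -
  have kA: "k \<notin> {i, j}" using i j by (auto simp: idx_def)
  note \<tau> = face_smooth[OF \<tau>i]
  have fix_\<tau>: "affine_simplex_map n (squash {i, j}) y = y" if "y \<in> \<tau> ` geom_simplex d2" for y
    by (rule squash_fix_point[OF kA]) (use that \<tau>i \<tau>j smooth_maps_in[OF \<tau>] in \<open>auto simp: face_def\<close>)
  have img: "l \<notin> squash {i, j} ` {..n}" if "l \<in> {i, j}" for l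
    using squash_cases[OF kA] that by auto
  have 1: "h n (squash {i, j}) = pull n (affine_simplex_map n (squash {i, j})) (H l)" if "l \<in> {i, j}" for l
    by (rule h_eq_pull[OF _ squash_hom[OF kA] img[OF that]]) (use that i j in auto)
  show "B i d2 \<tau> = B j d2 \<tau>"
    using pull_fix(1)[OF fix_\<tau> \<tau>, of "H i"] pull_fix(1)[OF fix_\<tau> \<tau>, of "H j"] 1[of i] 1[of j] by simp
  assume f: "f \<in> smooth_maps d1 d2"
  show "M i d1 d2 \<tau> f = M j d1 d2 \<tau> f"
    using pull_fix(2)[OF fix_\<tau> \<tau> f, of "H i"] pull_fix(2)[OF fix_\<tau> \<tau> f, of "H j"] 1[of i] 1[of j] by simp
qed

text \<open>A section of \<open>H j\<close> over a facet, natural in all simplices of the facet. The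
  family carries no index \<open>j\<close>, so that one family can serve several facets; this is
  consistent because their bundles coincide on overlaps.\<close>

definition section_family :: "nat \<Rightarrow> (nat \<Rightarrow> (point \<Rightarrow> point) \<Rightarrow> point \<Rightarrow> 'v) \<Rightarrow> bool" where
  "section_family j s \<longleftrightarrow> (\<forall>d \<tau>. face n j d \<tau> \<longrightarrow> lie_bundle.sec G (B j d \<tau>) (geom_simplex d) (s d \<tau>)) \<and>
     (\<forall>d1 d2 \<tau> f x. face n j d2 \<tau> \<longrightarrow> f \<in> smooth_maps d1 d2 \<longrightarrow> x \<in> geom_simplex d1 \<longrightarrow>
        M j d1 d2 \<tau> f (s d1 (scomp d1 \<tau> f) x) = s d2 \<tau> (f x))"

lemma section_familyD:
  assumes "section_family j s"
  shows "face n j d \<tau> \<Longrightarrow> lie_bundle.sec G (B j d \<tau>) (geom_simplex d) (s d \<tau>)"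
    and "face n j d2 \<tau> \<Longrightarrow> f \<in> smooth_maps d1 d2 \<Longrightarrow> x \<in> geom_simplex d1 \<Longrightarrow>
        M j d1 d2 \<tau> f (s d1 (scomp d1 \<tau> f) x) = s d2 \<tau> (f x)"
  using assms by (auto simp: section_family_def)

text \<open>\<open>H j\<close> is defined on the full simplex, so a section of its bundle over the
  identity can be pulled back along every simplex. The pull-backs are natural because bundle maps
  are injective on fibres.\<close>

lemma section_family_exists:
  assumes j: "idx j"
  shows "\<exists>s. section_family j s"
proof -
  interpret H: simplicial_bundle G n "H j" by unfold_locales (rule H_bundle[OF j])
  let ?Q = "B j n (sid n)"
  interpret Q: lie_bundle G ?Q by (rule lie_bundleI[OF H.bundle_B[OF sid_smooth]])
  have dQ: "base_dim ?Q = n" by (rule H.base_B[OF sid_smooth])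
  obtain t where t: "Q.sec (geom_simplex n) t" using Q.global_section dQ by auto
  have Mt: "smooth_bundle_map G (B j d \<tau>) ?Q (M j d n (sid n) \<tau>)" "covers (B j d \<tau>) ?Q (M j d n (sid n) \<tau>) \<tau>"
    if "\<tau> \<in> smooth_maps d n" for d \<tau>
    using H.bundle_map_M[OF sid_smooth that] H.covers_M[OF sid_smooth that] sid_scomp[OF that] by simp_all
  have "\<exists>s. lie_bundle.sec G (B j d \<tau>) (geom_simplex d) s \<and> (\<forall>x\<in>geom_simplex d. M j d n (sid n) \<tau> (s x) = t (\<tau> x))"
    if \<tau>: "\<tau> \<in> smooth_maps d n" for d \<tau>
  proof -
    interpret two_bundles G "B j d \<tau>" ?Q
      by (rule two_bundlesI[OF H.bundle_B[OF \<tau>] H.bundle_B[OF sid_smooth]])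
    have dP: "base_dim (B j d \<tau>) = d" by (rule H.base_B[OF \<tau>])
    obtain s where "P.sec (geom_simplex (base_dim (B j d \<tau>))) s" "\<And>x. x \<in> geom_simplex (base_dim (B j d \<tau>)) \<Longrightarrow> M j d n (sid n) \<tau> (s x) = t (\<tau> x)"
      by (rule pullback_section[OF Mt(1)[OF \<tau>] _ Mt(2)[OF \<tau>], of t]) (use \<tau> t dP dQ in auto)
    then show ?thesis using dP by auto
  qed
  note ex = this
  define s where "s d \<tau> = (SOME s. lie_bundle.sec G (B j d \<tau>) (geom_simplex d) s \<and>
      (\<forall>x\<in>geom_simplex d. M j d n (sid n) \<tau> (s x) = t (\<tau> x)))" for d \<tau>
  have s: "lie_bundle.sec G (B j d \<tau>) (geom_simplex d) (s d \<tau>)"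
    "\<And>x. x \<in> geom_simplex d \<Longrightarrow> M j d n (sid n) \<tau> (s d \<tau> x) = t (\<tau> x)" if "\<tau> \<in> smooth_maps d n" for d \<tau>
    using someI_ex[OF ex[OF that], folded s_def] by blast+
  have "M j d1 d2 \<tau> f (s d1 (scomp d1 \<tau> f) x) = s d2 \<tau> (f x)"
    if \<tau>: "\<tau> \<in> smooth_maps d2 n" and f: "f \<in> smooth_maps d1 d2" and x: "x \<in> geom_simplex d1" for d1 d2 \<tau> f x
  proof -
    have \<tau>f: "scomp d1 \<tau> f \<in> smooth_maps d1 n" by (rule smooth_maps_scomp[OF f \<tau>])
    interpret T: two_bundles G "B j d2 \<tau>" ?Q
      by (rule two_bundlesI[OF H.bundle_B[OF \<tau>] H.bundle_B[OF sid_smooth]])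
    interpret S: two_bundles G "B j d1 (scomp d1 \<tau> f)" "B j d2 \<tau>"
      by (rule two_bundlesI[OF H.bundle_B[OF \<tau>f] H.bundle_B[OF \<tau>]])
    have fx: "f x \<in> geom_simplex d2" by (rule smooth_maps_in[OF f x])
    have s1: "s d1 (scomp d1 \<tau> f) x \<in> S.P.T" "proj (B j d1 (scomp d1 \<tau> f)) (s d1 (scomp d1 \<tau> f) x) = x"
      using S.P.secD(2,3)[OF s(1)[OF \<tau>f] x] .
    have s2: "s d2 \<tau> (f x) \<in> T.P.T" "proj (B j d2 \<tau>) (s d2 \<tau> (f x)) = f x"
      using T.P.secD(2,3)[OF s(1)[OF \<tau>] fx] .
    have Ms: "M j d1 d2 \<tau> f (s d1 (scomp d1 \<tau> f) x) \<in> T.P.T"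
      "proj (B j d2 \<tau>) (M j d1 d2 \<tau> f (s d1 (scomp d1 \<tau> f) x)) = f x"
      using S.bundle_map_props(2)[OF H.bundle_map_M[OF \<tau> f] s1(1)] H.covers_M[OF \<tau> f] s1 by (auto simp: covers_def)
    have "M j d1 n (sid n) (scomp d1 \<tau> f) (s d1 (scomp d1 \<tau> f) x) =
        M j d2 n (sid n) \<tau> (M j d1 d2 \<tau> f (s d1 (scomp d1 \<tau> f) x))"
      using H.M_comp_apply[OF sid_smooth f \<tau>] s1(1) by (simp add: sid_scomp[OF \<tau>] sid_scomp[OF \<tau>f])
    then have eq: "M j d2 n (sid n) \<tau> (M j d1 d2 \<tau> f (s d1 (scomp d1 \<tau> f) x)) = M j d2 n (sid n) \<tau> (s d2 \<tau> (f x))"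
      using s(2)[OF \<tau>f x] s(2)[OF \<tau> fx] x by (simp add: scomp_apply)
    show ?thesis
      by (rule T.fiber_unique[OF Mt(1)[OF \<tau>] Ms(1) s2(1) _ eq]) (simp add: Ms s2)
  qed
  with s(1) show ?thesis unfolding section_family_def by (blast dest: face_smooth)
qed

text \<open>A section over some facets extends over one more facet: compare it with an arbitrary section
  over the new facet and extend the ratio, a group-valued function on the points of the simplex.\<close>

lemma common_section_family:
  assumes "finite J" "\<And>j. j \<in> J \<Longrightarrow> idx j"
  shows "\<exists>s. \<forall>j\<in>J. section_family j s"
  using assms
proof (induction J rule: finite_induct)
  case (insert j J)
  then obtain s where s: "\<And>i. i \<in> J \<Longrightarrow> section_family i s" by auto
  have j: "idx j" and J: "\<And>i. i \<in> J \<Longrightarrow> idx i" using insert.prems by auto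
  obtain u where u: "section_family j u" using section_family_exists[OF j] by blast
  interpret H: simplicial_bundle G n "H j" by unfold_locales (rule H_bundle[OF j])
  \<comment> \<open>To be extended, the ratio of the two families has to be a function of points. It
    is read off at 0-simplices, and naturality of both families shows that it is the ratio over
    every simplex (\<open>a_eq\<close>).\<close>
  define a where "a y = lie_bundle.dv G (B j 0 (pt y)) (u 0 (pt y) origin) (s 0 (pt y) origin)" for y
  have s_sec: "lie_bundle.sec G (B j d \<tau>) (geom_simplex d) (s d \<tau>)"
    if "i \<in> J" "face n i d \<tau>" "face n j d \<tau>" for i d \<tau>
    using section_familyD(1)[OF s[OF that(1)] that(2)] overlap(1)[OF J[OF that(1)] j that(2,3)] by simp
  have s_nat: "M j d1 d2 \<tau> f (s d1 (scomp d1 \<tau> f) x) = s d2 \<tau> (f x)"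
    if "i \<in> J" "face n i d2 \<tau>" "face n j d2 \<tau>" "f \<in> smooth_maps d1 d2" "x \<in> geom_simplex d1" for i d1 d2 \<tau> f x
    using section_familyD(2)[OF s[OF that(1)] that(2,4,5)] overlap(2)[OF J[OF that(1)] j that(2,3,4)] by simp
  have a_eq: "a (\<tau> x) = lie_bundle.dv G (B j d \<tau>) (u d \<tau> x) (s d \<tau> x)"
    if i: "i \<in> J" and \<tau>i: "face n i d \<tau>" and \<tau>j: "face n j d \<tau>" and x: "x \<in> geom_simplex d" for i d \<tau> x
  proof -
    note \<tau> = face_smooth[OF \<tau>i] and px = pt_smooth[OF x]
    have p\<tau>: "pt (\<tau> x) \<in> smooth_maps 0 n" by (rule pt_smooth[OF smooth_maps_in[OF \<tau> x]])
    interpret two_bundles G "B j 0 (pt (\<tau> x))" "B j d \<tau>"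
      by (rule two_bundlesI[OF H.bundle_B[OF p\<tau>] H.bundle_B[OF \<tau>]])
    have fp: "face n i 0 (pt (\<tau> x))" "face n j 0 (pt (\<tau> x))"
      using face_scomp[OF \<tau>i px] face_scomp[OF \<tau>j px] by (simp_all add: scomp_pt)
    note us = P.secD(2,3)[OF section_familyD(1)[OF u fp(2)] origin_in] P.secD(2,3)[OF s_sec[OF i fp] origin_in]
    have "Q.dv (M j 0 d \<tau> (pt x) (u 0 (pt (\<tau> x)) origin)) (M j 0 d \<tau> (pt x) (s 0 (pt (\<tau> x)) origin)) = a (\<tau> x)"
      unfolding a_def
      by (rule dv_bundle_map) (use H.bundle_map_M[OF \<tau> px] H.covers_M[OF \<tau> px] us in \<open>simp_all add: scomp_pt\<close>)
    then show ?thesis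
      using section_familyD(2)[OF u \<tau>j px origin_in] s_nat[OF i \<tau>i \<tau>j px origin_in] by (simp add: scomp_pt)
  qed
  have "\<exists>b. (\<forall>d \<tau>. face n j d \<tau> \<longrightarrow> ext d (geom_simplex d) (\<lambda>x. b (\<tau> x))) \<and>
    (\<forall>i\<in>J. \<forall>y\<in>geom_simplex n. barycentric n y i = 0 \<longrightarrow> barycentric n y j = 0 \<longrightarrow> b y = a y)"
  proof (rule extend_from_faces[OF k])
    fix i d \<tau> assume i: "i \<in> J" and \<tau>i: "face n i d \<tau>" and \<tau>j: "face n j d \<tau>"
    note \<tau> = face_smooth[OF \<tau>i]
    interpret lie_bundle G "B j d \<tau>" by (rule lie_bundleI[OF H.bundle_B[OF \<tau>]])
    have "ext d (geom_simplex d) (\<lambda>x. dv (u d \<tau> x) (s d \<tau> x))"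
      using sec_dv[OF section_familyD(1)[OF u \<tau>j] s_sec[OF i \<tau>i \<tau>j]] H.base_B[OF \<tau>] by simp
    then show "ext d (geom_simplex d) (\<lambda>x. a (\<tau> x))"
      by (rule ext_cong) (simp add: a_eq[OF i \<tau>i \<tau>j])
  qed (use j J insert.hyps in \<open>auto simp: idx_def\<close>)
  then obtain b where b: "\<And>d \<tau>. face n j d \<tau> \<Longrightarrow> ext d (geom_simplex d) (\<lambda>x. b (\<tau> x))"
    "\<And>i y. i \<in> J \<Longrightarrow> y \<in> geom_simplex n \<Longrightarrow> barycentric n y i = 0 \<Longrightarrow> barycentric n y j = 0 \<Longrightarrow> b y = a y"
    by blast
  \<comment> \<open>On simplices of the old facets \<open>s\<close> is kept literally, so these
    facets retain their section family. If such a simplex lies in the facet of \<open>j\<close> as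
    well, both branches agree by the choice of \<open>b\<close>.\<close>
  define t where "t d \<tau> = (if \<exists>i\<in>J. face n i d \<tau> then s d \<tau> else (\<lambda>x. act (B j d \<tau>) (u d \<tau> x, b (\<tau> x))))" for d \<tau>
  have t_s: "t d \<tau> = s d \<tau>" if "i \<in> J" "face n i d \<tau>" for i d \<tau>
    using that by (auto simp: t_def)
  have t_j: "t d \<tau> x = act (B j d \<tau>) (u d \<tau> x, b (\<tau> x))" if \<tau>j: "face n j d \<tau>" and x: "x \<in> geom_simplex d" for d \<tau> x
  proof (cases "\<exists>i\<in>J. face n i d \<tau>")
    case True
    then obtain i where i: "i \<in> J" "face n i d \<tau>" by blast
    note \<tau> = face_smooth[OF \<tau>j]
    interpret lie_bundle G "B j d \<tau>" by (rule lie_bundleI[OF H.bundle_B[OF \<tau>]])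
    have "b (\<tau> x) = dv (u d \<tau> x) (s d \<tau> x)"
      using b(2)[OF i(1) smooth_maps_in[OF \<tau> x]] i(2) \<tau>j x a_eq[OF i \<tau>j x] by (simp add: face_def)
    then show ?thesis
      using t_s[OF i] dv_props(2) secD(2,3)[OF section_familyD(1)[OF u \<tau>j] x] secD(2,3)[OF s_sec[OF i \<tau>j] x] by simp
  qed (simp add: t_def)
  have "section_family i t" if i: "i \<in> J" for i
    unfolding section_family_def
  proof (intro conjI allI impI)
    show "lie_bundle.sec G (B i d \<tau>) (geom_simplex d) (t d \<tau>)" if "face n i d \<tau>" for d \<tau>
      using section_familyD(1)[OF s[OF i] that] t_s[OF i that] by simp
    show "M i d1 d2 \<tau> f (t d1 (scomp d1 \<tau> f) x) = t d2 \<tau> (f x)"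
      if "face n i d2 \<tau>" "f \<in> smooth_maps d1 d2" "x \<in> geom_simplex d1" for d1 d2 \<tau> f x
      using section_familyD(2)[OF s[OF i] that] t_s[OF i that(1)] t_s[OF i face_scomp[OF that(1,2)]] by simp
  qed
  moreover have "section_family j t"
    unfolding section_family_def
  proof (intro conjI allI impI)
    fix d \<tau> assume \<tau>j: "face n j d \<tau>"
    note \<tau> = face_smooth[OF \<tau>j]
    interpret lie_bundle G "B j d \<tau>" by (rule lie_bundleI[OF H.bundle_B[OF \<tau>]])
    have "sec (geom_simplex d) (\<lambda>x. act (B j d \<tau>) (u d \<tau> x, b (\<tau> x)))"
      by (rule sec_mult[OF section_familyD(1)[OF u \<tau>j]]) (use b(1)[OF \<tau>j] H.base_B[OF \<tau>] in simp)
    then show "sec (geom_simplex d) (t d \<tau>)"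
      by (rule sec_cong) (simp add: t_j[OF \<tau>j])
  next
    fix d1 d2 \<tau> f x assume \<tau>j: "face n j d2 \<tau>" and f: "f \<in> smooth_maps d1 d2" and x: "x \<in> geom_simplex d1"
    note \<tau> = face_smooth[OF \<tau>j] and \<tau>fj = face_scomp[OF \<tau>j f]
    interpret two_bundles G "B j d1 (scomp d1 \<tau> f)" "B j d2 \<tau>"
      by (rule two_bundlesI[OF H.bundle_B[OF face_smooth[OF \<tau>fj]] H.bundle_B[OF \<tau>]])
    have "b (\<tau> (f x)) \<in> carrier G"
      using ext_in[OF b(1)[OF \<tau>j] smooth_maps_in[OF f x]] .
    then have "M j d1 d2 \<tau> f (act (B j d1 (scomp d1 \<tau> f)) (u d1 (scomp d1 \<tau> f) x, b (\<tau> (f x)))) =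
        act (B j d2 \<tau>) (u d2 \<tau> (f x), b (\<tau> (f x)))"
      using bundle_map_props(3)[OF H.bundle_map_M[OF \<tau> f]] P.secD(2)[OF section_familyD(1)[OF u \<tau>fj] x]
        section_familyD(2)[OF u \<tau>j f x] by simp
    then show "M j d1 d2 \<tau> f (t d1 (scomp d1 \<tau> f) x) = t d2 \<tau> (f x)"
      using t_j[OF \<tau>fj x] t_j[OF \<tau>j smooth_maps_in[OF f x]] x by (simp add: scomp_apply)
  qed
  ultimately show ?case by (intro exI[of _ t]) auto
qed simp

text \<open>The filler agrees with the horn on simplices lying in it; all other simplices are first
  projected to the vertex \<open>k\<close>. A section of everything in sight turns this into a functor.\<close>

definition in_horn :: "nat \<Rightarrow> (point \<Rightarrow> point) \<Rightarrow> bool" where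
  "in_horn d \<tau> \<longleftrightarrow> (\<exists>j. idx j \<and> face n j d \<tau>)"

text \<open>This is not natural in \<open>\<tau>\<close>: a simplex outside may restrict to one
  inside a facet. A simplex whose image lies in the union of the facets but in none of them also
  counts as outside.\<close>

definition proj_horn :: "nat \<Rightarrow> (point \<Rightarrow> point) \<Rightarrow> point \<Rightarrow> point" where
  "proj_horn d \<tau> = (if in_horn d \<tau> then \<tau> else scomp d (affine_simplex_map n (\<lambda>_. k)) \<tau>)"

text \<open>A choice among the facets containing the projected simplex; by \<open>overlap\<close>
  the bundle obtained does not depend on it.\<close>

definition facet :: "nat \<Rightarrow> (point \<Rightarrow> point) \<Rightarrow> nat" where
  "facet d \<tau> = (SOME j. idx j \<and> face n j d (proj_horn d \<tau>))"

lemma facet: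
  assumes \<tau>: "\<tau> \<in> smooth_maps d n"
  shows "idx (facet d \<tau>)" "face n (facet d \<tau>) d (proj_horn d \<tau>)"
proof -
  have "\<exists>j. idx j \<and> face n j d (proj_horn d \<tau>)"
  proof (cases "in_horn d \<tau>")
    case True
    then show ?thesis by (simp add: in_horn_def proj_horn_def)
  next
    case False
    \<comment> \<open>As \<open>n\<close> is positive, there is a vertex other than
      \<open>k\<close>, and the facet opposite to it contains \<open>k\<close>.\<close>
    have "idx (if k = 0 then 1 else 0)" unfolding idx_def using n by auto
    then obtain j where j: "idx j" by blast
    have c: "affine_simplex_map n (\<lambda>_. k) \<in> smooth_maps n n" by (rule affine_smooth) (rule k)
    have "barycentric n (affine_simplex_map n (\<lambda>_. k) y) j = 0" if "y \<in> geom_simplex n" for y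
      using barycentric_affine_simplex_map[of n "\<lambda>_. k" n j y] k j that by (simp add: idx_def)
    then have "face n j d (proj_horn d \<tau>)"
      using False smooth_maps_scomp[OF \<tau> c] smooth_maps_in[OF \<tau>] by (simp add: proj_horn_def face_def scomp_apply)
    then show ?thesis using j by blast
  qed
  from someI_ex[OF this] show "idx (facet d \<tau>)" "face n (facet d \<tau>) d (proj_horn d \<tau>)"
    by (simp_all add: facet_def)
qed

definition FB :: "nat \<Rightarrow> (point \<Rightarrow> point) \<Rightarrow> ('v, 'v) gbundle" where
  "FB d \<tau> = B (facet d \<tau>) d (proj_horn d \<tau>)"

lemma FB_props:
  assumes \<tau>: "\<tau> \<in> smooth_maps d n"
  shows "smooth_bundle G (FB d \<tau>)" "base_dim (FB d \<tau>) = d" "belongs_to (tot (FB d \<tau>)) U"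
proof -
  interpret H: simplicial_bundle G n "H (facet d \<tau>)" by unfold_locales (rule H_bundle[OF facet(1)[OF \<tau>]])
  note p = face_smooth[OF facet(2)[OF \<tau>]]
  show "smooth_bundle G (FB d \<tau>)" "base_dim (FB d \<tau>) = d"
    using H.bundle_B[OF p] H.base_B[OF p] by (simp_all add: FB_def)
  have "small_simplicial_bundle U n (H (facet d \<tau>))"
    using H_in[OF facet(1)[OF \<tau>]] by (simp add: simplices_BG)
  then show "belongs_to (tot (FB d \<tau>)) U" using p by (simp add: small_iff[OF adm] FB_def)
qed

lemma FB_face:
  assumes j: "idx j" and \<tau>: "face n j d \<tau>"
  shows "FB d \<tau> = B j d \<tau>" "proj_horn d \<tau> = \<tau>"
proof -
  show p: "proj_horn d \<tau> = \<tau>" using assms by (auto simp: proj_horn_def in_horn_def)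
  show "FB d \<tau> = B j d \<tau>"
    using overlap(1)[OF facet(1) j] facet[OF face_smooth[OF \<tau>]] \<tau> p face_smooth[OF \<tau>] by (simp add: FB_def)
qed

theorem horn_filler:
  "\<exists>F\<in>simplices (BG G U) n. \<forall>m. \<forall>f\<in>simplices (horn_sset n k) m. pull m (affine_simplex_map m f) F = h m f"
proof -
  have "finite {j. idx j}" by (rule finite_subset[of _ "{..n}"]) (auto simp: idx_def)
  then have "\<exists>s. \<forall>j\<in>{j. idx j}. section_family j s"
    by (rule common_section_family) simp
  then obtain s0 where "\<forall>j\<in>{j. idx j}. section_family j s0" by (rule exE)
  then have s0: "section_family j s0" if "idx j" for j
    by (rule bspec) (simp add: that)
  define s where "s d \<tau> = s0 d (proj_horn d \<tau>)" for d \<tau>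
  have s: "lie_bundle.sec G (FB d \<tau>) (geom_simplex d) (s d \<tau>)" if "\<tau> \<in> smooth_maps d n" for d \<tau>
    unfolding FB_def s_def by (rule section_familyD(1)[OF s0[OF facet(1)[OF that]] facet(2)[OF that]])
  have s_face: "s d \<tau> = s0 d \<tau>" if "idx j" "face n j d \<tau>" for j d \<tau>
    using FB_face(2)[OF that] by (simp add: s_def)
  \<comment> \<open>Source and target bundles may stem from different facets, or one from the
    simplex itself and the other from the constant simplex at \<open>k\<close>, with no given map
    between them; the sections provide one uniformly in all cases.\<close>
  define smap where "smap d1 \<tau>1 d2 \<tau>2 f = two_bundles.sec_map G (FB d1 \<tau>1) (FB d2 \<tau>2) (s d1 \<tau>1) (s d2 \<tau>2) f" for d1 \<tau>1 d2 \<tau>2 f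
  define F :: "('v, 'v) simplicial_bundle" where
    "F = \<lparr>fobj = (\<lambda>a\<in>ob (dsm_cat n). FB (fst a) (unobj a)),
          fmor = (\<lambda>(a, b, f)\<in>arrows (dsm_cat n). smap (fst a) (unobj a) (fst b) (unobj b) f)\<rparr>"
  have Fobj: "fobj F (obj d \<tau>) = FB d \<tau>" if "\<tau> \<in> smooth_maps d n" for d \<tau>
    using that by (simp add: F_def)
  have Fmor: "fmor F (mor d1 (scomp d1 \<tau> f) d2 \<tau> f) = smap d1 (scomp d1 \<tau> f) d2 \<tau> f"
    if "\<tau> \<in> smooth_maps d2 n" "f \<in> smooth_maps d1 d2" for d1 d2 \<tau> f
    using mor_arrow[OF that] that smooth_maps_scomp[OF that(2,1)] by (simp add: F_def mor_def)
  have F: "is_simplicial_bundle G n F"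
  proof (rule is_simplicial_bundleI)
    show "fobj F \<in> extensional (ob (dsm_cat n))" "fmor F \<in> extensional (arrows (dsm_cat n))"
      by (simp_all add: F_def)
    show "smooth_bundle G (fobj F (obj d \<tau>)) \<and> base_dim (fobj F (obj d \<tau>)) = d" if "\<tau> \<in> smooth_maps d n" for d \<tau>
      using FB_props[OF that] by (simp add: Fobj[OF that])
  next
    fix d1 d2 \<tau> f assume \<tau>: "\<tau> \<in> smooth_maps d2 n" and f: "f \<in> smooth_maps d1 d2"
    have \<tau>f: "scomp d1 \<tau> f \<in> smooth_maps d1 n" by (rule smooth_maps_scomp[OF f \<tau>])
    interpret two_bundles G "FB d1 (scomp d1 \<tau> f)" "FB d2 \<tau>"
      by (rule two_bundlesI[OF FB_props(1)[OF \<tau>f] FB_props(1)[OF \<tau>]])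
    note d = FB_props(2)[OF \<tau>f] FB_props(2)[OF \<tau>]
    show "smooth_bundle_map G (fobj F (obj d1 (scomp d1 \<tau> f))) (fobj F (obj d2 \<tau>)) (fmor F (mor d1 (scomp d1 \<tau> f) d2 \<tau> f)) \<and>
        covers (fobj F (obj d1 (scomp d1 \<tau> f))) (fobj F (obj d2 \<tau>)) (fmor F (mor d1 (scomp d1 \<tau> f) d2 \<tau> f)) f"
      unfolding Fobj[OF \<tau>] Fobj[OF \<tau>f] Fmor[OF \<tau> f] smap_def
      using smooth_sec_map[of "s d1 (scomp d1 \<tau> f)" "s d2 \<tau>" f] covers_sec_map[of "s d1 (scomp d1 \<tau> f)" "s d2 \<tau>" f]
        s[OF \<tau>] s[OF \<tau>f] f d by simp
  next
    fix d \<tau> assume \<tau>: "\<tau> \<in> smooth_maps d n"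
    interpret two_bundles G "FB d \<tau>" "FB d \<tau>" by (rule two_bundlesI[OF FB_props(1)[OF \<tau>] FB_props(1)[OF \<tau>]])
    have "sec_map (s d \<tau>) (s d \<tau>) (sid d) p = p" if p: "p \<in> tot (FB d \<tau>)" for p
    proof -
      have x: "proj (FB d \<tau>) p \<in> geom_simplex d" using P.pr_in[OF p] FB_props(2)[OF \<tau>] by simp
      then show ?thesis
        using p P.dv_props(2)[OF _ p] P.secD(2,3)[OF s[OF \<tau>] x] by (simp add: sec_map_def)
    qed
    then show "fmor F (mor d \<tau> d \<tau> (sid d)) = (\<lambda>p\<in>topspace (total (fobj F (obj d \<tau>))). p)"
      using Fmor[OF \<tau> sid_smooth] scomp_sid[OF \<tau>]
      by (auto simp: Fobj[OF \<tau>] smap_def fun_eq_iff sec_map_def)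
  next
    fix d1 d2 d3 \<tau> f g assume \<tau>: "\<tau> \<in> smooth_maps d3 n" and f: "f \<in> smooth_maps d1 d2" and g: "g \<in> smooth_maps d2 d3"
    have gf: "scomp d1 g f \<in> smooth_maps d1 d3" by (rule smooth_maps_scomp[OF f g])
    have \<tau>2: "scomp d2 \<tau> g \<in> smooth_maps d2 n" by (rule smooth_maps_scomp[OF g \<tau>])
    have \<tau>1: "scomp d1 \<tau> (scomp d1 g f) \<in> smooth_maps d1 n" by (rule smooth_maps_scomp[OF gf \<tau>])
    have e: "scomp d1 \<tau> (scomp d1 g f) = scomp d1 (scomp d2 \<tau> g) f" using scomp_assoc[OF f] by simp
    let ?\<tau>1 = "scomp d1 \<tau> (scomp d1 g f)" and ?\<tau>2 = "scomp d2 \<tau> g"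
    interpret A: two_bundles G "FB d1 ?\<tau>1" "FB d2 ?\<tau>2" by (rule two_bundlesI[OF FB_props(1)[OF \<tau>1] FB_props(1)[OF \<tau>2]])
    interpret B: two_bundles G "FB d2 ?\<tau>2" "FB d3 \<tau>" by (rule two_bundlesI[OF FB_props(1)[OF \<tau>2] FB_props(1)[OF \<tau>]])
    interpret C: two_bundles G "FB d1 ?\<tau>1" "FB d3 \<tau>" by (rule two_bundlesI[OF FB_props(1)[OF \<tau>1] FB_props(1)[OF \<tau>]])
    note d = FB_props(2)[OF \<tau>] FB_props(2)[OF \<tau>2] FB_props(2)[OF \<tau>1]
    \<comment> \<open>Each map sends a translate of a section value to the same translate of another
      section value. The translating element is carried along unchanged, and this is
      functoriality.\<close>
    have pointwise: "C.sec_map (s d1 ?\<tau>1) (s d3 \<tau>) (scomp d1 g f) p =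
      B.sec_map (s d2 ?\<tau>2) (s d3 \<tau>) g (A.sec_map (s d1 ?\<tau>1) (s d2 ?\<tau>2) f p)" if p: "p \<in> tot (FB d1 ?\<tau>1)" for p
    proof -
      have x: "proj (FB d1 ?\<tau>1) p \<in> geom_simplex d1" using A.P.pr_in[OF p] d by simp
      have sx: "s d1 ?\<tau>1 (proj (FB d1 ?\<tau>1) p) \<in> A.P.T" "proj (FB d1 ?\<tau>1) (s d1 ?\<tau>1 (proj (FB d1 ?\<tau>1) p)) = proj (FB d1 ?\<tau>1) p"
        using A.P.secD(2,3)[OF s[OF \<tau>1] x] .
      have "B.sec_map (s d2 ?\<tau>2) (s d3 \<tau>) g (act (FB d2 ?\<tau>2) (s d2 ?\<tau>2 (f (proj (FB d1 ?\<tau>1) p)), A.P.dv (s d1 ?\<tau>1 (proj (FB d1 ?\<tau>1) p)) p))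
        = act (FB d3 \<tau>) (s d3 \<tau> (g (f (proj (FB d1 ?\<tau>1) p))), A.P.dv (s d1 ?\<tau>1 (proj (FB d1 ?\<tau>1) p)) p)"
        by (rule B.sec_map_act) (use s[OF \<tau>2] s[OF \<tau>] g d smooth_maps_in[OF f x] A.P.dv_props(1)[OF sx(1) p sx(2)] in simp_all)
      then show ?thesis using p x by (simp add: A.sec_map_def C.sec_map_def scomp_apply)
    qed
    have comp: "C.sec_map (s d1 ?\<tau>1) (s d3 \<tau>) (scomp d1 g f) =
      compose (tot (FB d1 ?\<tau>1)) (B.sec_map (s d2 ?\<tau>2) (s d3 \<tau>) g) (A.sec_map (s d1 ?\<tau>1) (s d2 ?\<tau>2) f)"
    proof (rule extensionalityI[of _ "tot (FB d1 ?\<tau>1)"])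
      show "C.sec_map (s d1 ?\<tau>1) (s d3 \<tau>) (scomp d1 g f) p =
        compose (tot (FB d1 ?\<tau>1)) (B.sec_map (s d2 ?\<tau>2) (s d3 \<tau>) g) (A.sec_map (s d1 ?\<tau>1) (s d2 ?\<tau>2) f) p"
        if "p \<in> tot (FB d1 ?\<tau>1)" for p
        unfolding compose_eq[OF that] by (rule pointwise[OF that])
    qed (simp_all add: C.sec_map_def)
    have Ff: "fmor F (mor d1 ?\<tau>1 d2 ?\<tau>2 f) = smap d1 ?\<tau>1 d2 ?\<tau>2 f"
      unfolding e by (rule Fmor[OF \<tau>2 f])
    show "fmor F (mor d1 ?\<tau>1 d3 \<tau> (scomp d1 g f)) =
        compose (topspace (total (fobj F (obj d1 ?\<tau>1)))) (fmor F (mor d2 ?\<tau>2 d3 \<tau> g)) (fmor F (mor d1 ?\<tau>1 d2 ?\<tau>2 f))"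
      unfolding Fobj[OF \<tau>1] Fmor[OF \<tau> gf] Fmor[OF \<tau> g] Ff smap_def by (rule comp)
  qed
  have "small_simplicial_bundle U n F"
    using FB_props(3) by (simp add: small_iff[OF adm] Fobj)
  with F have FBG: "F \<in> simplices (BG G U) n" by (simp add: simplices_BG)
  have "pull m (affine_simplex_map m f) F = h m f" if hf: "f \<in> simplices (horn_sset n k) m" for m f
  proof -
    obtain j where f: "f \<in> delta_hom m n" and j: "idx j" "j \<notin> f ` {..m}"
      using hf by (auto simp: horn_sset_def idx_def)
    let ?\<alpha> = "affine_simplex_map m f"
    have \<alpha>: "?\<alpha> \<in> smooth_maps m n" by (rule affine_smooth[OF delta_hom_le[OF f]])
    have \<alpha>j: "barycentric n (?\<alpha> y) j = 0" if "y \<in> geom_simplex m" for y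
    proof -
      have empty: "{a. a \<le> m \<and> f a = j} = {}" using j(2) by auto
      have "barycentric n (?\<alpha> y) j = (\<Sum>a | a \<le> m \<and> f a = j. barycentric m y a)"
        by (rule barycentric_affine_simplex_map[OF delta_hom_le[OF f] _ that]) (use j(1) in \<open>auto simp: idx_def\<close>)
      then show ?thesis by (simp only: empty sum.empty)
    qed
    have face: "face n j d (scomp d ?\<alpha> \<sigma>)" if "\<sigma> \<in> smooth_maps d m" for d \<sigma>
      using smooth_maps_scomp[OF that \<alpha>] \<alpha>j smooth_maps_in[OF that] by (simp add: face_def scomp_apply)
    interpret H: simplicial_bundle G n "H j" by unfold_locales (rule H_bundle[OF j(1)])
    have "pull m ?\<alpha> F = pull m ?\<alpha> (H j)"
    proof (rule functor_eqI[OF pull_ext pull_ext])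
      fix d \<sigma> assume \<sigma>: "\<sigma> \<in> smooth_maps d m"
      show "fobj (pull m ?\<alpha> F) (obj d \<sigma>) = fobj (pull m ?\<alpha> (H j)) (obj d \<sigma>)"
        using FB_face(1)[OF j(1) face[OF \<sigma>]] Fobj[OF face_smooth[OF face[OF \<sigma>]]] by (simp add: fobj_pull[OF \<sigma>])
    next
      fix d1 d2 \<sigma> g assume \<sigma>: "\<sigma> \<in> smooth_maps d2 m" and g: "g \<in> smooth_maps d1 d2"
      have \<sigma>g: "scomp d1 \<sigma> g \<in> smooth_maps d1 m" by (rule smooth_maps_scomp[OF g \<sigma>])
      let ?\<tau> = "scomp d2 ?\<alpha> \<sigma>"
      have e: "scomp d1 ?\<alpha> (scomp d1 \<sigma> g) = scomp d1 ?\<tau> g" using scomp_assoc[OF g] by simp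
      have \<tau>j: "face n j d2 ?\<tau>" by (rule face[OF \<sigma>])
      have \<tau>gj: "face n j d1 (scomp d1 ?\<tau> g)" by (rule face_scomp[OF \<tau>j g])
      note \<tau> = face_smooth[OF \<tau>j] and \<tau>g = face_smooth[OF \<tau>gj]
      interpret two_bundles G "B j d1 (scomp d1 ?\<tau> g)" "B j d2 ?\<tau>"
        by (rule two_bundlesI[OF H.bundle_B[OF \<tau>g] H.bundle_B[OF \<tau>]])
      note d = H.base_B[OF \<tau>g] H.base_B[OF \<tau>]
      \<comment> \<open>The maps of the horn carry \<open>s0\<close> to \<open>s0\<close> by
        naturality of the family, so uniqueness forces them to be the maps used by the
        filler.\<close>
      have "M j d1 d2 ?\<tau> g = sec_map (s0 d1 (scomp d1 ?\<tau> g)) (s0 d2 ?\<tau>) g"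
        by (rule sec_map_unique)
           (use section_familyD[OF s0[OF j(1)]] \<tau>j \<tau>gj g d H.bundle_map_M[OF \<tau> g] in simp_all)
      then have "fmor F (mor d1 (scomp d1 ?\<tau> g) d2 ?\<tau> g) = M j d1 d2 ?\<tau> g"
        using Fmor[OF \<tau> g] FB_face(1)[OF j(1) \<tau>j] FB_face(1)[OF j(1) \<tau>gj] s_face[OF j(1) \<tau>j] s_face[OF j(1) \<tau>gj]
        by (simp add: smap_def)
      then show "fmor (pull m ?\<alpha> F) (mor d1 (scomp d1 \<sigma> g) d2 \<sigma> g) = fmor (pull m ?\<alpha> (H j)) (mor d1 (scomp d1 \<sigma> g) d2 \<sigma> g)"
        unfolding fmor_pull[OF \<sigma>g \<sigma> mor_arrow[OF \<sigma> g]] e .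
    qed
    also have "\<dots> = h m f" by (rule h_eq_pull[OF j(1) f j(2), symmetric])
    finally show ?thesis .
  qed
  with FBG show ?thesis by blast
qed

end

theorem proposition8p4:
  fixes G :: "('v::zf_sets, 'e::locally_convex_space) lie_group" and U :: 'v
  assumes "locally_convex_lie_group G"
    and "admissible_universe G U"
  shows "kan_complex (BG G U)"
  unfolding kan_complex_def
proof (intro conjI allI impI)
  have ss: "simplicial_set (BG G U)" by (rule simplicial_set_BG[OF assms(2)])
  then show "simplicial_set (BG G U)" .
  fix n k h assume nk: "1 \<le> n" "k \<le> n" and h: "simplicial_map (horn_sset n k) (BG G U) h"
  interpret horn_filling G U n k h by unfold_locales (use assms nk h in auto)
  obtain F where F: "F \<in> simplices (BG G U) n"
    "\<And>m f. f \<in> simplices (horn_sset n k) m \<Longrightarrow> pull m (affine_simplex_map m f) F = h m f"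
    using horn_filler by blast
  \<comment> \<open>By the Yoneda lemma, a map from the standard simplex is given by an
    \<open>n\<close>-simplex, here \<open>F\<close>, together with its structure maps.\<close>
  let ?s = "\<lambda>m f. struct_map (BG G U) m n f F"
  have "simplicial_map (simplex_sset n) (BG G U) ?s"
    using ss F(1) unfolding simplicial_map_def simplicial_set_def simplex_sset_def by auto
  then show "\<exists>s. simplicial_map (simplex_sset n) (BG G U) s \<and>
      (\<forall>m. \<forall>f\<in>simplices (horn_sset n k) m. s m f = h m f)"
    using F(2) by (intro exI[of _ ?s]) (simp add: struct_map_BG)
qed

end
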